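(* For a graph $G$, $\mathrm{la}_{\boxtimes}(G)\le 2$ if and only if $G$ has no minor isomorphic to any of the graphs $F_3$, $H_3$, $W_5$.
   Context: All graphs are finite and simple. A graph $M$ is a minor of $G$ if it can be obtained from $G$ by a series of edge deletions, edge contractions and node deletions. Strong product: for graphs $G=(V,E)$, $G'=(V',E')$, $G\boxtimes G'$ has node set $V\times V'$, and distinct nodes $(i,i'),(j,j')$ are adjacent when ($i=j$ or $\{i,j\}\in E$) and ($i'=j'$ or $\{i',j'\}\in E'$). The strong largeur d'arborescence $\mathrm{la}_{\boxtimes}(G)$ is the smallest integer $k\ge 1$ for which $G$ is a minor of $T\boxtimes K_k$ for some tree $T$. The graph $F_3$ has 6 nodes $v_1,v_2,v_3,v_{12},v_{13},v_{23}$; its edges are the three edges of the triangle on $\{v_1,v_2,v_3\}$ together with the edges $\{v_i,v_{ij}\}$ and $\{v_j,v_{ij}\}$ for $1\le i<j\le 3$. The graph $H_3$ is obtained from the complete graph $K_4$ on nodes $v_1,v_2,v_3,v_{13}$ by subdividing the edge $\{v_1,v_2\}$ with a new node $v_{12}$ and the edge $\{v_2,v_3\}$ with a new node $v_{23}$. The wheel $W_5$ is the graph on 5 nodes obtained from the circuit $C_4$ by adding a node adjacent to all nodes of $C_4$. *)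

theory Defs
  imports "Graph_Theory.Graph_Theory"
begin

text \<open>
  A finite simple graph is a \<^typ>\<open>'a pair_pre_digraph\<close> satisfying \<^const>\<open>pair_graph\<close>: a
  finite vertex set with a symmetric irreflexive arc relation, the edge \<open>{u, v}\<close> being the pair of
  arcs \<open>(u, v)\<close>, \<open>(v, u)\<close>. The graph without nodes is included.
\<close>

section \<open>Minors\<close>

definition delete_edge :: "'a pair_pre_digraph \<Rightarrow> 'a \<Rightarrow> 'a \<Rightarrow> 'a pair_pre_digraph" where
  "delete_edge G u v = \<lparr>pverts = pverts G, parcs = parcs G - {(u, v), (v, u)}\<rparr>"

definition delete_node :: "'a pair_pre_digraph \<Rightarrow> 'a \<Rightarrow> 'a pair_pre_digraph" where
  "delete_node G v =
     \<lparr>pverts = pverts G - {v}, parcs = {(x, y) \<in> parcs G. x \<noteq> v \<and> y \<noteq> v}\<rparr>"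

text \<open>
  Contracting \<open>{u, v}\<close> keeps the name \<open>u\<close> for the merged node; the resulting loop is dropped and
  parallel edges coincide, so the result is again simple.
\<close>

definition contract_edge :: "'a pair_pre_digraph \<Rightarrow> 'a \<Rightarrow> 'a \<Rightarrow> 'a pair_pre_digraph" where
  "contract_edge G u v =
     \<lparr>pverts = pverts G - {v},
      parcs = {(x, y). x \<noteq> y \<and>
                 (\<exists>(a, b) \<in> parcs G. x = (if a = v then u else a) \<and> y = (if b = v then u else b))}\<rparr>"

inductive minor_step :: "'a pair_pre_digraph \<Rightarrow> 'a pair_pre_digraph \<Rightarrow> bool" where
  edge_deletion: "(u, v) \<in> parcs G \<Longrightarrow> minor_step G (delete_edge G u v)"
| edge_contraction: "(u, v) \<in> parcs G \<Longrightarrow> minor_step G (contract_edge G u v)"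
| node_deletion: "v \<in> pverts G \<Longrightarrow> minor_step G (delete_node G v)"

text \<open>As usual, being a minor is understood up to isomorphism.\<close>

definition minor :: "'a pair_pre_digraph \<Rightarrow> 'b pair_pre_digraph \<Rightarrow> bool" where
  "minor M G \<longleftrightarrow> (\<exists>H. minor_step\<^sup>*\<^sup>* G H \<and> digraph_iso (with_proj M) (with_proj H))"

section \<open>The strong largeur d'arborescence\<close>

text \<open>
  The constant \<^const>\<open>tree\<close> of the library is about digraphs: in a symmetric digraph it counts the
  closed walk \<open>u, v, u\<close> along one edge as a cycle. The cycles of the undirected graph are those of
  length at least 3. Note that \<^const>\<open>connected\<close> includes nonemptiness.
\<close>

definition undirected_tree :: "'a pair_pre_digraph \<Rightarrow> bool" where
  "undirected_tree T \<longleftrightarrow>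
     pair_graph T \<and> connected (with_proj T) \<and>
     \<not> (\<exists>p. pre_digraph.cycle (with_proj T) p \<and> 3 \<le> length p)"

definition complete_on :: "'a set \<Rightarrow> 'a pair_pre_digraph" where
  "complete_on V = \<lparr>pverts = V, parcs = {(x, y). x \<in> V \<and> y \<in> V \<and> x \<noteq> y}\<rparr>"

definition strong_product ::
    "'a pair_pre_digraph \<Rightarrow> 'b pair_pre_digraph \<Rightarrow> ('a \<times> 'b) pair_pre_digraph"  (infixl "\<boxtimes>" 70) where
  "G \<boxtimes> G' =
     \<lparr>pverts = pverts G \<times> pverts G',
      parcs = {((i, i'), (j, j')).
                 (i, i') \<in> pverts G \<times> pverts G' \<and> (j, j') \<in> pverts G \<times> pverts G' \<and>
                 (i, i') \<noteq> (j, j') \<and>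
                 (i = j \<or> (i, j) \<in> parcs G) \<and> (i' = j' \<or> (i', j') \<in> parcs G')}\<rparr>"

text \<open>
  Trees with natural numbers as nodes suffice, since trees are finite and minors are taken up to
  isomorphism. The least \<open>k\<close> exists by \<open>la_strong_exists\<close> below.
\<close>

definition la_strong :: "'a pair_pre_digraph \<Rightarrow> nat" where
  "la_strong G =
     (LEAST k. 1 \<le> k \<and>
        (\<exists>T :: nat pair_pre_digraph. undirected_tree T \<and> minor G (T \<boxtimes> complete_on {..<k})))"

section \<open>The graphs \<open>F\<^sub>3\<close>, \<open>H\<^sub>3\<close> and \<open>W\<^sub>5\<close>\<close>

datatype node = V1 | V2 | V3 | V12 | V13 | V23

definition F3 :: "node pair_pre_digraph" where
  "F3 = (let E = {(V1, V2), (V1, V3), (V2, V3),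
                  (V1, V12), (V2, V12), (V1, V13), (V3, V13), (V2, V23), (V3, V23)}
         in \<lparr>pverts = {V1, V2, V3, V12, V13, V23}, parcs = E \<union> E\<inverse>\<rparr>)"

definition H3 :: "node pair_pre_digraph" where
  "H3 = subdivide (subdivide (complete_on {V1, V2, V3, V13}) (V1, V2) V12) (V2, V3) V23"

text \<open>The circuit is on \<open>0, 1, 2, 3\<close>; the node \<open>4\<close> is the hub.\<close>

definition W5 :: "nat pair_pre_digraph" where
  "W5 = (let E = {(0, 1), (1, 2), (2, 3), (3, 0)} \<union> {4} \<times> {0, 1, 2, 3}
         in \<lparr>pverts = {0, 1, 2, 3, 4}, parcs = E \<union> E\<inverse>\<rparr>)"

section \<open>Sanity checks\<close>

lemma pair_graph_iff:
  "pair_graph G \<longleftrightarrow>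
     finite (pverts G) \<and> parcs G \<subseteq> pverts G \<times> pverts G \<and> sym (parcs G) \<and> irrefl (parcs G)"
proof
  assume "pair_graph G"
  then interpret pair_graph G .
  show "finite (pverts G) \<and> parcs G \<subseteq> pverts G \<times> pverts G \<and> sym (parcs G) \<and> irrefl (parcs G)"
    using pair_finite_verts in_arcsD1 in_arcsD2 pair_sym_arcs pair_no_loops
    by (fastforce simp: symmetric_def irrefl_def)
next
  assume *: "finite (pverts G) \<and> parcs G \<subseteq> pverts G \<times> pverts G \<and> sym (parcs G) \<and> irrefl (parcs G)"
  then have "finite (parcs G)"
    by (meson finite_SigmaI finite_subset)
  with * show "pair_graph G"
    by unfold_locales (auto simp: symmetric_def irrefl_def)
qed

lemma pair_graph_delete_edge: "pair_graph G \<Longrightarrow> pair_graph (delete_edge G u v)"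
  unfolding pair_graph_iff delete_edge_def sym_def irrefl_def by (simp, blast)

lemma pair_graph_delete_node: "pair_graph G \<Longrightarrow> pair_graph (delete_node G v)"
  unfolding pair_graph_iff delete_node_def sym_def irrefl_def by (simp, blast)

lemma pair_graph_contract_edge:
  assumes "pair_graph G" "(u, v) \<in> parcs G"
  shows "pair_graph (contract_edge G u v)"
proof -
  from assms(1) have fin: "finite (pverts G)" and wf: "parcs G \<subseteq> pverts G \<times> pverts G"
    and sym: "sym (parcs G)" and irr: "irrefl (parcs G)" by (simp_all add: pair_graph_iff)
  have "u \<in> pverts G - {v}" using assms(2) wf irr by (auto simp: irrefl_def)
  then have "parcs (contract_edge G u v) \<subseteq> pverts (contract_edge G u v) \<times> pverts (contract_edge G u v)"
    using wf by (auto simp: contract_edge_def split: if_splits)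
  moreover have "sym (parcs (contract_edge G u v))"
  proof (rule symI)
    fix x y assume "(x, y) \<in> parcs (contract_edge G u v)"
    then obtain a b where ab: "x \<noteq> y" "(a, b) \<in> parcs G" "x = (if a = v then u else a)"
      "y = (if b = v then u else b)"
      unfolding contract_edge_def by auto
    from ab(2) have "(b, a) \<in> parcs G" by (rule symD[OF sym])
    with ab show "(y, x) \<in> parcs (contract_edge G u v)"
      unfolding contract_edge_def by (auto intro!: bexI[of _ "(b, a)"])
  qed
  ultimately show ?thesis
    using fin by (simp add: pair_graph_iff contract_edge_def irrefl_def)
qed

lemma minor_step_pair_graph: "minor_step G H \<Longrightarrow> pair_graph G \<Longrightarrow> pair_graph H"
  by (induction rule: minor_step.induct)
    (simp_all add: pair_graph_delete_edge pair_graph_delete_node pair_graph_contract_edge)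

lemma pair_graph_complete_on: "finite V \<Longrightarrow> pair_graph (complete_on V)"
  by (auto simp: pair_graph_iff complete_on_def sym_def irrefl_def)

lemma complete_digraph_complete_on:
  "finite V \<Longrightarrow> complete_digraph (card V) (with_proj (complete_on V))"
  using pair_graph_complete_on[of V]
  by (auto simp: complete_digraph_def complete_on_def intro: pair_graph.pair_graphD_graph)

lemma pair_graph_strong_product: "pair_graph G \<Longrightarrow> pair_graph G' \<Longrightarrow> pair_graph (G \<boxtimes> G')"
  unfolding pair_graph_iff strong_product_def sym_def irrefl_def by auto

lemma pair_graph_symmetric_closure:
  assumes "finite V" "E \<subseteq> V \<times> V" "irrefl E"
  shows "pair_graph \<lparr>pverts = V, parcs = E \<union> E\<inverse>\<rparr>"
  using assms sym_Un_converse[of E] by (auto simp: pair_graph_iff irrefl_def)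

lemma pair_graph_F3: "pair_graph F3"
  unfolding F3_def Let_def by (rule pair_graph_symmetric_closure) (auto simp: irrefl_def)

lemma pair_graph_H3: "pair_graph H3"
proof -
  let ?K = "complete_on {V1, V2, V3, V13}"
  interpret K: pair_graph ?K by (rule pair_graph_complete_on) simp
  have "pair_graph (subdivide ?K (V1, V2) V12)"
    by (rule K.pair_graph_subdivide) (auto simp: complete_on_def)
  then interpret K': pair_graph "subdivide ?K (V1, V2) V12" .
  show ?thesis
    unfolding H3_def
    by (rule K'.pair_graph_subdivide) (auto simp: complete_on_def subdivide.simps)
qed

lemma pair_graph_W5: "pair_graph W5"
  unfolding W5_def Let_def by (rule pair_graph_symmetric_closure) (auto simp: irrefl_def)

lemma minor_steps_delete_edges:
  assumes "finite D" "D \<subseteq> parcs G" "sym D" "sym (parcs G)"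
  shows "minor_step\<^sup>*\<^sup>* G \<lparr>pverts = pverts G, parcs = parcs G - D\<rparr>"
  using assms
proof (induction "card D" arbitrary: D rule: less_induct)
  case less
  show ?case
  proof (cases "D = {}")
    case True
    then have "\<lparr>pverts = pverts G, parcs = parcs G - D\<rparr> = G" by simp
    then show ?thesis by simp
  next
    case False
    then obtain u v where uv: "(u, v) \<in> D" by auto
    let ?D = "D - {(u, v), (v, u)}"
    let ?G = "\<lparr>pverts = pverts G, parcs = parcs G - ?D\<rparr>"
    have "card ?D < card D"
      using uv less.prems(1) by (intro psubset_card_mono) auto
    moreover have "sym ?D" using less.prems(3) by (auto simp: sym_def)
    ultimately have "minor_step\<^sup>*\<^sup>* G ?G"
      using less.prems by (intro less.hyps) auto
    moreover have "minor_step ?G (delete_edge ?G u v)"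
      using uv less.prems(2) by (intro edge_deletion) auto
    moreover have "delete_edge ?G u v = \<lparr>pverts = pverts G, parcs = parcs G - D\<rparr>"
      using uv less.prems(3) by (auto simp: delete_edge_def sym_def)
    ultimately show ?thesis by (metis rtranclp.rtrancl_into_rtrancl)
  qed
qed

lemma undirected_tree_single: "undirected_tree (complete_on {0 :: nat})"
proof -
  have no_arc: "parcs (complete_on {0 :: nat}) = {}"
    by (auto simp: complete_on_def)
  have "p = []" if "pre_digraph.awalk (with_proj (complete_on {0 :: nat})) u p u" for u p
    using that by (auto simp: pre_digraph.awalk_def no_arc)
  moreover have "connected (with_proj (complete_on {0 :: nat}))"
    by (auto simp: connected_def strongly_connected_def mk_symmetric_def complete_on_def
        reachable_def intro: rtrancl_on_refl)
  ultimately show ?thesis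
    by (fastforce simp: undirected_tree_def pre_digraph.cycle_def pair_graph_complete_on)
qed

lemma la_strong_exists:
  assumes "pair_graph G"
  shows "\<exists>k \<ge> 1 :: nat. \<exists>T :: nat pair_pre_digraph.
           undirected_tree T \<and> minor G (T \<boxtimes> complete_on {..<k})"
proof -
  from assms have fin: "finite (pverts G)" and wf: "parcs G \<subseteq> pverts G \<times> pverts G"
    and sym: "sym (parcs G)" and irr: "irrefl (parcs G)" by (auto simp: pair_graph_iff)
  obtain h where h: "bij_betw h (pverts G) {0..<card (pverts G)}"
    using ex_bij_betw_finite_nat[OF fin] by blast
  show ?thesis
  proof (cases "pverts G = {}")
    case True
    let ?P = "complete_on {0 :: nat} \<boxtimes> complete_on {..<1 :: nat}"
    have "delete_node ?P (0, 0) = \<lparr>pverts = {}, parcs = {}\<rparr>"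
      by (auto simp: delete_node_def strong_product_def complete_on_def)
    moreover have "minor_step ?P (delete_node ?P (0, 0))"
      by (intro node_deletion) (auto simp: strong_product_def complete_on_def)
    ultimately have "minor_step\<^sup>*\<^sup>* ?P \<lparr>pverts = {}, parcs = {}\<rparr>" by auto
    moreover have "parcs G = {}" using wf True by auto
    then have "pre_digraph.digraph_isomorphism (with_proj G)
        \<lparr>iso_verts = \<lambda>_. (0, 0), iso_arcs = \<lambda>_. ((0, 0), (0, 0)), iso_head = snd, iso_tail = fst\<rparr>"
      using True by (auto simp: pre_digraph.digraph_isomorphism_def wf_digraph_def)
    then have "digraph_iso (with_proj G)
        (with_proj \<lparr>pverts = {} :: (nat \<times> nat) set, parcs = {}\<rparr>)"
      unfolding digraph_iso_def using True \<open>parcs G = {}\<close>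
      by (intro exI conjI) (auto simp: app_iso_def with_proj_def)
    ultimately have "minor G ?P" unfolding minor_def by blast
    then show ?thesis using undirected_tree_single by (metis order_refl)
  next
    case False
    let ?k = "card (pverts G)"
    let ?P = "complete_on {0 :: nat} \<boxtimes> complete_on {..<?k}"
    let ?f = "\<lambda>v. (0 :: nat, h v)"
    let ?A = "map_prod ?f ?f ` parcs G"
    let ?H = "\<lparr>pverts = ?f ` pverts G, parcs = ?A\<rparr>"
    have inj: "inj_on ?f (pverts G)" and img: "h ` pverts G = {..<?k}"
      using h by (auto simp: bij_betw_def inj_on_def lessThan_atLeast0)
    have verts: "?f ` pverts G = pverts ?P"
      using img by (auto simp: strong_product_def complete_on_def)
    have sub: "?A \<subseteq> parcs ?P"
    proof (rule image_subsetI)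
      fix e assume e: "e \<in> parcs G"
      obtain a b where [simp]: "e = (a, b)" by (cases e)
      from e have ab: "(a, b) \<in> parcs G" by simp
      with wf have v: "a \<in> pverts G" "b \<in> pverts G" by auto
      from ab irr have "a \<noteq> b" by (auto simp: irrefl_def)
      with v inj have "h a \<noteq> h b" by (auto simp: inj_on_def)
      moreover have "h a < ?k" "h b < ?k" using v img by auto
      ultimately show "map_prod ?f ?f e \<in> parcs ?P"
        by (simp add: strong_product_def complete_on_def)
    qed
    have P: "pair_graph ?P"
      by (intro pair_graph_strong_product pair_graph_complete_on) auto
    then have symP: "sym (parcs ?P)" and "finite (parcs ?P - ?A)"
      unfolding pair_graph_iff by (blast intro: finite_subset)+
    moreover have symA: "sym ?A" using sym by (force simp: sym_def)
    moreover have "sym (r - s)" if "sym r" "sym s" for r s :: "'b rel"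
      using that unfolding sym_def by blast
    ultimately have "minor_step\<^sup>*\<^sup>* ?P \<lparr>pverts = pverts ?P, parcs = parcs ?P - (parcs ?P - ?A)\<rparr>"
      by (intro minor_steps_delete_edges) (simp_all only: Diff_subset)
    moreover have "\<lparr>pverts = pverts ?P, parcs = parcs ?P - (parcs ?P - ?A)\<rparr> = ?H"
      using sub verts by auto
    ultimately have "minor_step\<^sup>*\<^sup>* ?P ?H" by simp
    moreover have "inj_on (map_prod ?f ?f) (parcs G)"
      using inj_on_subset[OF map_prod_inj_on[OF inj inj] wf] .
    then have "pre_digraph.digraph_isomorphism (with_proj G)
        \<lparr>iso_verts = ?f, iso_arcs = map_prod ?f ?f, iso_head = snd, iso_tail = fst\<rparr>"
      using inj wf by (auto simp: pre_digraph.digraph_isomorphism_def wf_digraph_def)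
    then have "digraph_iso (with_proj G) (with_proj ?H)"
      unfolding digraph_iso_def by (intro exI conjI) (auto simp: app_iso_def with_proj_def)
    ultimately have "minor G ?P" unfolding minor_def by blast
    moreover have "1 \<le> ?k" using False fin by (simp add: Suc_le_eq card_gt_0_iff)
    ultimately show ?thesis using undirected_tree_single by metis
  qed
qed

end

theory Submission
  imports Defs
begin

text \<open>
  A graph \<open>G\<close> is a minor of \<open>T \<boxtimes> K\<^sub>2\<close> exactly if its vertices can be represented by subtrees of \<open>T\<close> such
  that no node of \<open>T\<close> lies in more than two subtrees and the subtrees of adjacent vertices meet or
  are joined by an edge of \<open>T\<close>: the branch sets of a model of \<open>G\<close> project to such subtrees, and
  conversely the at most two vertices in the bag of a node are placed on its two copies.

  For the three forbidden graphs such a representation does not exist. By the Helly property of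
  subtrees (\<open>tree_helly\<close>), two of the subtrees of a triangle are disjoint, since three of them cannot
  share a node. Say they are joined by the tree edge \<open>s t\<close>. Only the
  at most two vertices at \<open>s\<close> and the at most two vertices at \<open>t\<close> link the two sides of this edge, and none
  of \<open>F\<^sub>3\<close>, \<open>H\<^sub>3\<close>, \<open>W\<^sub>5\<close> has a separation of this kind around an edge of a suitable triangle.

  For the converse, representations glue at a common vertex, so let \<open>G\<close> be 2-connected. Fix a first bag
  \<open>{x, y}\<close> and let \<open>C\<close> be a component of \<open>G - {x, y}\<close>. The tree can be continued into \<open>C\<close> by
  exchanging \<open>x\<close> for its neighbour if \<open>x\<close> has only one neighbour in \<open>C\<close>, likewise for \<open>y\<close>, or both at once if together
  they have only two neighbours in \<open>C\<close>. When no exchange is possible, \<open>C\<close> contracts to one of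
  two small configurations rooted at \<open>x\<close> and \<open>y\<close>, the bowtie and the kite
  (\<open>unblocked_imp_rooted_rep\<close>). A kite together with a second component of \<open>G - {x, y}\<close> gives \<open>H\<^sub>3\<close>; a
  bowtie together with a triangle through \<open>x\<close> and \<open>y\<close> on the other side gives \<open>F\<^sub>3\<close>. So if \<open>G\<close> has
  no representation and neither minor, then for each pair \<open>{x, y}\<close> that separates \<open>G\<close> the vertices
  \<open>x\<close> and \<open>y\<close> are not adjacent and one of exactly two sides is a path
  (\<open>separating_pair_thin\<close>).

  Hence suppressing the vertices of degree two in \<open>G\<close> leaves a 3-connected graph, in which all degrees are at
  least three. If it has at least five vertices, contractions that preserve 3-connectivity reduce it to five vertices, where it
  contains \<open>W\<^sub>5\<close> (\<open>three_connected_imp_W5\<close>). Otherwise \<open>G\<close> is a subdivision of \<open>K\<^sub>4\<close>. Two subdivided edges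
  with a common end give \<open>H\<^sub>3\<close>. If the subdivided edges are among \<open>{a, b}\<close> and \<open>{c, d}\<close>, then the adjacent
  bags \<open>{a, b}\<close> and \<open>{c, d}\<close> start a representation, a contradiction.
\<close>

section \<open>Connected sets of vertices\<close>

text \<open>Connectedness is expressed by cuts instead of walks. Branch sets are contracted, united and projected
  throughout, and a cut of the new set simply restricts to a cut of the old ones.\<close>

definition conn :: "'a rel \<Rightarrow> 'a set \<Rightarrow> bool" where
  "conn E A \<longleftrightarrow> A \<noteq> {} \<and>
     (\<forall>B. B \<subseteq> A \<longrightarrow> B \<noteq> {} \<longrightarrow> B \<noteq> A \<longrightarrow> (\<exists>b \<in> B. \<exists>a \<in> A - B. (b, a) \<in> E))"

definition adj :: "'a rel \<Rightarrow> 'a set \<Rightarrow> 'a set \<Rightarrow> bool" where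
  "adj E A B \<longleftrightarrow> (\<exists>a \<in> A. \<exists>b \<in> B. (a, b) \<in> E)"

definition nb :: "'a rel \<Rightarrow> 'a set \<Rightarrow> 'a set" where
  "nb E C = E `` C - C"

definition comps :: "'a rel \<Rightarrow> 'a set \<Rightarrow> 'a set set" where
  "comps E A = {C. C \<subseteq> A \<and> conn E C \<and> nb E C \<inter> A = {}}"

lemma conn_cut:
  "conn E A \<Longrightarrow> D \<inter> A = {} \<or> A \<subseteq> D \<or> (\<exists>b \<in> D \<inter> A. \<exists>a \<in> A - D. (b, a) \<in> E)"
  unfolding conn_def by (drule conjunct2, drule spec[of _ "D \<inter> A"]) blast

lemma conn_nonempty: "conn E A \<Longrightarrow> A \<noteq> {}"
  by (simp add: conn_def)

lemma conn_single: "conn E {x}"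
  by (auto simp: conn_def)

lemma conn_mono: "conn E A \<Longrightarrow> E \<subseteq> E' \<Longrightarrow> conn E' A"
  unfolding conn_def by blast

lemma conn_restrict: "conn E A \<Longrightarrow> A \<subseteq> S \<Longrightarrow> conn (E \<inter> S \<times> S) A"
  unfolding conn_def by (intro conjI allI impI; elim conjE) (simp, drule_tac x = B in spec, blast)

lemma adj_sym: "sym E \<Longrightarrow> adj E A B \<longleftrightarrow> adj E B A"
  unfolding adj_def sym_def by blast

lemma adj_mono: "adj E A B \<Longrightarrow> E \<subseteq> E' \<Longrightarrow> A \<subseteq> A' \<Longrightarrow> B \<subseteq> B' \<Longrightarrow> adj E' A' B'"
  unfolding adj_def by blast

lemma adj_Un: "adj E (A \<union> B) C \<longleftrightarrow> adj E A C \<or> adj E B C"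
  "adj E C (A \<union> B) \<longleftrightarrow> adj E C A \<or> adj E C B"
  unfolding adj_def by blast+

lemma nb_iff: "v \<in> nb E C \<longleftrightarrow> v \<notin> C \<and> (\<exists>c \<in> C. (c, v) \<in> E)"
  by (auto simp: nb_def)

text \<open>By symmetry of \<open>E\<close> a cut may be replaced by its complement, so only cuts that avoid a chosen vertex
  matter.\<close>

lemma conn_avoidingI:
  assumes "sym E" "x \<in> A"
    and "\<And>B. B \<subseteq> A \<Longrightarrow> B \<noteq> {} \<Longrightarrow> x \<notin> B \<Longrightarrow> \<exists>b \<in> B. \<exists>a \<in> A - B. (b, a) \<in> E"
  shows "conn E A"
  unfolding conn_def
proof (intro conjI allI impI)
  show "A \<noteq> {}" using assms by auto
  fix B assume B: "B \<subseteq> A" "B \<noteq> {}" "B \<noteq> A"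
  show "\<exists>b \<in> B. \<exists>a \<in> A - B. (b, a) \<in> E"
  proof (cases "x \<in> B")
    case False
    then show ?thesis using assms B by blast
  next
    case True
    then have "\<exists>b \<in> A - B. \<exists>a \<in> A - (A - B). (b, a) \<in> E"
      using B by (intro assms(3)) auto
    then show ?thesis using \<open>sym E\<close> by (blast dest: symD)
  qed
qed

lemma conn_Un:
  assumes "sym E" "conn E A" "conn E B" "A \<inter> B \<noteq> {} \<or> adj E A B"
  shows "conn E (A \<union> B)"
  unfolding conn_def
proof (intro conjI allI impI)
  show "A \<union> B \<noteq> {}" using assms conn_nonempty by auto
  fix D assume D: "D \<subseteq> A \<union> B" "D \<noteq> {}" "D \<noteq> A \<union> B"
  note A = conn_cut[OF assms(2), of D] and B = conn_cut[OF assms(3), of D]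
  show "\<exists>b \<in> D. \<exists>a \<in> A \<union> B - D. (b, a) \<in> E"
  proof (rule ccontr)
    assume neg: "\<not> ?thesis"
    then have "D \<inter> A = {} \<or> A \<subseteq> D" "D \<inter> B = {} \<or> B \<subseteq> D" using A B by blast+
    moreover have "\<not> (A \<subseteq> D \<and> B \<subseteq> D)" "\<not> (D \<inter> A = {} \<and> D \<inter> B = {})" using D by auto
    ultimately have "A \<subseteq> D \<and> D \<inter> B = {} \<or> B \<subseteq> D \<and> D \<inter> A = {}" by blast
    moreover have "A \<inter> B \<noteq> {} \<or> adj E A B \<and> adj E B A"
      using assms(1,4) adj_sym by auto
    ultimately show False using neg unfolding adj_def by blast
  qed
qed

lemma conn_insert:
  assumes "sym E" "conn E A" "a \<in> A" "(x, a) \<in> E"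
  shows "conn E (insert x A)"
  using conn_Un[OF assms(1) conn_single assms(2), of x] assms(3,4) by (auto simp: adj_def)

text \<open>A cut of the union that splits no \<open>g u\<close> is a union of sets \<open>g u\<close>, and so comes from a cut of \<open>W\<close>. This is
  what makes models compose.\<close>

lemma conn_UN:
  assumes W: "conn E' W" and g: "\<And>u. u \<in> W \<Longrightarrow> conn E (g u)"
    and e: "\<And>u v. u \<in> W \<Longrightarrow> v \<in> W \<Longrightarrow> (u, v) \<in> E' \<Longrightarrow> adj E (g u) (g v)"
    and disj: "\<And>u v. u \<in> W \<Longrightarrow> v \<in> W \<Longrightarrow> u \<noteq> v \<Longrightarrow> g u \<inter> g v = {}"
  shows "conn E (\<Union>u \<in> W. g u)"
  unfolding conn_def
proof (intro conjI allI impI)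
  show "(\<Union>u \<in> W. g u) \<noteq> {}" using conn_nonempty[OF W] conn_nonempty[OF g] by auto
  fix D assume D: "D \<subseteq> (\<Union>u \<in> W. g u)" "D \<noteq> {}" "D \<noteq> (\<Union>u \<in> W. g u)"
  show "\<exists>b \<in> D. \<exists>a \<in> (\<Union>u \<in> W. g u) - D. (b, a) \<in> E"
  proof (cases "\<exists>u \<in> W. D \<inter> g u \<noteq> {} \<and> \<not> g u \<subseteq> D")
    case True
    then obtain u where u: "u \<in> W" "D \<inter> g u \<noteq> {}" "\<not> g u \<subseteq> D" by blast
    then show ?thesis using conn_cut[OF g[OF u(1)], of D] by blast
  next
    case False
    let ?U = "{u \<in> W. g u \<subseteq> D}"
    have ne: "g u \<noteq> {}" if "u \<in> W" for u using conn_nonempty[OF g[OF that]] .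
    have "?U \<inter> W \<noteq> {}" using D(1,2) False by blast
    moreover have "\<not> W \<subseteq> ?U" using D(1,3) by blast
    ultimately obtain u v where uv: "u \<in> ?U" "v \<in> W" "v \<notin> ?U" "(u, v) \<in> E'"
      using conn_cut[OF W, of ?U] by blast
    then have "g u \<subseteq> D" "g v \<inter> D = {}" using False by blast+
    then show ?thesis using e[of u v] uv unfolding adj_def by blast
  qed
qed

lemma comp_exists:
  assumes "sym E" "v \<in> A"
  obtains C where "C \<in> comps E A" "v \<in> C"
proof
  let ?R = "E \<inter> A \<times> A"
  let ?C = "{u. (v, u) \<in> ?R\<^sup>*}"
  have sub: "?C \<subseteq> A"
  proof
    fix u assume "u \<in> ?C"
    then have "(v, u) \<in> ?R\<^sup>*" by simp
    then show "u \<in> A" using \<open>v \<in> A\<close> by (induction) auto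
  qed
  show "v \<in> ?C" by simp
  have "conn E ?C"
  proof (rule conn_avoidingI[OF assms(1)])
    show "v \<in> ?C" by simp
    fix B assume B: "B \<subseteq> ?C" "B \<noteq> {}" "v \<notin> B"
    then obtain u where u: "u \<in> B" by auto
    then have "(v, u) \<in> ?R\<^sup>*" using B by auto
    then have "u \<in> B \<longrightarrow> (\<exists>b \<in> B. \<exists>a \<in> ?C - B. (b, a) \<in> E)"
    proof (induction)
      case base
      then show ?case using B by auto
    next
      case (step y z)
      then have "y \<in> ?C" "(z, y) \<in> E" using \<open>sym E\<close> by (auto dest: symD)
      then show ?case using step.IH by blast
    qed
    then show "\<exists>b \<in> B. \<exists>a \<in> ?C - B. (b, a) \<in> E" using u by blast
  qed
  moreover have "nb E ?C \<inter> A = {}"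
  proof -
    have "w \<in> ?C" if "c \<in> ?C" "(c, w) \<in> E" "w \<in> A" for c w
    proof -
      have "(c, w) \<in> ?R" using that sub by auto
      then show ?thesis using that(1) by (auto intro: rtrancl_into_rtrancl)
    qed
    then show ?thesis by (auto simp: nb_def)
  qed
  ultimately show "?C \<in> comps E A" using sub by (simp add: comps_def)
qed

lemma compsD:
  assumes "C \<in> comps E A"
  shows "C \<subseteq> A" "conn E C" "nb E C \<inter> A = {}" "C \<noteq> {}"
  using assms by (auto simp: comps_def conn_def)

lemma comp_absorbs:
  assumes "sym E" "C \<in> comps E A" "conn E D" "D \<subseteq> A" "C \<inter> D \<noteq> {}"
  shows "D \<subseteq> C"
proof (rule ccontr)
  assume "\<not> D \<subseteq> C"
  then obtain b a where "b \<in> C \<inter> D" "a \<in> D" "a \<notin> C \<inter> D" "(b, a) \<in> E"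
    using conn_cut[OF assms(3), of C] assms(5) by blast
  then show False using compsD(3)[OF assms(2)] assms(4) by (auto simp: nb_def)
qed

lemma comps_disjoint:
  assumes "sym E" "C \<in> comps E A" "D \<in> comps E A" "C \<noteq> D"
  shows "C \<inter> D = {}"
  using comp_absorbs[OF assms(1,2) compsD(2,1)[OF assms(3)]]
    comp_absorbs[OF assms(1,3) compsD(2,1)[OF assms(2)]] assms(4) by blast

lemma Union_comps: "sym E \<Longrightarrow> \<Union> (comps E A) = A"
  by (rule subset_antisym) (auto dest: compsD(1) elim: comp_exists)

lemma nb_comp: "C \<in> comps E (A - B) \<Longrightarrow> nb E C \<subseteq> nb E A \<union> B"
  unfolding comps_def nb_def by blast

text \<open>Take for \<open>B\<close> the component of \<open>C - {u}\<close> that contains \<open>v\<close>; all other components stay connected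
  through \<open>u\<close>.\<close>

lemma conn_split:
  assumes "sym E" "conn E C" "u \<in> C" "v \<in> C" "u \<noteq> v"
  obtains A B where "A \<union> B = C" "A \<inter> B = {}" "u \<in> A" "v \<in> B" "conn E A" "conn E B" "adj E A B"
proof -
  obtain B where B: "B \<in> comps E (C - {u})" "v \<in> B"
    using comp_exists[OF assms(1), of v "C - {u}"] assms by auto
  have BC: "B \<subseteq> C - {u}" "conn E B" "nb E B \<inter> (C - {u}) = {}" using compsD[OF B(1)] by auto
  have "conn E (C - B)"
  proof (rule conn_avoidingI[OF assms(1)])
    show "u \<in> C - B" using assms(3) BC by auto
    fix D assume D: "D \<subseteq> C - B" "D \<noteq> {}" "u \<notin> D"
    then obtain b a where ba: "b \<in> D" "a \<in> C" "a \<notin> D" "(b, a) \<in> E"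
      using conn_cut[OF assms(2), of D] assms(3) by blast
    then have "a \<notin> B" using D BC(3) \<open>sym E\<close> unfolding nb_def by (blast dest: symD)
    then show "\<exists>b \<in> D. \<exists>a \<in> C - B - D. (b, a) \<in> E" using ba by blast
  qed
  moreover have "adj E (C - B) B"
    using conn_cut[OF assms(2), of B] BC assms(3) B(2) \<open>sym E\<close> unfolding adj_def sym_def
    by blast
  ultimately show ?thesis using that[of "C - B" B] B BC assms(3) by blast
qed

lemma conn_imp_rtrancl:
  assumes "sym E" "conn E A" "u \<in> A" "v \<in> A"
  shows "(u, v) \<in> (E \<inter> A \<times> A)\<^sup>*"
proof -
  let ?C = "{w \<in> A. (u, w) \<in> (E \<inter> A \<times> A)\<^sup>*}"
  have "?C = A"
  proof (rule ccontr)
    assume "?C \<noteq> A"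
    then obtain b a where ba: "b \<in> ?C" "a \<in> A" "a \<notin> ?C" "(b, a) \<in> E"
      using conn_cut[OF assms(2), of ?C] assms(3) by blast
    then have "(b, a) \<in> E \<inter> A \<times> A" by auto
    then show False using ba by (auto intro: rtrancl_into_rtrancl)
  qed
  then show ?thesis using assms(4) by blast
qed

section \<open>Minors as families of branch sets\<close>

definition model :: "'b set \<Rightarrow> 'b rel \<Rightarrow> 'a set \<Rightarrow> 'a rel \<Rightarrow> ('b \<Rightarrow> 'a set) \<Rightarrow> bool" where
  "model VM EM V E f \<longleftrightarrow>
     (\<forall>v \<in> VM. f v \<subseteq> V \<and> conn E (f v)) \<and>
     (\<forall>u \<in> VM. \<forall>v \<in> VM. u \<noteq> v \<longrightarrow> f u \<inter> f v = {}) \<and>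
     (\<forall>(u, v) \<in> EM. adj E (f u) (f v))"

lemma modelI:
  assumes "\<And>v. v \<in> VM \<Longrightarrow> f v \<subseteq> V" "\<And>v. v \<in> VM \<Longrightarrow> conn E (f v)"
    and "\<And>u v. u \<in> VM \<Longrightarrow> v \<in> VM \<Longrightarrow> u \<noteq> v \<Longrightarrow> f u \<inter> f v = {}"
    and "\<And>u v. (u, v) \<in> EM \<Longrightarrow> adj E (f u) (f v)"
  shows "model VM EM V E f"
  using assms by (auto simp: model_def)

lemma modelD:
  assumes "model VM EM V E f"
  shows "v \<in> VM \<Longrightarrow> f v \<subseteq> V" "v \<in> VM \<Longrightarrow> conn E (f v)"
    and "u \<in> VM \<Longrightarrow> v \<in> VM \<Longrightarrow> u \<noteq> v \<Longrightarrow> f u \<inter> f v = {}"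
    and "(u, v) \<in> EM \<Longrightarrow> adj E (f u) (f v)"
  using assms unfolding model_def by (simp_all, fastforce)

lemma model_mono:
  assumes "model VM EM V E f" "V \<subseteq> V'" "E \<subseteq> E'"
  shows "model VM EM V' E' f"
proof (rule modelI)
  show "f v \<subseteq> V'" if "v \<in> VM" for v using modelD(1)[OF assms(1) that] assms(2) by simp
  show "conn E' (f v)" if "v \<in> VM" for v
    using modelD(2)[OF assms(1) that] assms(3) by (rule conn_mono)
  show "f u \<inter> f v = {}" if "u \<in> VM" "v \<in> VM" "u \<noteq> v" for u v
    using modelD(3)[OF assms(1) that] .
  show "adj E' (f u) (f v)" if "(u, v) \<in> EM" for u v
    using adj_mono[OF modelD(4)[OF assms(1) that] assms(3)] by simp
qed

lemma model_trans:
  assumes f: "model VM EM V E f" and g: "model V E V' E' g"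
  shows "model VM EM V' E' (\<lambda>v. \<Union>u \<in> f v. g u)"
proof (rule modelI)
  fix v assume v: "v \<in> VM"
  note fv = modelD(1,2)[OF f v]
  show "(\<Union>u \<in> f v. g u) \<subseteq> V'" using modelD(1)[OF g] fv by blast
  show "conn E' (\<Union>u \<in> f v. g u)"
    using modelD(2-4)[OF g] fv by (intro conn_UN[OF fv(2)]) (simp_all add: subset_iff)
next
  fix u v assume uv: "u \<in> VM" "v \<in> VM" "u \<noteq> v"
  then have fuv: "f u \<inter> f v = {}" "f u \<subseteq> V" "f v \<subseteq> V" using modelD(1,3)[OF f] by simp_all
  have "g a \<inter> g b = {}" if "a \<in> f u" "b \<in> f v" for a b
    by (rule modelD(3)[OF g]) (use that fuv in blast)+
  then show "(\<Union>u \<in> f u. g u) \<inter> (\<Union>u \<in> f v. g u) = {}" by blast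
next
  fix u v assume e: "(u, v) \<in> EM"
  then obtain a b where ab: "a \<in> f u" "b \<in> f v" "(a, b) \<in> E"
    using modelD(4)[OF f e] unfolding adj_def by auto
  then have "adj E' (g a) (g b)" using modelD(4)[OF g] by simp
  then show "adj E' (\<Union>u \<in> f u. g u) (\<Union>u \<in> f v. g u)"
    by (rule adj_mono) (use ab in auto)
qed

lemma pair_graphD:
  assumes "pair_graph G"
  shows "finite (pverts G)" "parcs G \<subseteq> pverts G \<times> pverts G" "sym (parcs G)" "irrefl (parcs G)"
  using assms by (auto simp: pair_graph_iff)

text \<open>Contraction is undone by adding the contracted vertex to the branch set of the merged one; this is a
  composition with a model of the contracted graph.\<close>

lemma model_contract_edge:
  assumes G: "pair_graph G" and uv: "(u, v) \<in> parcs G"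
    and f: "model VM EM (pverts (contract_edge G u v)) (parcs (contract_edge G u v)) f"
  shows "\<exists>g. model VM EM (pverts G) (parcs G) g"
proof -
  note G' = pair_graphD[OF G]
  have u: "u \<in> pverts G" "v \<in> pverts G" "u \<noteq> v" using uv G' by (auto simp: irrefl_def)
  let ?H = "contract_edge G u v"
  have h: "model (pverts ?H) (parcs ?H) (pverts G) (parcs G) (\<lambda>w. if w = u then {u, v} else {w})"
  proof (rule modelI)
    fix w assume "w \<in> pverts ?H"
    then show "(if w = u then {u, v} else {w}) \<subseteq> pverts G"
      using u by (auto simp: contract_edge_def)
    show "conn (parcs G) (if w = u then {u, v} else {w})"
      using conn_insert[OF G'(3) conn_single, of v v u] uv by (auto simp: conn_single)
  next
    fix w z assume "w \<in> pverts ?H" "z \<in> pverts ?H" "w \<noteq> z"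
    then show "(if w = u then {u, v} else {w}) \<inter> (if z = u then {u, v} else {z}) = {}"
      by (auto simp: contract_edge_def)
  next
    fix w z assume "(w, z) \<in> parcs ?H"
    then show "adj (parcs G) (if w = u then {u, v} else {w}) (if z = u then {u, v} else {z})"
      by (auto simp: contract_edge_def adj_def split: if_splits)
  qed
  show ?thesis using model_trans[OF f h] by blast
qed

lemma model_minor_steps:
  assumes "minor_step\<^sup>*\<^sup>* G H" "pair_graph G" "model VM EM (pverts H) (parcs H) f"
  shows "\<exists>g. model VM EM (pverts G) (parcs G) g"
  using assms
proof (induction arbitrary: f rule: converse_rtranclp_induct)
  case base
  then show ?case by blast
next
  case (step G G')
  from step.hyps(1) step.prems(1) have "pair_graph G'" by (rule minor_step_pair_graph)
  then obtain g where g: "model VM EM (pverts G') (parcs G') g" using step by blast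
  from step.hyps(1) show ?case
  proof cases
    case (edge_deletion u v)
    then show ?thesis using model_mono[OF g] by (auto simp: delete_edge_def)
  next
    case (edge_contraction u v)
    then show ?thesis using model_contract_edge[OF step.prems(1)] g by blast
  next
    case (node_deletion v)
    then show ?thesis using model_mono[OF g] by (auto simp: delete_node_def)
  qed
qed

lemma minor_imp_model:
  assumes "minor M G" "pair_graph G"
  shows "\<exists>f. model (pverts M) (parcs M) (pverts G) (parcs G) f"
proof -
  obtain H h where H: "minor_step\<^sup>*\<^sup>* G H"
    and h: "pre_digraph.digraph_isomorphism (with_proj M) h" "with_proj H = app_iso h (with_proj M)"
    using assms unfolding minor_def digraph_iso_def by blast
  have inj: "inj_on (iso_verts h) (pverts M)"
    using h(1) unfolding pre_digraph.digraph_isomorphism_def by simp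
  have verts: "pverts H = iso_verts h ` pverts M"
    using arg_cong[OF h(2), of verts] by (simp add: app_iso_def)
  have arcs: "(iso_verts h u, iso_verts h v) \<in> parcs H" if "(u, v) \<in> parcs M" for u v
  proof -
    have "iso_arcs h (u, v) \<in> parcs H"
      using that arg_cong[OF h(2), of arcs] by (simp add: app_iso_def)
    moreover have "iso_tail h = fst" "iso_head h = snd"
      using arg_cong[OF h(2), of tail] arg_cong[OF h(2), of head] by (simp_all add: app_iso_def)
    moreover have "iso_verts h u = iso_tail h (iso_arcs h (u, v))"
      "iso_verts h v = iso_head h (iso_arcs h (u, v))"
      using h(1) that unfolding pre_digraph.digraph_isomorphism_def by fastforce+
    ultimately show ?thesis by simp
  qed
  have "model (pverts M) (parcs M) (pverts H) (parcs H) (\<lambda>v. {iso_verts h v})"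
  proof (rule modelI)
    show "{iso_verts h v} \<subseteq> pverts H" if "v \<in> pverts M" for v using that verts by simp
    show "conn (parcs H) {iso_verts h v}" for v by (rule conn_single)
    show "{iso_verts h u} \<inter> {iso_verts h v} = {}" if "u \<in> pverts M" "v \<in> pverts M" "u \<noteq> v" for u v
      using that inj by (simp add: inj_on_eq_iff)
    show "adj (parcs H) {iso_verts h u} {iso_verts h v}" if "(u, v) \<in> parcs M" for u v
      using arcs[OF that] by (simp add: adj_def)
  qed
  then show ?thesis by (rule model_minor_steps[OF H assms(2)])
qed

lemma spanning_embedding_imp_minor:
  assumes M: "pair_graph M" and G: "pair_graph G"
    and h: "inj_on h (pverts M)" "h ` pverts M = pverts G"
    and arcs: "\<And>u v. (u, v) \<in> parcs M \<Longrightarrow> (h u, h v) \<in> parcs G"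
  shows "minor M G"
proof -
  note M' = pair_graphD[OF M] and G' = pair_graphD[OF G]
  let ?A = "map_prod h h ` parcs M"
  let ?H = "\<lparr>pverts = pverts G, parcs = ?A\<rparr>"
  have sub: "?A \<subseteq> parcs G" using arcs by auto
  have symA: "sym ?A" using M'(3) by (force simp: sym_def)
  have "sym (parcs G - ?A)" using symA G'(3) unfolding sym_def by blast
  moreover have "finite (parcs G - ?A)" using G'(1,2) finite_subset by blast
  ultimately have "minor_step\<^sup>*\<^sup>* G \<lparr>pverts = pverts G, parcs = parcs G - (parcs G - ?A)\<rparr>"
    using G'(3) by (intro minor_steps_delete_edges) auto
  moreover have "parcs G - (parcs G - ?A) = ?A" using sub by auto
  ultimately have "minor_step\<^sup>*\<^sup>* G ?H" by simp
  moreover have "inj_on (map_prod h h) (parcs M)"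
    using inj_on_subset[OF map_prod_inj_on[OF h(1) h(1)] M'(2)] .
  then have "pre_digraph.digraph_isomorphism (with_proj M)
      \<lparr>iso_verts = h, iso_arcs = map_prod h h, iso_head = snd, iso_tail = fst\<rparr>"
    using h M'(2) by (auto simp: pre_digraph.digraph_isomorphism_def wf_digraph_def)
  then have "digraph_iso (with_proj M) (with_proj ?H)"
    unfolding digraph_iso_def using h(2) by (intro exI conjI) (auto simp: app_iso_def with_proj_def)
  ultimately show ?thesis unfolding minor_def by blast
qed

lemma minor_step_minor: "minor_step G H \<Longrightarrow> minor M H \<Longrightarrow> minor M G"
  unfolding minor_def by (blast intro: converse_rtranclp_into_rtranclp)

text \<open>Nodes outside all branch sets are deleted and edges inside branch sets are contracted until the
  branch sets are the single nodes of a spanning supergraph of \<open>M\<close>.\<close>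

lemma model_imp_minor:
  assumes M: "pair_graph M" and "pair_graph G"
    and "model (pverts M) (parcs M) (pverts G) (parcs G) f"
  shows "minor M G"
  using assms(2,3)
proof (induction "card (pverts G)" arbitrary: G f rule: less_induct)
  case less
  note G' = pair_graphD[OF less.prems(1)] and f = modelD[OF less.prems(2)]
  let ?U = "\<Union>v \<in> pverts M. f v"
  consider (outside) x where "x \<in> pverts G" "x \<notin> ?U"
    | (large) w where "w \<in> pverts M" "\<nexists>x. f w = {x}"
    | (small) "pverts G \<subseteq> ?U" "\<forall>w \<in> pverts M. \<exists>x. f w = {x}"
    by blast
  then show ?case
  proof cases
    case outside
    let ?H = "delete_node G x"
    have "card (pverts ?H) < card (pverts G)"
      using card_Diff1_less[OF G'(1) outside(1)] by (simp only: delete_node_def pair_pre_digraph.simps)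
    moreover have "model (pverts M) (parcs M) (pverts ?H) (parcs ?H) f"
    proof (rule modelI)
      show "f v \<subseteq> pverts ?H" if "v \<in> pverts M" for v
        using f(1)[OF that] outside that by (auto simp: delete_node_def)
      have e: "parcs G \<inter> ?U \<times> ?U \<subseteq> parcs ?H" using outside by (auto simp: delete_node_def)
      show "conn (parcs ?H) (f v)" if "v \<in> pverts M" for v
        by (rule conn_mono[OF conn_restrict[OF f(2)[OF that]] e]) (use that in auto)
      show "f u \<inter> f v = {}" if "u \<in> pverts M" "v \<in> pverts M" "u \<noteq> v" for u v
        using f(3)[OF that] .
      show "adj (parcs ?H) (f u) (f v)" if "(u, v) \<in> parcs M" for u v
      proof -
        have "u \<in> pverts M" "v \<in> pverts M" using that pair_graphD(2)[OF M] by auto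
        then have "f u \<subseteq> ?U" "f v \<subseteq> ?U" by auto
        then show ?thesis using f(4)[OF that] e unfolding adj_def by blast
      qed
    qed
    ultimately have "minor M ?H"
      using less.hyps pair_graph_delete_node[OF less.prems(1)] by blast
    then show ?thesis using minor_step_minor[OF node_deletion[OF outside(1)]] by blast
  next
    case large
    obtain x where x: "x \<in> f w" using conn_nonempty[OF f(2)[OF large(1)]] by auto
    then have "f w \<noteq> {x}" using large(2) by blast
    then obtain y where y: "y \<in> f w" "y \<noteq> x" "(x, y) \<in> parcs G"
      using conn_cut[OF f(2)[OF large(1)], of "{x}"] x by auto
    let ?H = "contract_edge G x y"
    have xy: "x \<in> pverts G" "y \<in> pverts G" using y(3) G'(2) by auto
    have "card (pverts ?H) < card (pverts G)"
      using card_Diff1_less[OF G'(1) xy(2)] by (simp only: contract_edge_def pair_pre_digraph.simps)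
    moreover have "model (pverts M) (parcs M) (pverts ?H) (parcs ?H) (\<lambda>v. f v - {y})"
    proof (rule modelI)
      show "f v - {y} \<subseteq> pverts ?H" if "v \<in> pverts M" for v
        using f(1)[OF that] by (auto simp: contract_edge_def)
      show "(f u - {y}) \<inter> (f v - {y}) = {}" if "u \<in> pverts M" "v \<in> pverts M" "u \<noteq> v" for u v
        using f(3)[OF that] by auto
      have other: "y \<notin> f v" "x \<notin> f v" if "v \<in> pverts M" "v \<noteq> w" for v
        using f(3)[OF large(1) that(1)] that x y by auto
      have rep: "((if a = y then x else a), (if b = y then x else b)) \<in> parcs ?H"
        if "(a, b) \<in> parcs G" "(if a = y then x else a) \<noteq> (if b = y then x else b)" for a b
        using that unfolding contract_edge_def by force
      show "conn (parcs ?H) (f v - {y})" if v: "v \<in> pverts M" for v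
        unfolding conn_def
      proof (intro conjI allI impI)
        show "f v - {y} \<noteq> {}"
          using conn_nonempty[OF f(2)[OF v]] other(1)[OF v] x y(2) by (cases "v = w") auto
        fix B assume B: "B \<subseteq> f v - {y}" "B \<noteq> {}" "B \<noteq> f v - {y}"
        \<comment> \<open>the contracted vertex \<open>y\<close> goes to the side of the cut on which \<open>x\<close> lies\<close>
        let ?B = "if x \<in> B then insert y B else B"
        have "?B \<inter> f v \<noteq> {}" using B by auto
        moreover have "\<not> f v \<subseteq> ?B" using B by auto
        ultimately obtain b a where ba: "b \<in> ?B" "b \<in> f v" "a \<in> f v" "a \<notin> ?B" "(b, a) \<in> parcs G"
          using conn_cut[OF f(2)[OF v], of ?B] by blast
        have "x \<in> f v" if "y \<in> f v" using that other[OF v] x by (cases "v = w") auto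
        then have 1: "(if b = y then x else b) \<in> B" and 2: "(if a = y then x else a) \<in> f v - {y} - B"
          using ba B y(2) by (auto split: if_splits)
        from 1 2 have "(if b = y then x else b) \<noteq> (if a = y then x else a)" by force
        from rep[OF ba(5) this] 1 2 show "\<exists>b \<in> B. \<exists>a \<in> f v - {y} - B. (b, a) \<in> parcs ?H"
          by blast
      qed
      show "adj (parcs ?H) (f u - {y}) (f v - {y})" if uv: "(u, v) \<in> parcs M" for u v
      proof -
        have uv': "u \<in> pverts M" "v \<in> pverts M" "u \<noteq> v"
          using uv pair_graphD(2,4)[OF M] by (auto simp: irrefl_def)
        obtain a b where ab: "a \<in> f u" "b \<in> f v" "(a, b) \<in> parcs G"
          using f(4)[OF uv] unfolding adj_def by auto
        have in_f: "(if c = y then x else c) \<in> f z - {y}" if "c \<in> f z" "z \<in> pverts M" for c z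
          using that other[OF that(2)] x y(2) by (cases "z = w") auto
        have "(if a = y then x else a) \<noteq> (if b = y then x else b)"
          using in_f[OF ab(1) uv'(1)] in_f[OF ab(2) uv'(2)] f(3)[OF uv'] by force
        then show ?thesis
          using rep[OF ab(3)] in_f[OF ab(1) uv'(1)] in_f[OF ab(2) uv'(2)] unfolding adj_def by blast
      qed
    qed
    ultimately have "minor M ?H"
      using less.hyps pair_graph_contract_edge[OF less.prems(1) y(3)] by blast
    then show ?thesis using minor_step_minor[OF edge_contraction[OF y(3)]] by blast
  next
    case small
    then obtain h where h: "\<And>w. w \<in> pverts M \<Longrightarrow> f w = {h w}" by metis
    show ?thesis
    proof (rule spanning_embedding_imp_minor[OF M less.prems(1)])
      show "inj_on h (pverts M)" using f(3) h by (fastforce simp: inj_on_def)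
      show "h ` pverts M = pverts G" using small(1) f(1) h by fastforce
      show "(h u, h v) \<in> parcs G" if "(u, v) \<in> parcs M" for u v
      proof -
        have "u \<in> pverts M" "v \<in> pverts M" using that pair_graphD(2)[OF M] by auto
        then show ?thesis using f(4)[OF that] h by (simp add: adj_def)
      qed
    qed
  qed
qed

section \<open>Separations along the edges of a tree\<close>

lemma cas_with_proj:
  "pre_digraph.cas (with_proj G) u p v = pre_digraph.cas (with_proj H) u p v"
  by (induction p arbitrary: u) (simp_all add: pre_digraph.cas.simps)

lemma awalk_verts_with_proj:
  "pre_digraph.awalk_verts (with_proj G) u p = pre_digraph.awalk_verts (with_proj H) u p"
  by (induction p arbitrary: u) (simp_all add: pre_digraph.awalk_verts.simps)

definition edge_split :: "'n set \<Rightarrow> 'n rel \<Rightarrow> 'n \<Rightarrow> 'n \<Rightarrow> 'n set \<Rightarrow> 'n set \<Rightarrow> bool" where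
  "edge_split N R s t N1 N2 \<longleftrightarrow>
     N1 \<union> N2 = N \<and> N1 \<inter> N2 = {} \<and> s \<in> N1 \<and> t \<in> N2 \<and>
     (\<forall>a \<in> N1. \<forall>b \<in> N2. (a, b) \<in> R \<or> (b, a) \<in> R \<longrightarrow> a = s \<and> b = t)"

text \<open>Were \<open>t\<close> still reachable from \<open>s\<close> without the edge, a path between them would close to a cycle with
  at least three arcs.\<close>

lemma undirected_tree_edge_split:
  assumes T: "undirected_tree T" and st: "(s, t) \<in> parcs T"
  obtains N1 N2 where "edge_split (pverts T) (parcs T) s t N1 N2"
proof -
  have pg: "pair_graph T" using T by (simp add: undirected_tree_def)
  note T' = pair_graphD[OF pg]
  let ?R = "parcs T - {(s, t), (t, s)}"
  let ?G = "\<lparr>pverts = pverts T, parcs = ?R\<rparr>"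
  let ?N1 = "{x \<in> pverts T. (s, x) \<in> ?R\<^sup>*}"
  have "s \<in> pverts T" "t \<in> pverts T" "s \<noteq> t" using st T' by (auto simp: irrefl_def)
  have "t \<notin> ?N1"
  proof
    assume "t \<in> ?N1"
    interpret G: wf_digraph "with_proj ?G" using T'(2) by unfold_locales auto
    have "s \<rightarrow>\<^sup>*\<^bsub>with_proj ?G\<^esub> x" if "(s, x) \<in> ?R\<^sup>*" for x
      using that
    proof (induction)
      case base
      then show ?case using \<open>s \<in> pverts T\<close> by (intro G.reachable_refl) simp
    next
      case (step y z)
      then have "y \<rightarrow>\<^bsub>with_proj ?G\<^esub> z" by (simp add: arcs_ends_def arc_to_ends_def)
      then show ?case using step.IH by (rule G.reachable_adj_trans[rotated])
    qed
    then have "s \<rightarrow>\<^sup>*\<^bsub>with_proj ?G\<^esub> t" using \<open>t \<in> ?N1\<close> by blast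
    then obtain p where p: "G.apath s p t" using G.reachable_apath by blast
    then have aw: "G.awalk s p t" and dist: "distinct (G.awalk_verts s p)"
      by (auto simp: G.apath_def)
    have "set p \<subseteq> ?R" "G.cas s p t" using aw by (auto simp: G.awalk_def)
    then have "length p \<ge> 2"
      using \<open>s \<noteq> t\<close> by (cases p; cases "tl p") auto
    let ?c = "(t, s) # p"
    have "pre_digraph.awalk (with_proj T) t ?c t"
      using \<open>set p \<subseteq> ?R\<close> \<open>G.cas s p t\<close> st T'(3) \<open>t \<in> pverts T\<close> cas_with_proj[of ?G s p t T]
      by (auto simp: pre_digraph.awalk_def pre_digraph.cas.simps dest: symD)
    moreover have "distinct (tl (pre_digraph.awalk_verts (with_proj T) t ?c))"
      using dist awalk_verts_with_proj[of ?G s p T] by (simp add: pre_digraph.awalk_verts.simps)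
    ultimately have "pre_digraph.cycle (with_proj T) ?c"
      by (auto simp: pre_digraph.cycle_def)
    then show False using T \<open>length p \<ge> 2\<close> unfolding undirected_tree_def by fastforce
  qed
  moreover have "a = s \<and> b = t" if "a \<in> ?N1" "b \<in> pverts T - ?N1" "(a, b) \<in> parcs T \<or> (b, a) \<in> parcs T" for a b
  proof -
    have ab: "(a, b) \<in> parcs T" using that(3) T'(3) by (blast dest: symD)
    have "(a, b) \<notin> ?R" using that(1,2) by (auto intro: rtrancl_into_rtrancl)
    then have "(a, b) = (s, t) \<or> (a, b) = (t, s)" using ab by blast
    then show ?thesis using \<open>t \<notin> ?N1\<close> that by auto
  qed
  ultimately have "edge_split (pverts T) (parcs T) s t ?N1 (pverts T - ?N1)"
    unfolding edge_split_def using \<open>s \<in> pverts T\<close> \<open>t \<in> pverts T\<close> by blast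
  then show ?thesis by (rule that)
qed

lemma edge_split_side:
  assumes "edge_split N R s t N1 N2" "conn R A" "A \<subseteq> N" "\<not> (s \<in> A \<and> t \<in> A)"
  shows "A \<subseteq> N1 \<or> A \<subseteq> N2"
proof -
  have "A \<inter> N1 = {} \<or> A \<subseteq> N1 \<or> (\<exists>b \<in> N1 \<inter> A. \<exists>a \<in> A - N1. (b, a) \<in> R)"
    using conn_cut[OF assms(2), of N1] by blast
  then show ?thesis using assms unfolding edge_split_def by blast
qed

text \<open>If the three sets had no common node, let \<open>K\<close> be a component of \<open>A - C\<close> that meets \<open>B\<close>. An edge
  \<open>s t\<close> leaving \<open>K\<close> inside \<open>A\<close> ends in \<open>C\<close>, so it separates \<open>C\<close> from the connected set
  \<open>K \<union> B\<close>, although \<open>B\<close> meets \<open>C\<close>.\<close>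

lemma tree_helly:
  assumes T: "undirected_tree T"
    and A: "conn (parcs T) A" "A \<subseteq> pverts T" and B: "conn (parcs T) B" "B \<subseteq> pverts T"
    and C: "conn (parcs T) C" "C \<subseteq> pverts T"
    and int: "A \<inter> B \<noteq> {}" "A \<inter> C \<noteq> {}" "B \<inter> C \<noteq> {}"
  shows "A \<inter> B \<inter> C \<noteq> {}"
proof
  assume empty: "A \<inter> B \<inter> C = {}"
  have sym: "sym (parcs T)" using T pair_graphD(3) by (auto simp: undirected_tree_def)
  obtain x where x: "x \<in> A" "x \<in> B" "x \<notin> C" using int(1) empty by blast
  obtain K where K: "K \<in> comps (parcs T) (A - C)" "x \<in> K"
    using comp_exists[OF sym, of x "A - C"] x by auto
  note K' = compsD[OF K(1)]
  have "\<not> A \<subseteq> K" using K'(1) int(2) by blast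
  then obtain s t where st: "s \<in> K" "t \<in> A" "t \<notin> K" "(s, t) \<in> parcs T"
    using conn_cut[OF A(1), of K] K'(1) K(2) by blast
  then have "t \<in> C" using K'(3) unfolding nb_def by blast
  obtain N1 N2 where split: "edge_split (pverts T) (parcs T) s t N1 N2"
    using undirected_tree_edge_split[OF T st(4)] .
  have "t \<notin> B" "t \<notin> K" "s \<notin> C" using \<open>t \<in> C\<close> st empty K'(1) by auto
  have "conn (parcs T) (K \<union> B)" using K'(2) B(1) K(2) x by (intro conn_Un[OF sym]) auto
  then have "K \<union> B \<subseteq> N1"
    using edge_split_side[OF split, of "K \<union> B"] K'(1) A(2) B(2) \<open>t \<notin> B\<close> \<open>t \<notin> K\<close> st(1) split
    unfolding edge_split_def by blast
  moreover have "C \<subseteq> N2"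
    using edge_split_side[OF split C] \<open>s \<notin> C\<close> \<open>t \<in> C\<close> split unfolding edge_split_def by blast
  ultimately show False using int(3) split unfolding edge_split_def by blast
qed

section \<open>Graphs represented by subtrees\<close>

text \<open>The projection to \<open>T\<close> of the branch sets of a model in \<open>T \<boxtimes> K\<^sub>k\<close>: as branch sets are disjoint and
  a node of \<open>T\<close> has \<open>k\<close> copies, at most \<open>k\<close> of the projections contain a given node.\<close>

definition subtree_rep :: "nat \<Rightarrow> 'b set \<Rightarrow> 'b rel \<Rightarrow> 'n pair_pre_digraph \<Rightarrow> ('b \<Rightarrow> 'n set) \<Rightarrow> bool" where
  "subtree_rep k VM EM T f \<longleftrightarrow>
     (\<forall>v \<in> VM. f v \<subseteq> pverts T \<and> conn (parcs T) (f v)) \<and>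
     (\<forall>(u, v) \<in> EM. \<exists>s \<in> f u. \<exists>t \<in> f v. s = t \<or> (s, t) \<in> parcs T) \<and>
     (\<forall>t. \<forall>W \<subseteq> VM. (\<forall>v \<in> W. t \<in> f v) \<longrightarrow> finite W \<and> card W \<le> k)"

lemma subtree_repD:
  assumes "subtree_rep k VM EM T f"
  shows "v \<in> VM \<Longrightarrow> f v \<subseteq> pverts T" "v \<in> VM \<Longrightarrow> conn (parcs T) (f v)"
    and "(u, v) \<in> EM \<Longrightarrow> \<exists>s \<in> f u. \<exists>t \<in> f v. s = t \<or> (s, t) \<in> parcs T"
    and "W \<subseteq> VM \<Longrightarrow> (\<And>v. v \<in> W \<Longrightarrow> t \<in> f v) \<Longrightarrow> card W \<le> k"
proof -
  note rep = assms[unfolded subtree_rep_def]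
  show "v \<in> VM \<Longrightarrow> f v \<subseteq> pverts T" "v \<in> VM \<Longrightarrow> conn (parcs T) (f v)"
    using conjunct1[OF rep] by simp_all
  show "\<exists>s \<in> f u. \<exists>t \<in> f v. s = t \<or> (s, t) \<in> parcs T" if "(u, v) \<in> EM"
    using bspec[OF conjunct1[OF conjunct2[OF rep]] that] by (simp only: prod.case)
  show "W \<subseteq> VM \<Longrightarrow> (\<And>v. v \<in> W \<Longrightarrow> t \<in> f v) \<Longrightarrow> card W \<le> k"
    using conjunct2[OF conjunct2[OF rep]] by (drule_tac x = t in spec) blast
qed

lemma model_imp_subtree_rep:
  assumes f: "model VM EM (pverts (T \<boxtimes> complete_on {..<k})) (parcs (T \<boxtimes> complete_on {..<k})) f"
  shows "subtree_rep k VM EM T (\<lambda>v. fst ` f v)"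
proof -
  let ?P = "T \<boxtimes> complete_on {..<k :: nat}"
  note f' = modelD[OF f]
  have cn: "conn (parcs T) (fst ` f v)" if v: "v \<in> VM" for v
    unfolding conn_def
  proof (intro conjI allI impI)
    show "fst ` f v \<noteq> {}" using conn_nonempty[OF f'(2)[OF v]] by auto
    fix B assume B: "B \<subseteq> fst ` f v" "B \<noteq> {}" "B \<noteq> fst ` f v"
    let ?B = "{p. fst p \<in> B}"
    have "?B \<inter> f v \<noteq> {}" "\<not> f v \<subseteq> ?B" using B by auto
    then obtain b a where ba: "b \<in> ?B" "b \<in> f v" "a \<in> f v" "a \<notin> ?B" "(b, a) \<in> parcs ?P"
      using conn_cut[OF f'(2)[OF v], of ?B] by blast
    then have "fst b \<noteq> fst a" by auto
    then have "(fst b, fst a) \<in> parcs T" using ba(5) by (auto simp: strong_product_def)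
    then show "\<exists>b \<in> B. \<exists>a \<in> fst ` f v - B. (b, a) \<in> parcs T" using ba by auto
  qed
  have sub: "fst ` f v \<subseteq> pverts T" if "v \<in> VM" for v
    using f'(1)[OF that] by (auto simp: strong_product_def)
  have touch: "\<exists>s \<in> fst ` f u. \<exists>t \<in> fst ` f v. s = t \<or> (s, t) \<in> parcs T" if uv: "(u, v) \<in> EM" for u v
  proof -
    obtain a b where "a \<in> f u" "b \<in> f v" "(a, b) \<in> parcs ?P"
      using f'(4)[OF uv] unfolding adj_def by auto
    moreover from this have "fst a = fst b \<or> (fst a, fst b) \<in> parcs T"
      by (auto simp: strong_product_def)
    ultimately show ?thesis by blast
  qed
  have few: "finite W \<and> card W \<le> k" if W: "W \<subseteq> VM" "\<forall>v \<in> W. t \<in> fst ` f v" for t W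
  proof -
    have "\<exists>i < k. (t, i) \<in> f v" if "v \<in> W" for v
      using W f'(1)[of v] that by (fastforce simp: strong_product_def complete_on_def)
    then obtain g where g: "\<And>v. v \<in> W \<Longrightarrow> g v < k \<and> (t, g v) \<in> f v" by metis
    have "inj_on g W"
    proof (rule inj_onI, rule ccontr)
      fix u v assume uv: "u \<in> W" "v \<in> W" "g u = g v" "u \<noteq> v"
      then have "f u \<inter> f v = {}" using f'(3)[of u v] W(1) by blast
      moreover have "(t, g u) \<in> f u" "(t, g u) \<in> f v" using g uv(1,2) uv(3) by metis+
      ultimately show False by blast
    qed
    moreover have "g ` W \<subseteq> {..<k}" using g by auto
    ultimately show ?thesis
      using card_inj_on_le[of g W "{..<k}"] inj_on_finite[of g W "{..<k}"] by simp
  qed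
  show ?thesis unfolding subtree_rep_def
  proof (intro conjI)
    show "\<forall>v \<in> VM. fst ` f v \<subseteq> pverts T \<and> conn (parcs T) (fst ` f v)" using cn sub by simp
    show "\<forall>(u, v) \<in> EM. \<exists>s \<in> fst ` f u. \<exists>t \<in> fst ` f v. s = t \<or> (s, t) \<in> parcs T"
      using touch by (intro ballI) (simp only: split_paired_all case_prod_conv)
    show "\<forall>t. \<forall>W \<subseteq> VM. (\<forall>v \<in> W. t \<in> fst ` f v) \<longrightarrow> finite W \<and> card W \<le> k"
      using few by simp
  qed
qed

text \<open>What remains of a representation when only one tree edge \<open>s t\<close> is observed: \<open>L w\<close> and \<open>R w\<close> say that the
  subtree of \<open>w\<close> meets the side of \<open>s\<close> and of \<open>t\<close>, and \<open>P w\<close> and \<open>Q w\<close> that it contains \<open>s\<close>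
  and \<open>t\<close>. The vertex \<open>u\<close> is one of at most two at \<open>s\<close>, and \<open>v\<close> one of at most two at \<open>t\<close>. For a concrete
  graph such a cut is a propositional matter.\<close>

definition tree_cut :: "'b set \<Rightarrow> 'b rel \<Rightarrow> 'b \<Rightarrow> 'b \<Rightarrow>
    ('b \<Rightarrow> bool) \<Rightarrow> ('b \<Rightarrow> bool) \<Rightarrow> ('b \<Rightarrow> bool) \<Rightarrow> ('b \<Rightarrow> bool) \<Rightarrow> bool" where
  "tree_cut VM EM u v L R P Q \<longleftrightarrow>
     (\<forall>w \<in> VM. (L w \<or> R w) \<and> (L w \<and> R w \<longrightarrow> P w \<and> Q w) \<and> (P w \<longrightarrow> L w) \<and> (Q w \<longrightarrow> R w)) \<and>
     (\<forall>(w, z) \<in> EM. \<not> R w \<and> \<not> L z \<longrightarrow> P w \<and> Q z) \<and>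
     (\<forall>w \<in> VM. \<forall>z \<in> VM. P w \<and> P z \<longrightarrow> w = u \<or> z = u \<or> w = z) \<and>
     (\<forall>w \<in> VM. \<forall>z \<in> VM. Q w \<and> Q z \<longrightarrow> w = v \<or> z = v \<or> w = z) \<and>
     P u \<and> Q v \<and> \<not> R u \<and> \<not> L v"

text \<open>The subtrees of \<open>u\<close> and \<open>v\<close> are disjoint but joined by a tree edge \<open>s t\<close>, so they lie on
  different sides of it.\<close>

lemma disjoint_edge_tree_cut:
  assumes T: "undirected_tree T" and f: "subtree_rep k VM EM T f" and "k \<le> 2"
    and wf: "EM \<subseteq> VM \<times> VM" and uv: "(u, v) \<in> EM" and disj: "f u \<inter> f v = {}"
  shows "\<exists>L R P Q. tree_cut VM EM u v L R P Q"
proof -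
  have fv: "f w \<subseteq> pverts T" "conn (parcs T) (f w)" if "w \<in> VM" for w
    using subtree_repD(1,2)[OF f that] by auto
  note edge = subtree_repD(3)[OF f]
  have uvM: "u \<in> VM" "v \<in> VM" using uv wf by auto
  obtain s t where st: "s \<in> f u" "t \<in> f v" "(s, t) \<in> parcs T" using edge[OF uv] disj by blast
  obtain N1 N2 where split: "edge_split (pverts T) (parcs T) s t N1 N2"
    using undirected_tree_edge_split[OF T st(3)] .
  have split': "N1 \<union> N2 = pverts T" "N1 \<inter> N2 = {}" "s \<in> N1" "t \<in> N2"
    using split by (simp_all add: edge_split_def)
  have cross: "a = s \<and> b = t" if "a \<in> N1" "b \<in> N2" "(a, b) \<in> parcs T" for a b
    using split that by (simp add: edge_split_def)
  have side: "f w \<subseteq> N1 \<or> f w \<subseteq> N2" if "w \<in> VM" "\<not> (s \<in> f w \<and> t \<in> f w)" for w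
    using edge_split_side[OF split fv(2)[OF that(1)] fv(1)[OF that(1)] that(2)] .
  have "t \<notin> f u" "s \<notin> f v" using st disj by auto
  have three: "w = x \<or> z = x \<or> w = z" if "w \<in> VM" "z \<in> VM" "x \<in> VM" "r \<in> f w" "r \<in> f z" "r \<in> f x" for w z x r
  proof (rule ccontr)
    assume "\<not> ?thesis"
    then have "card {w, z, x} = 3" by simp
    moreover have "card {w, z, x} \<le> k" by (rule subtree_repD(4)[OF f, of _ r]) (use that in auto)
    ultimately show False using \<open>k \<le> 2\<close> by simp
  qed
  have "tree_cut VM EM u v (\<lambda>w. f w \<inter> N1 \<noteq> {}) (\<lambda>w. f w \<inter> N2 \<noteq> {}) (\<lambda>w. s \<in> f w) (\<lambda>w. t \<in> f w)"
    unfolding tree_cut_def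
  proof (intro conjI ballI impI)
    fix w assume w: "w \<in> VM"
    show "f w \<inter> N1 \<noteq> {} \<or> f w \<inter> N2 \<noteq> {}"
      using fv[OF w] conn_nonempty[of _ "f w"] split'(1) by blast
    show "s \<in> f w" "t \<in> f w" if "f w \<inter> N1 \<noteq> {} \<and> f w \<inter> N2 \<noteq> {}"
      using side[OF w] that split' by blast+
    show "f w \<inter> N1 \<noteq> {}" if "s \<in> f w" using that split' by blast
    show "f w \<inter> N2 \<noteq> {}" if "t \<in> f w" using that split' by blast
  next
    fix e assume e: "e \<in> EM"
    obtain w z where [simp]: "e = (w, z)" by (cases e)
    have wz: "w \<in> VM" "z \<in> VM" using e wf by auto
    have "(w, z) \<in> EM" using e by simp
    then obtain p q where pq: "p \<in> f w" "q \<in> f z" "p = q \<or> (p, q) \<in> parcs T"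
      using edge[of w z] by blast
    have "s \<in> f w \<and> t \<in> f z" if "f w \<inter> N2 = {}" "f z \<inter> N1 = {}"
    proof -
      have "p \<in> N1" "q \<in> N2" using pq(1,2) that fv(1)[OF wz(1)] fv(1)[OF wz(2)] split'(1) by blast+
      then have "p \<noteq> q" using split'(2) by blast
      then have "p = s \<and> q = t" using cross \<open>p \<in> N1\<close> \<open>q \<in> N2\<close> pq(3) by simp
      then show ?thesis using pq(1,2) by simp
    qed
    then show "case e of (w, z) \<Rightarrow> \<not> f w \<inter> N2 \<noteq> {} \<and> \<not> f z \<inter> N1 \<noteq> {} \<longrightarrow> s \<in> f w \<and> t \<in> f z"
      by simp
  next
    show "w = u \<or> z = u \<or> w = z" if "w \<in> VM" "z \<in> VM" "s \<in> f w \<and> s \<in> f z" for w z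
      using three[of w z u s] that uvM st by blast
    show "w = v \<or> z = v \<or> w = z" if "w \<in> VM" "z \<in> VM" "t \<in> f w \<and> t \<in> f z" for w z
      using three[of w z v t] that uvM st by blast
    show "s \<in> f u" "t \<in> f v" by fact+
    show "\<not> f u \<inter> N2 \<noteq> {}"
      using side[OF uvM(1)] st(1) \<open>t \<notin> f u\<close> split' by blast
    show "\<not> f v \<inter> N1 \<noteq> {}"
      using side[OF uvM(2)] st(2) \<open>s \<notin> f v\<close> split' by blast
  qed
  then show ?thesis by blast
qed

text \<open>By the Helly property pairwise intersecting subtrees of \<open>a\<close>, \<open>b\<close> and \<open>c\<close> would overcrowd a node.\<close>

lemma triangle_tree_cut:
  assumes T: "undirected_tree T" and f: "subtree_rep k VM EM T f" and "k \<le> 2"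
    and wf: "EM \<subseteq> VM \<times> VM" and tri: "(a, b) \<in> EM" "(b, c) \<in> EM" "(a, c) \<in> EM" and ne: "a \<noteq> b" "b \<noteq> c" "a \<noteq> c"
  shows "\<exists>u v L R P Q. (u, v) \<in> {(a, b), (b, c), (a, c)} \<and> tree_cut VM EM u v L R P Q"
proof -
  have abc: "a \<in> VM" "b \<in> VM" "c \<in> VM" using tri wf by auto
  have fv: "conn (parcs T) (f w)" "f w \<subseteq> pverts T" if "w \<in> VM" for w
    using subtree_repD(1,2)[OF f that] by auto
  have "f a \<inter> f b = {} \<or> f b \<inter> f c = {} \<or> f a \<inter> f c = {}"
  proof (rule ccontr)
    assume "\<not> ?thesis"
    then have "f a \<inter> f b \<inter> f c \<noteq> {}"
      using tree_helly[OF T fv[OF abc(1)] fv[OF abc(2)] fv[OF abc(3)]] by blast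
    then obtain t where "t \<in> f a" "t \<in> f b" "t \<in> f c" by blast
    then have "card {a, b, c} \<le> k" using abc by (intro subtree_repD(4)[OF f, of _ t]) auto
    then show False using ne \<open>k \<le> 2\<close> by simp
  qed
  then show ?thesis using disjoint_edge_tree_cut[OF T f \<open>k \<le> 2\<close> wf] tri by (metis insertI1 insertI2)
qed

lemma converse_insert_pair: "(insert (a, b) r)\<inverse> = insert (b, a) (r\<inverse>)"
  by auto

lemma H3_explicit: "pverts H3 = UNIV" "parcs H3 = (let E = {(V1, V3), (V1, V13), (V2, V13), (V3, V13), (V1, V12), (V12, V2), (V2, V23), (V23, V3)} in E \<union> E\<inverse>)"
proof -
  have "x = V1 \<or> x = V2 \<or> x = V3 \<or> x = V12 \<or> x = V13 \<or> x = V23" for x by (cases x) auto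
  then show "pverts H3 = UNIV" by (auto simp: H3_def subdivide.simps complete_on_def)
  have K: "parcs (complete_on {V1, V2, V3, V13}) = {V1, V2, V3, V13} \<times> {V1, V2, V3, V13} - Id"
    by (auto simp: complete_on_def)
  show "parcs H3 = (let E = {(V1, V3), (V1, V13), (V2, V13), (V3, V13), (V1, V12), (V12, V2), (V2, V23), (V23, V3)} in E \<union> E\<inverse>)"
    unfolding H3_def by (simp add: subdivide.simps K Let_def insert_Diff_if converse_insert_pair) (rule equalityI; simp)
qed

lemma UNIV_node: "UNIV = {V1, V2, V3, V12, V13, V23}"
  using node.exhaust by auto

text \<open>A connected set of vertices that touches both \<open>u\<close> and \<open>v\<close> must occupy the remaining place at \<open>s\<close> or at
  \<open>t\<close>. In each of the three graphs these two places are soon used up, and then some further vertex would have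
  neighbours strictly on both sides. The cases are few enough for a propositional search.\<close>

lemma F3_no_tree_cut:
  shows "\<not> tree_cut (pverts F3) (parcs F3) V1 V2 L R P Q"
  and "\<not> tree_cut (pverts F3) (parcs F3) V2 V3 L R P Q"
  and "\<not> tree_cut (pverts F3) (parcs F3) V1 V3 L R P Q"
  unfolding tree_cut_def F3_def Let_def by ((rule notI, simp add: converse_insert_pair, argo)+)

lemma H3_no_tree_cut:
  shows "\<not> tree_cut (pverts H3) (parcs H3) V1 V3 L R P Q"
  and "\<not> tree_cut (pverts H3) (parcs H3) V3 V13 L R P Q"
  and "\<not> tree_cut (pverts H3) (parcs H3) V1 V13 L R P Q"
  unfolding tree_cut_def H3_explicit Let_def UNIV_node by ((rule notI, simp add: converse_insert_pair, argo)+)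

lemma W5_no_tree_cut:
  shows "\<not> tree_cut (pverts W5) (parcs W5) 0 1 L R P Q"
  and "\<not> tree_cut (pverts W5) (parcs W5) 1 4 L R P Q"
  and "\<not> tree_cut (pverts W5) (parcs W5) 0 4 L R P Q"
  unfolding tree_cut_def W5_def Let_def by ((rule notI, simp add: converse_insert_pair, argo)+)

lemma no_model_in_tree_product:
  fixes T :: "'n pair_pre_digraph" and k :: nat
  assumes T: "undirected_tree T" and "k \<le> 2"
    and M: "pair_graph M" and tri: "(a, b) \<in> parcs M" "(b, c) \<in> parcs M" "(a, c) \<in> parcs M"
    and cut: "\<And>L R P Q. \<not> tree_cut (pverts M) (parcs M) a b L R P Q"
      "\<And>L R P Q. \<not> tree_cut (pverts M) (parcs M) b c L R P Q"
      "\<And>L R P Q. \<not> tree_cut (pverts M) (parcs M) a c L R P Q"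
  shows "\<not> model (pverts M) (parcs M) (pverts (T \<boxtimes> complete_on {..<k})) (parcs (T \<boxtimes> complete_on {..<k})) f"
proof
  note M' = pair_graphD[OF M]
  assume "model (pverts M) (parcs M) (pverts (T \<boxtimes> complete_on {..<k})) (parcs (T \<boxtimes> complete_on {..<k})) f"
  then have "subtree_rep k (pverts M) (parcs M) T (\<lambda>v. fst ` f v)" by (rule model_imp_subtree_rep)
  moreover have "a \<noteq> b" "b \<noteq> c" "a \<noteq> c" using tri M'(4) by (auto simp: irrefl_def)
  ultimately show False using triangle_tree_cut[OF T _ \<open>k \<le> 2\<close> M'(2) tri] cut by blast
qed

section \<open>Trees by counting edges\<close>

text \<open>A finite connected graph in which every set \<open>W\<close> of nodes spans at most \<open>card W - 1\<close> edges, that is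
  \<open>2 * card W - 2\<close> arcs. This hereditary bound is easily seen to survive joining two trees by an edge,
  and it leaves no room for a cycle.\<close>

definition tree_like :: "'n set \<Rightarrow> 'n rel \<Rightarrow> bool" where
  "tree_like N R \<longleftrightarrow> finite N \<and> R \<subseteq> N \<times> N \<and> sym R \<and> irrefl R \<and> conn R N \<and>
     (\<forall>W \<subseteq> N. W \<noteq> {} \<longrightarrow> card (R \<inter> W \<times> W) + 2 \<le> 2 * card W)"

lemma awalk_arc_nth:
  assumes "pre_digraph.cas (with_proj T) u p v" "i < length p"
  shows "p ! i = (pre_digraph.awalk_verts (with_proj T) u p ! i,
    pre_digraph.awalk_verts (with_proj T) u p ! Suc i)"
  using assms
proof (induction p arbitrary: u i)
  case Nil
  then show ?case by simp
next
  case (Cons e p)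
  then have e: "fst e = u" "pre_digraph.cas (with_proj T) (snd e) p v"
    by (auto simp: pre_digraph.cas.simps)
  have hd: "pre_digraph.awalk_verts (with_proj T) (snd e) p ! 0 = snd e"
    using e(2) by (cases p) (auto simp: pre_digraph.awalk_verts.simps pre_digraph.cas.simps)
  show ?case
  proof (cases i)
    case 0
    then show ?thesis using hd by (simp add: pre_digraph.awalk_verts.simps prod_eq_iff)
  next
    case (Suc j)
    then show ?thesis using Cons.IH[OF e(2), of j] Cons.prems(2)
      by (simp add: pre_digraph.awalk_verts.simps)
  qed
qed

lemma awalk_verts_ends:
  assumes "pre_digraph.cas (with_proj T) u p v"
  shows "pre_digraph.awalk_verts (with_proj T) u p ! 0 = u"
    and "pre_digraph.awalk_verts (with_proj T) u p ! length p = v"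
  using assms
  by (induction p arbitrary: u) (auto simp: pre_digraph.awalk_verts.simps pre_digraph.cas.simps)

text \<open>A cycle through \<open>n \<ge> 3\<close> nodes spans \<open>n\<close> arcs in each direction, which is too many for the bound.\<close>

lemma tree_like_no_cycle:
  assumes T: "tree_like (pverts T) (parcs T)" and cyc: "pre_digraph.cycle (with_proj T) p"
  shows "length p < 3"
proof (rule ccontr)
  assume "\<not> length p < 3"
  then have n3: "length p \<ge> 3" by simp
  let ?n = "length p"
  obtain u where aw: "pre_digraph.awalk (with_proj T) u p u"
    and dist: "distinct (tl (pre_digraph.awalk_verts (with_proj T) u p))"
    using cyc by (auto simp: pre_digraph.cycle_def)
  define vs where "vs = pre_digraph.awalk_verts (with_proj T) u p"
  have cas: "pre_digraph.cas (with_proj T) u p u" and pR: "set p \<subseteq> parcs T"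
    using aw by (auto simp: pre_digraph.awalk_def)
  have len: "length vs = Suc ?n" unfolding vs_def by (rule pre_digraph.length_awalk_verts)
  have arc: "p ! i = (vs ! i, vs ! Suc i)" if "i < ?n" for i
    unfolding vs_def by (rule awalk_arc_nth[OF cas that])
  have "vs ! 0 = u" "vs ! ?n = u"
    unfolding vs_def using awalk_verts_ends[OF cas] by auto
  have inj: "i = j" if "vs ! i = vs ! j" "0 < i" "0 < j" "i \<le> ?n" "j \<le> ?n" for i j
  proof -
    have "tl vs ! (i - 1) = tl vs ! (j - 1)" using that len by (simp add: nth_tl)
    then show ?thesis using dist that len unfolding vs_def[symmetric]
      by (subst (asm) nth_eq_iff_index_eq) auto
  qed
  let ?W = "set (tl vs)"
  have W: "vs ! i \<in> ?W" if "i \<le> ?n" for i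
  proof -
    have "Suc (?n - 1) = ?n" using n3 by simp
    then have "vs ! i = tl vs ! (if i = 0 then ?n - 1 else i - 1)"
      using that len \<open>vs ! 0 = u\<close> \<open>vs ! ?n = u\<close> n3 by (simp add: nth_tl)
    then show ?thesis using that len n3 by simp
  qed
  have cardW: "card ?W = ?n" using dist len unfolding vs_def[symmetric] by (simp add: distinct_card)
  have pW: "set p \<subseteq> ?W \<times> ?W" using arc W by (auto simp: set_conv_nth)
  have "inj_on (\<lambda>i. p ! i) {..<?n}"
    using arc inj by (intro inj_onI) (metis Suc_inject Suc_leI lessThan_iff prod.inject zero_less_Suc)
  then have "distinct p" by (simp add: distinct_conv_nth inj_on_def) blast
  then have card_p: "card (set p) = ?n" by (rule distinct_card)
  then have card_p': "card ((set p)\<inverse>) = ?n" by simp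
  have "set p \<inter> (set p)\<inverse> = {}"
  proof (rule ccontr)
    assume "set p \<inter> (set p)\<inverse> \<noteq> {}"
    then obtain a b where ab: "(a, b) \<in> set p" "(b, a) \<in> set p" by auto
    obtain i where i: "i < ?n" "p ! i = (a, b)" using ab(1) by (auto simp: in_set_conv_nth)
    obtain j where j: "j < ?n" "p ! j = (b, a)" using ab(2) by (auto simp: in_set_conv_nth)
    have 1: "vs ! i = vs ! Suc j" "vs ! j = vs ! Suc i" using arc i j by auto
    have 2: "i = Suc j \<or> i = 0 \<and> Suc j = ?n"
      using inj[OF 1(1)] inj[of ?n "Suc j"] i j 1(1) \<open>vs ! 0 = u\<close> \<open>vs ! ?n = u\<close> by (cases i) auto
    have 3: "j = Suc i \<or> j = 0 \<and> Suc i = ?n"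
      using inj[OF 1(2)] inj[of ?n "Suc i"] i j 1(2) \<open>vs ! 0 = u\<close> \<open>vs ! ?n = u\<close> by (cases j) auto
    show False using 2 3 n3 by auto
  qed
  then have "card (set p \<union> (set p)\<inverse>) = 2 * ?n"
    using card_p card_p' by (subst card_Un_disjoint) auto
  moreover have "set p \<union> (set p)\<inverse> \<subseteq> parcs T \<inter> ?W \<times> ?W"
    using pR pW T by (auto simp: tree_like_def dest: symD)
  ultimately have "2 * ?n \<le> card (parcs T \<inter> ?W \<times> ?W)"
    by (metis List.finite_set card_mono finite_Int finite_SigmaI)
  moreover have "?W \<subseteq> pverts T"
  proof
    fix x assume "x \<in> ?W"
    then obtain i where i: "i < ?n" "x = vs ! Suc i" using len by (auto simp: in_set_conv_nth nth_tl)
    then have "(vs ! i, x) \<in> parcs T" using arc[OF i(1)] nth_mem[OF i(1)] pR by auto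
    then show "x \<in> pverts T" using T by (auto simp: tree_like_def)
  qed
  moreover have "?W \<noteq> {}" using cardW n3 by (metis card.empty not_numeral_le_zero)
  moreover have "\<forall>W \<subseteq> pverts T. W \<noteq> {} \<longrightarrow> card (parcs T \<inter> W \<times> W) + 2 \<le> 2 * card W"
    using T by (simp add: tree_like_def)
  ultimately have "2 * ?n \<le> card (parcs T \<inter> ?W \<times> ?W)"
    "card (parcs T \<inter> ?W \<times> ?W) + 2 \<le> 2 * card ?W" by simp_all
  then show False using cardW by linarith
qed

lemma tree_like_undirected_tree:
  assumes "tree_like N R"
  shows "undirected_tree \<lparr>pverts = N, parcs = R\<rparr>"
proof -
  let ?T = "\<lparr>pverts = N, parcs = R\<rparr>"
  have T: "pair_graph ?T" using assms by (simp add: tree_like_def pair_graph_iff)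
  have sub: "R \<subseteq> N \<times> N" and "sym R" and cn: "conn R N" using assms by (auto simp: tree_like_def)
  have m: "parcs (mk_symmetric (with_proj ?T)) = R"
    using \<open>sym R\<close> by (auto simp: parcs_mk_symmetric sym_def)
  interpret M: wf_digraph "with_proj (mk_symmetric (with_proj ?T))"
    using sub by unfold_locales (auto simp: m)
  have "u \<rightarrow>\<^sup>*\<^bsub>with_proj (mk_symmetric (with_proj ?T))\<^esub> v" if "u \<in> N" "v \<in> N" for u v
  proof -
    have "(u, v) \<in> (R \<inter> N \<times> N)\<^sup>*" using conn_imp_rtrancl[OF \<open>sym R\<close> cn that] .
    then show ?thesis
    proof (induction)
      case base
      then show ?case using that by (intro M.reachable_refl) simp
    next
      case (step y z)
      then have "y \<rightarrow>\<^bsub>with_proj (mk_symmetric (with_proj ?T))\<^esub> z"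
        by (auto simp: arcs_ends_def arc_to_ends_def m)
      then show ?case using step.IH by (rule M.reachable_adj_trans[rotated])
    qed
  qed
  then have "connected (with_proj ?T)"
    using conn_nonempty[OF cn] unfolding connected_def strongly_connected_def by simp
  moreover have "\<not> (\<exists>p. pre_digraph.cycle (with_proj ?T) p \<and> 3 \<le> length p)"
    using tree_like_no_cycle[of ?T] assms by fastforce
  ultimately show ?thesis using T by (simp add: undirected_tree_def)
qed

lemma tree_like_single: "tree_like {t} {}"
  by (auto simp: tree_like_def conn_single sym_def irrefl_def subset_singleton_iff)

lemma tree_like_join:
  assumes A1: "tree_like N1 R1" and A2: "tree_like N2 R2" and disj: "N1 \<inter> N2 = {}"
    and ab: "a \<in> N1" "b \<in> N2"
  shows "tree_like (N1 \<union> N2) (R1 \<union> R2 \<union> {(a, b), (b, a)})"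
proof -
  let ?R = "R1 \<union> R2 \<union> {(a, b), (b, a)}"
  note T1 = A1[unfolded tree_like_def] and T2 = A2[unfolded tree_like_def]
  have symR: "sym ?R" using T1 T2 by (auto simp: sym_def)
  have "conn ?R N1" "conn ?R N2" using T1 T2 by (auto intro: conn_mono)
  then have cn: "conn ?R (N1 \<union> N2)" using ab by (intro conn_Un[OF symR]) (auto simp: adj_def)
  have irr: "irrefl ?R" using T1 T2 ab disj by (auto simp: irrefl_def)
  have few: "card (?R \<inter> W \<times> W) + 2 \<le> 2 * card W" if W: "W \<subseteq> N1 \<union> N2" "W \<noteq> {}" for W
  proof -
    let ?W1 = "W \<inter> N1" and ?W2 = "W \<inter> N2"
    have fin: "finite ?W1" "finite ?W2" using T1 T2 by auto
    have W12: "W = ?W1 \<union> ?W2" using W by auto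
    have "?W1 \<inter> ?W2 = {}" using disj by blast
    with fin have "card (?W1 \<union> ?W2) = card ?W1 + card ?W2" by (rule card_Un_disjoint)
    then have cW: "card W = card ?W1 + card ?W2" using arg_cong[OF W12, of card] by linarith
    have c1: "card (R1 \<inter> ?W1 \<times> ?W1) + 2 \<le> 2 * card ?W1" if "?W1 \<noteq> {}" using T1 that by auto
    have c2: "card (R2 \<inter> ?W2 \<times> ?W2) + 2 \<le> 2 * card ?W2" if "?W2 \<noteq> {}" using T2 that by auto
    have sub: "x \<in> N1 \<and> y \<in> N1" if "(x, y) \<in> R1" for x y using T1 that by blast
    have sub2: "x \<in> N2 \<and> y \<in> N2" if "(x, y) \<in> R2" for x y using T2 that by blast
    note sub = sub sub2
    have fin12: "finite (R1 \<inter> ?W1 \<times> ?W1)" "finite (R2 \<inter> ?W2 \<times> ?W2)" using fin by auto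
    consider "?W1 = {}" | "?W2 = {}" | "?W1 \<noteq> {}" "?W2 \<noteq> {}" by blast
    then show ?thesis
    proof cases
      case 1
      then have "?R \<inter> W \<times> W \<subseteq> R2 \<inter> ?W2 \<times> ?W2" using sub ab(1) by (intro subrelI) blast
      then have "card (?R \<inter> W \<times> W) \<le> card (R2 \<inter> ?W2 \<times> ?W2)" by (rule card_mono[OF fin12(2)])
      moreover have "?W2 \<noteq> {}" "card ?W1 = 0" using 1 W by auto
      ultimately show ?thesis using c2[OF \<open>?W2 \<noteq> {}\<close>] cW by linarith
    next
      case 2
      then have "?R \<inter> W \<times> W \<subseteq> R1 \<inter> ?W1 \<times> ?W1" using sub ab(2) by (intro subrelI) blast
      then have "card (?R \<inter> W \<times> W) \<le> card (R1 \<inter> ?W1 \<times> ?W1)" by (rule card_mono[OF fin12(1)])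
      moreover have "?W1 \<noteq> {}" "card ?W2 = 0" using 2 W by auto
      ultimately show ?thesis using c1[OF \<open>?W1 \<noteq> {}\<close>] cW by linarith
    next
      case 3
      let ?X = "(R1 \<inter> ?W1 \<times> ?W1) \<union> (R2 \<inter> ?W2 \<times> ?W2) \<union> {(a, b), (b, a)}"
      have "?R \<inter> W \<times> W \<subseteq> ?X" using sub by (intro subrelI) blast
      then have le: "card (?R \<inter> W \<times> W) \<le> card ?X" using fin12 by (intro card_mono) auto
      have le2: "card ?X \<le> card (R1 \<inter> ?W1 \<times> ?W1) + card (R2 \<inter> ?W2 \<times> ?W2) + card {(a, b), (b, a)}"
        using card_Un_le[of "(R1 \<inter> ?W1 \<times> ?W1) \<union> (R2 \<inter> ?W2 \<times> ?W2)" "{(a, b), (b, a)}"]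
          card_Un_le[of "R1 \<inter> ?W1 \<times> ?W1" "R2 \<inter> ?W2 \<times> ?W2"] by linarith
      have "card {(a, b), (b, a)} \<le> 2" using card_length[of "[(a, b), (b, a)]"] by simp
      with le le2 show ?thesis using c1[OF 3(1)] c2[OF 3(2)] cW by linarith
    qed
  qed
  have "finite (N1 \<union> N2)" using T1 T2 by simp
  moreover have "?R \<subseteq> (N1 \<union> N2) \<times> (N1 \<union> N2)" using conjunct1[OF conjunct2[OF T1]]
      conjunct1[OF conjunct2[OF T2]] ab by blast
  ultimately show ?thesis using symR irr cn few unfolding tree_like_def by simp
qed

lemma conn_image:
  assumes "conn R A" "inj h"
  shows "conn (map_prod h h ` R) (h ` A)"
  unfolding conn_def
proof (intro conjI allI impI)
  show "h ` A \<noteq> {}" using conn_nonempty[OF assms(1)] by simp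
  fix B assume B: "B \<subseteq> h ` A" "B \<noteq> {}" "B \<noteq> h ` A"
  then have "h -` B \<inter> A \<noteq> {}" "\<not> A \<subseteq> h -` B" by auto
  then obtain b a where "b \<in> h -` B" "a \<in> A" "a \<notin> h -` B" "(b, a) \<in> R"
    using conn_cut[OF assms(1), of "h -` B"] by blast
  then show "\<exists>b \<in> B. \<exists>a \<in> h ` A - B. (b, a) \<in> map_prod h h ` R" by force
qed

lemma tree_like_image:
  assumes T: "tree_like N R" and h: "inj h"
  shows "tree_like (h ` N) (map_prod h h ` R)"
proof -
  note T' = T[unfolded tree_like_def]
  have inj2: "inj (map_prod h h)" using h by (simp add: prod.inj_map)
  have "card (map_prod h h ` R \<inter> W \<times> W) + 2 \<le> 2 * card W" if W: "W \<subseteq> h ` N" "W \<noteq> {}" for W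
  proof -
    obtain U where U: "U \<subseteq> N" "W = h ` U" using W(1) by (auto simp: subset_image_iff)
    have "map_prod h h ` R \<inter> W \<times> W = map_prod h h ` (R \<inter> U \<times> U)"
      using h unfolding U(2) by (auto simp: inj_eq)
    then have "card (map_prod h h ` R \<inter> W \<times> W) = card (R \<inter> U \<times> U)"
      using card_image inj_on_subset[OF inj2] by (metis subset_UNIV)
    moreover have "card W = card U" using U(2) h card_image inj_on_subset by (metis subset_UNIV)
    ultimately show ?thesis using T' U W(2) by auto
  qed
  moreover have "sym (map_prod h h ` R)" "irrefl (map_prod h h ` R)"
    using T' h by (fastforce simp: sym_def irrefl_def inj_def)+
  ultimately show ?thesis using T' conn_image[OF _ h, of R N] unfolding tree_like_def by auto
qed

section \<open>Representations by bags of size two\<close>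

text \<open>The subtree representation from the point of view of the tree nodes: the bag of a node consists of the
  vertices whose subtrees contain it.\<close>

definition tree_rep :: "'a rel \<Rightarrow> 'a set \<Rightarrow> nat set \<Rightarrow> nat rel \<Rightarrow> (nat \<Rightarrow> 'a set) \<Rightarrow> bool" where
  "tree_rep E S N R bag \<longleftrightarrow>
     tree_like N R \<and>
     (\<forall>t \<in> N. bag t \<subseteq> S \<and> finite (bag t) \<and> card (bag t) \<le> 2) \<and>
     (\<forall>v \<in> S. conn R {t \<in> N. v \<in> bag t}) \<and>
     (\<forall>u \<in> S. \<forall>v \<in> S. (u, v) \<in> E \<longrightarrow>
        (\<exists>s \<in> N. \<exists>t \<in> N. u \<in> bag s \<and> v \<in> bag t \<and> (s = t \<or> (s, t) \<in> R)))"

text \<open>Trees are grown by gluing at bags, so of a representation only one bag is remembered at which the next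
  tree may be attached.\<close>

definition rooted_rep :: "'a rel \<Rightarrow> 'a set \<Rightarrow> 'a set \<Rightarrow> bool" where
  "rooted_rep E S B \<longleftrightarrow> (\<exists>N R bag. tree_rep E S N R bag \<and> B \<in> bag ` N)"

lemma tree_repD:
  assumes "tree_rep E S N R bag"
  shows "tree_like N R"
    and "t \<in> N \<Longrightarrow> bag t \<subseteq> S" "t \<in> N \<Longrightarrow> finite (bag t)" "t \<in> N \<Longrightarrow> card (bag t) \<le> 2"
    and "v \<in> S \<Longrightarrow> conn R {t \<in> N. v \<in> bag t}"
    and "u \<in> S \<Longrightarrow> v \<in> S \<Longrightarrow> (u, v) \<in> E \<Longrightarrow>
      \<exists>s \<in> N. \<exists>t \<in> N. u \<in> bag s \<and> v \<in> bag t \<and> (s = t \<or> (s, t) \<in> R)"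
  using assms by (simp_all add: tree_rep_def)

lemma rooted_rep_leaf:
  assumes "finite B" "card B \<le> 2"
  shows "rooted_rep E B B"
proof -
  have "tree_rep E B {0} {} (\<lambda>_. B)"
    using assms by (auto simp: tree_rep_def tree_like_single conn_single)
  then show ?thesis unfolding rooted_rep_def by blast
qed

lemma rooted_rep_bag_at:
  assumes "rooted_rep E S B" "v \<in> S"
  shows "\<exists>B'. v \<in> B' \<and> rooted_rep E S B'"
proof -
  obtain N R bag where rep: "tree_rep E S N R bag" using assms(1) by (auto simp: rooted_rep_def)
  have "{t \<in> N. v \<in> bag t} \<noteq> {}" using conn_nonempty[OF tree_repD(5)[OF rep assms(2)]] .
  then show ?thesis using rep unfolding rooted_rep_def by blast
qed

lemma tree_rep_rename:
  assumes rep: "tree_rep E S N R bag" and h: "inj h"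
  shows "tree_rep E S (h ` N) (map_prod h h ` R) (\<lambda>t. bag (inv h t))"
proof -
  note d = tree_repD[OF rep]
  have [simp]: "inv h (h t) = t" for t using h by (rule inv_f_f)
  have im: "{t \<in> h ` N. v \<in> bag (inv h t)} = h ` {t \<in> N. v \<in> bag t}" for v by auto
  show ?thesis unfolding tree_rep_def im
  proof (intro conjI ballI impI)
    show "tree_like (h ` N) (map_prod h h ` R)" using tree_like_image[OF d(1) h] .
    fix t assume "t \<in> h ` N"
    then have "inv h t \<in> N" by auto
    then show "bag (inv h t) \<subseteq> S" "finite (bag (inv h t))" "card (bag (inv h t)) \<le> 2"
      using d(2-4) by simp_all
  next
    show "conn (map_prod h h ` R) (h ` {t \<in> N. v \<in> bag t})" if "v \<in> S" for v
      using conn_image[OF d(5)[OF that] h] .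
    fix u v assume "u \<in> S" "v \<in> S" "(u, v) \<in> E"
    then obtain s t where "s \<in> N" "t \<in> N" "u \<in> bag s" "v \<in> bag t" "s = t \<or> (s, t) \<in> R"
      using d(6) by blast
    then show "\<exists>s \<in> h ` N. \<exists>t \<in> h ` N. u \<in> bag (inv h s) \<and> v \<in> bag (inv h t) \<and>
        (s = t \<or> (s, t) \<in> map_prod h h ` R)"
      by (intro bexI[of _ "h s"] bexI[of _ "h t"]) auto
  qed
qed

text \<open>An edge is drawn between the tree nodes that carry \<open>B1\<close> and \<open>B2\<close>. Vertices common to both parts lie in both bags,
  so their subtrees are united along the new edge.\<close>

lemma rooted_rep_join:
  assumes "sym E" "rooted_rep E S1 B1" "rooted_rep E S2 B2" and int: "S1 \<inter> S2 \<subseteq> B1 \<inter> B2"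
    and cross: "\<And>u v. u \<in> S1 - S2 \<Longrightarrow> v \<in> S2 - S1 \<Longrightarrow> (u, v) \<in> E \<Longrightarrow> u \<in> B1 \<and> v \<in> B2"
  shows "rooted_rep E (S1 \<union> S2) B1"
proof -
  obtain N1 R1 b1 t1 where rep1: "tree_rep E S1 N1 R1 b1" "t1 \<in> N1" "b1 t1 = B1"
    using assms(2) by (auto simp: rooted_rep_def)
  obtain N R b t where rep: "tree_rep E S2 N R b" "t \<in> N" "b t = B2"
    using assms(3) by (auto simp: rooted_rep_def)
  have "finite N1" using tree_repD(1)[OF rep1(1)] by (simp add: tree_like_def)
  \<comment> \<open>shifting the second tree by \<open>m\<close> makes the trees disjoint\<close>
  then obtain m where m: "\<forall>s \<in> N1. s < m" using finite_nat_set_iff_bounded by blast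
  define h where "h = (\<lambda>t. t + m :: nat)"
  have h: "inj h" by (simp add: h_def inj_def)
  define N2 R2 b2 where "N2 = h ` N" "R2 = map_prod h h ` R" "b2 = (\<lambda>t. b (inv h t))"
  define t2 where "t2 = h t"
  have rep2: "tree_rep E S2 N2 R2 b2" "t2 \<in> N2" "b2 t2 = B2"
    using tree_rep_rename[OF rep(1) h] rep h unfolding N2_R2_b2_def t2_def by auto
  have disj: "N1 \<inter> N2 = {}" using m by (auto simp: N2_R2_b2_def h_def)
  note d1 = tree_repD[OF rep1(1)] and d2 = tree_repD[OF rep2(1)]
  let ?R = "R1 \<union> R2 \<union> {(t1, t2), (t2, t1)}"
  let ?b = "\<lambda>s. if s \<in> N1 then b1 s else b2 s"
  have T: "tree_like (N1 \<union> N2) ?R" using tree_like_join[OF d1(1) d2(1) disj rep1(2) rep2(2)] .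
  then have symR: "sym ?R" unfolding tree_like_def by blast
  have b2: "?b s = b2 s" if "s \<in> N2" for s using that disj by auto
  have "tree_rep E (S1 \<union> S2) (N1 \<union> N2) ?R ?b"
    unfolding tree_rep_def
  proof (intro conjI ballI impI)
    show "tree_like (N1 \<union> N2) ?R" by fact
    show "?b s \<subseteq> S1 \<union> S2" "finite (?b s)" "card (?b s) \<le> 2" if "s \<in> N1 \<union> N2" for s
      using that d1(2-4)[of s] d2(2-4)[of s] by auto
  next
    fix v assume v: "v \<in> S1 \<union> S2"
    have eq: "{s \<in> N1 \<union> N2. v \<in> ?b s} = {s \<in> N1. v \<in> b1 s} \<union> {s \<in> N2. v \<in> b2 s}"
      using disj by auto
    have c1: "conn ?R {s \<in> N1. v \<in> b1 s}" if "v \<in> S1" by (rule conn_mono[OF d1(5)[OF that]]) auto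
    have c2: "conn ?R {s \<in> N2. v \<in> b2 s}" if "v \<in> S2" by (rule conn_mono[OF d2(5)[OF that]]) auto
    have e1: "{s \<in> N1. v \<in> b1 s} = {}" if "v \<notin> S1" using d1(2) that by auto
    have e2: "{s \<in> N2. v \<in> b2 s} = {}" if "v \<notin> S2" using d2(2) that by auto
    show "conn ?R {s \<in> N1 \<union> N2. v \<in> ?b s}"
    proof (cases "v \<in> S1 \<and> v \<in> S2")
      case True
      then have "v \<in> b1 t1" "v \<in> b2 t2" using int rep1(3) rep2(3) by auto
      then show ?thesis unfolding eq using True c1 c2 rep1(2) rep2(2)
        by (intro conn_Un[OF symR]) (auto simp: adj_def)
    next
      case False
      then consider "v \<in> S1" "v \<notin> S2" | "v \<in> S2" "v \<notin> S1" using v by blast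
      then show ?thesis
      proof cases
        case 1
        show ?thesis unfolding eq e2[OF 1(2)] Un_empty_right using c1[OF 1(1)] .
      next
        case 2
        show ?thesis unfolding eq e1[OF 2(2)] Un_empty_left using c2[OF 2(1)] .
      qed
    qed
  next
    fix u v assume uv: "u \<in> S1 \<union> S2" "v \<in> S1 \<union> S2" "(u, v) \<in> E"
    consider "u \<in> S1" "v \<in> S1" | "u \<in> S2" "v \<in> S2" | "u \<in> S1 - S2" "v \<in> S2 - S1" | "u \<in> S2 - S1" "v \<in> S1 - S2"
      using uv by blast
    then show "\<exists>s \<in> N1 \<union> N2. \<exists>t \<in> N1 \<union> N2. u \<in> ?b s \<and> v \<in> ?b t \<and> (s = t \<or> (s, t) \<in> ?R)"
    proof cases
      case 1
      then obtain s t where "s \<in> N1" "t \<in> N1" "u \<in> b1 s" "v \<in> b1 t" "s = t \<or> (s, t) \<in> R1"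
        using d1(6) uv by blast
      then show ?thesis by (intro bexI[of _ s] bexI[of _ t]) auto
    next
      case 2
      then obtain s t where "s \<in> N2" "t \<in> N2" "u \<in> b2 s" "v \<in> b2 t" "s = t \<or> (s, t) \<in> R2"
        using d2(6) uv by blast
      then show ?thesis using b2 by (intro bexI[of _ s] bexI[of _ t]) auto
    next
      case 3
      then have "u \<in> b1 t1" "v \<in> b2 t2" using cross uv(3) rep1(3) rep2(3) by auto
      then show ?thesis using rep1(2) rep2(2) b2 by (intro bexI[of _ t1] bexI[of _ t2]) auto
    next
      case 4
      then have "v \<in> b1 t1" "u \<in> b2 t2"
        using cross symD[OF \<open>sym E\<close> uv(3)] rep1(3) rep2(3) by auto
      then show ?thesis using rep1(2) rep2(2) b2 by (intro bexI[of _ t2] bexI[of _ t1]) auto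
    qed
  qed
  then show ?thesis unfolding rooted_rep_def using rep1(2,3) by force
qed

lemma rooted_rep_cong:
  assumes "rooted_rep E S B" "E' \<inter> S \<times> S \<subseteq> E"
  shows "rooted_rep E' S B"
proof -
  obtain N R bag where rep: "tree_rep E S N R bag" "B \<in> bag ` N" using assms(1) by (auto simp: rooted_rep_def)
  have "(u, v) \<in> E" if "u \<in> S" "v \<in> S" "(u, v) \<in> E'" for u v using that assms(2) by blast
  then have "tree_rep E' S N R bag" using rep(1) by (simp add: tree_rep_def)
  then show ?thesis using rep(2) unfolding rooted_rep_def by blast
qed

text \<open>Representations of the parts behind \<open>B\<close> are all attached to one node with bag \<open>B\<close>.\<close>

lemma rooted_rep_comps:
  assumes "sym E" "finite S" "B \<subseteq> S" "card B \<le> 2"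
    and comps: "\<And>C. C \<in> comps E (S - B) \<Longrightarrow> rooted_rep E (C \<union> B) B"
  shows "rooted_rep E S B"
proof -
  have finB: "finite B" using assms(2,3) by (rule finite_subset[rotated])
  have "rooted_rep E (\<Union> F \<union> B) B" if "finite F" "F \<subseteq> comps E (S - B)" for F
    using that
  proof (induction F rule: finite_induct)
    case empty
    then show ?case using rooted_rep_leaf[OF finB assms(4)] by simp
  next
    case (insert C F)
    have C: "C \<in> comps E (S - B)" using insert by simp
    have FS: "\<Union> F \<subseteq> S - B" using insert.prems compsD(1) by blast
    have "C \<inter> D = {}" if "D \<in> F" for D
      using comps_disjoint[OF assms(1) C] that insert by blast
    then have disj: "C \<inter> \<Union> F = {}" by blast
    have "rooted_rep E ((\<Union> F \<union> B) \<union> (C \<union> B)) B"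
    proof (rule rooted_rep_join[OF assms(1) _ comps[OF C]])
      show "rooted_rep E (\<Union> F \<union> B) B" using insert by simp
      show "(\<Union> F \<union> B) \<inter> (C \<union> B) \<subseteq> B \<inter> B" using disj by blast
      fix u v assume uv: "u \<in> (\<Union> F \<union> B) - (C \<union> B)" "v \<in> (C \<union> B) - (\<Union> F \<union> B)" "(u, v) \<in> E"
      then have "u \<in> nb E C" using \<open>sym E\<close> by (auto simp: nb_iff dest: symD)
      then show "u \<in> B \<and> v \<in> B" using compsD(3)[OF C] uv(1) FS by blast
    qed
    then show ?case by (simp add: Un_ac)
  qed
  moreover have "comps E (S - B) \<subseteq> Pow S" using compsD(1) by blast
  then have "finite (comps E (S - B))" using assms(2) finite_subset by blast
  ultimately have "rooted_rep E (\<Union> (comps E (S - B)) \<union> B) B" by blast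
  moreover have "S - B \<union> B = S" using assms(3) by blast
  ultimately show ?thesis using Union_comps[OF assms(1), of "S - B"] by simp
qed

text \<open>From the bag \<open>B\<close> the tree is continued into \<open>C\<close> with the adjacent bag \<open>B'\<close>. Vertices of \<open>B\<close> outside \<open>B'\<close>
  end here, so their neighbours in \<open>C\<close> must all be in \<open>B'\<close>.\<close>

lemma rooted_rep_step:
  assumes "sym E" "finite C" "finite B" "card B \<le> 2" "B \<inter> C = {}"
    and B': "B' \<subseteq> B \<union> C" "card B' \<le> 2"
    and left: "\<And>b c. b \<in> B - B' \<Longrightarrow> c \<in> C \<Longrightarrow> (b, c) \<in> E \<Longrightarrow> c \<in> B'"
    and comps: "\<And>D. D \<in> comps E (C - B') \<Longrightarrow> rooted_rep E (D \<union> B') B'"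
  shows "rooted_rep E (C \<union> B) B"
proof -
  have eq: "(C \<union> B') - B' = C - B'" by blast
  have "finite B'" using B'(1) assms(2,3) finite_subset by blast
  then have "finite (C \<union> B')" using assms(2) by simp
  then have "rooted_rep E (C \<union> B') B'"
    by (rule rooted_rep_comps[OF assms(1)]) (use B'(2) comps eq in simp_all)
  then have "rooted_rep E (B \<union> (C \<union> B')) B"
  proof (rule rooted_rep_join[OF assms(1) rooted_rep_leaf[OF assms(3,4)]])
    show "B \<inter> (C \<union> B') \<subseteq> B \<inter> B'" using assms(5) by blast
    fix u v assume uv: "u \<in> B - (C \<union> B')" "v \<in> C \<union> B' - B" "(u, v) \<in> E"
    then have "v \<in> C" using B'(1) by blast
    then show "u \<in> B \<and> v \<in> B'" using left[of u v] uv by simp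
  qed
  moreover have "B \<union> (C \<union> B') = C \<union> B" using B'(1) by blast
  ultimately show ?thesis by simp
qed

text \<open>At each tree node \<open>t\<close> the vertices of the bag are distributed over the two copies of \<open>t\<close>. The choices at
  different nodes are independent, because in the strong product all copies of adjacent nodes are
  adjacent.\<close>

lemma rooted_rep_imp_minor:
  assumes G: "pair_graph G" and "rooted_rep (parcs G) (pverts G) B"
  shows "\<exists>T :: nat pair_pre_digraph. undirected_tree T \<and> minor G (T \<boxtimes> complete_on {..<2 :: nat})"
proof -
  obtain N R bag where rep: "tree_rep (parcs G) (pverts G) N R bag"
    using assms(2) by (auto simp: rooted_rep_def)
  note d = tree_repD[OF rep]
  let ?T = "\<lparr>pverts = N, parcs = R\<rparr>"
  let ?P = "?T \<boxtimes> complete_on {..<2 :: nat}"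
  have T: "undirected_tree ?T" using tree_like_undirected_tree[OF d(1)] .
  have "\<exists>h :: 'a \<Rightarrow> nat. inj_on h (bag t) \<and> h ` bag t \<subseteq> {..<2}" if "t \<in> N" for t
    using card_le_inj[OF d(3)[OF that], of "{..<2 :: nat}"] d(4)[OF that] by auto
  then obtain h :: "nat \<Rightarrow> 'a \<Rightarrow> nat" where h: "\<And>t. t \<in> N \<Longrightarrow> inj_on (h t) (bag t)"
    "\<And>t. t \<in> N \<Longrightarrow> h t ` bag t \<subseteq> {..<2}" by metis
  define f where "f v = (\<lambda>t. (t, h t v)) ` {t \<in> N. v \<in> bag t}" for v
  have arc: "((s, h s u), (t, h t v)) \<in> parcs ?P"
    if "s \<in> N" "t \<in> N" "u \<in> bag s" "v \<in> bag t" "s = t \<and> u \<noteq> v \<or> (s, t) \<in> R" "(s, t) \<in> R \<longrightarrow> s \<noteq> t" for s t u v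
  proof -
    have "h s u < 2" "h t v < 2" using h(2) that by blast+
    moreover have "h s u \<noteq> h t v" if "s = t" "u \<noteq> v"
      using h(1)[OF \<open>s \<in> N\<close>] that \<open>u \<in> bag s\<close> \<open>v \<in> bag t\<close> by (simp add: inj_on_eq_iff)
    ultimately show ?thesis using that by (auto simp: strong_product_def complete_on_def)
  qed
  have irr: "s \<noteq> t" if "(s, t) \<in> R" for s t using d(1) that by (auto simp: tree_like_def irrefl_def)
  have "model (pverts G) (parcs G) (pverts ?P) (parcs ?P) f"
  proof (rule modelI)
    fix v assume v: "v \<in> pverts G"
    show "f v \<subseteq> pverts ?P" using h(2) by (fastforce simp: f_def strong_product_def complete_on_def)
    show "conn (parcs ?P) (f v)" unfolding conn_def
    proof (intro conjI allI impI)
      show "f v \<noteq> {}" using conn_nonempty[OF d(5)[OF v]] by (simp add: f_def)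
      fix D assume D: "D \<subseteq> f v" "D \<noteq> {}" "D \<noteq> f v"
      let ?D = "{t. (t, h t v) \<in> D}"
      have "?D \<inter> {t \<in> N. v \<in> bag t} \<noteq> {}" "\<not> {t \<in> N. v \<in> bag t} \<subseteq> ?D"
        using D by (auto simp: f_def)
      then obtain b a where ba: "b \<in> ?D" "b \<in> N" "v \<in> bag b" "a \<in> N" "v \<in> bag a" "a \<notin> ?D" "(b, a) \<in> R"
        using conn_cut[OF d(5)[OF v], of ?D] by blast
      have "((b, h b v), (a, h a v)) \<in> parcs ?P" using ba irr[OF ba(7)] by (intro arc) auto
      moreover have "(b, h b v) \<in> D" "(a, h a v) \<in> f v - D" using ba by (auto simp: f_def)
      ultimately show "\<exists>b \<in> D. \<exists>a \<in> f v - D. (b, a) \<in> parcs ?P" by blast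
    qed
  next
    fix u v assume "u \<in> pverts G" "v \<in> pverts G" "u \<noteq> v"
    then show "f u \<inter> f v = {}" using inj_onD[OF h(1)] by (fastforce simp: f_def)
  next
    fix u v assume uv: "(u, v) \<in> parcs G"
    then have "u \<in> pverts G" "v \<in> pverts G" "u \<noteq> v"
      using pair_graphD(2,4)[OF G] by (auto simp: irrefl_def)
    then obtain s t where st: "s \<in> N" "t \<in> N" "u \<in> bag s" "v \<in> bag t" "s = t \<or> (s, t) \<in> R"
      using d(6) uv by blast
    then have "((s, h s u), (t, h t v)) \<in> parcs ?P" using \<open>u \<noteq> v\<close> irr by (intro arc) auto
    then show "adj (parcs ?P) (f u) (f v)" using st by (auto simp: adj_def f_def)
  qed
  moreover have "pair_graph ?P"
    using T by (intro pair_graph_strong_product pair_graph_complete_on) (auto simp: undirected_tree_def)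
  ultimately have "minor G ?P" using model_imp_minor[OF G] by blast
  then show ?thesis using T by blast
qed

section \<open>Rooted minors that block the continuation of a tree\<close>

text \<open>Connectivity in terms of neighbourhoods: fewer than \<open>k\<close> vertices never separate a set from the
  rest. Complete graphs satisfy this for every \<open>k\<close>.\<close>

definition kconn :: "nat \<Rightarrow> 'a set \<Rightarrow> 'a rel \<Rightarrow> bool" where
  "kconn k V E \<longleftrightarrow> (\<forall>C \<subseteq> V. C \<noteq> {} \<longrightarrow> card (nb E C) < k \<longrightarrow> C \<union> nb E C = V)"

lemma kconnD: "kconn k V E \<Longrightarrow> C \<subseteq> V \<Longrightarrow> C \<noteq> {} \<Longrightarrow> card (nb E C) < k \<Longrightarrow> C \<union> nb E C = V"
  unfolding kconn_def by blast

locale fgraph =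
  fixes V :: "'a set" and E :: "'a rel"
  assumes finV: "finite V" and wf: "E \<subseteq> V \<times> V" and sym: "sym E" and irr: "irrefl E"
begin

lemma arcD: "(u, v) \<in> E \<Longrightarrow> u \<in> V \<and> v \<in> V \<and> u \<noteq> v \<and> (v, u) \<in> E"
  using wf sym irr by (auto simp: irrefl_def dest: symD)

lemma nb_in_V: "nb E C \<subseteq> V"
  using wf by (auto simp: nb_def)

text \<open>Otherwise a single vertex would separate \<open>C\<close> from the other root.\<close>

lemma two_connected_nb:
  assumes "kconn 2 V E" "C \<subseteq> V" "C \<noteq> {}" "nb E C \<subseteq> {x, y}" "x \<in> V - C" "y \<in> V - C" "x \<noteq> y"
  shows "nb E C = {x, y}"
proof (rule ccontr)
  assume "nb E C \<noteq> {x, y}"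
  then obtain z where z: "nb E C \<subseteq> {z}" "z = x \<or> z = y" using assms(4) by blast
  then have "card (nb E C) \<le> card {z}" by (intro card_mono) auto
  then have "C \<union> nb E C = V" by (intro kconnD[OF assms(1-3)]) simp
  then show False using z assms(5-7) by blast
qed

end

text \<open>The common part of the two configurations that obstruct the continuation of a tree from the bag
  \<open>{x, y}\<close>: branch sets \<open>X\<close> and \<open>Y\<close> of the roots and three more branch sets, such that each root is adjacent
  to two of them and \<open>A2\<close> serves both. The configurations differ in which of the three is adjacent to the
  other two.\<close>

definition blocked :: "'a rel \<Rightarrow> 'a set \<Rightarrow> 'a \<Rightarrow> 'a \<Rightarrow>
    'a set \<Rightarrow> 'a set \<Rightarrow> 'a set \<Rightarrow> 'a set \<Rightarrow> 'a set \<Rightarrow> bool" where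
  "blocked E D x y X Y A1 A2 A3 \<longleftrightarrow>
     x \<in> X \<and> y \<in> Y \<and> X \<union> Y \<union> A1 \<union> A2 \<union> A3 \<subseteq> D \<and>
     conn E X \<and> conn E Y \<and> conn E A1 \<and> conn E A2 \<and> conn E A3 \<and>
     X \<inter> Y = {} \<and> X \<inter> A1 = {} \<and> X \<inter> A2 = {} \<and> X \<inter> A3 = {} \<and>
     Y \<inter> A1 = {} \<and> Y \<inter> A2 = {} \<and> Y \<inter> A3 = {} \<and>
     A1 \<inter> A2 = {} \<and> A1 \<inter> A3 = {} \<and> A2 \<inter> A3 = {} \<and>
     adj E X A1 \<and> adj E X A2 \<and> adj E Y A2 \<and> adj E Y A3"

text \<open>Two triangles, on \<open>X\<close>, \<open>A1\<close>, \<open>A2\<close> and on \<open>Y\<close>, \<open>A2\<close>, \<open>A3\<close>, with \<open>A2\<close> in common.\<close>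

definition bowtie :: "'a rel \<Rightarrow> 'a set \<Rightarrow> 'a \<Rightarrow> 'a \<Rightarrow> bool" where
  "bowtie E D x y \<longleftrightarrow>
     (\<exists>X Y A1 A2 A3. blocked E D x y X Y A1 A2 A3 \<and> adj E A1 A2 \<and> adj E A2 A3)"

text \<open>A circuit \<open>A1\<close>, \<open>A2\<close>, \<open>Y\<close>, \<open>A3\<close> with \<open>X\<close> attached to both ends of its edge \<open>A1 A2\<close>. The roots do not play
  symmetric roles.\<close>

definition kite :: "'a rel \<Rightarrow> 'a set \<Rightarrow> 'a \<Rightarrow> 'a \<Rightarrow> bool" where
  "kite E D x y \<longleftrightarrow>
     (\<exists>X Y A1 A2 A3. blocked E D x y X Y A1 A2 A3 \<and> adj E A1 A2 \<and> adj E A1 A3)"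

lemma adj_insertI: "adj E X A \<Longrightarrow> adj E (insert x X) A"
  unfolding adj_def by blast

lemma two_elements:
  assumes "2 \<le> card S"
  obtains a b where "a \<in> S" "b \<in> S" "a \<noteq> b"
proof -
  obtain a where a: "a \<in> S" using assms by fastforce
  moreover have "S \<noteq> {a}" using assms by auto
  ultimately show ?thesis using that by blast
qed

text \<open>A root may be moved along an edge to a vertex outside the configuration, which then joins the
  branch set of the root.\<close>

lemma blocked_lift:
  assumes "sym E" and b: "blocked E D' x' y' X Y A1 A2 A3" and "D' \<subseteq> D" "x \<in> D" "y \<in> D" "x \<noteq> y"
    and x: "x = x' \<or> (x, x') \<in> E \<and> x \<notin> D'" and y: "y = y' \<or> (y, y') \<in> E \<and> y \<notin> D'"
  shows "blocked E D x y (insert x X) (insert y Y) A1 A2 A3"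
proof -
  note b' = b[unfolded blocked_def]
  have dX: "X \<inter> Y = {}" "X \<inter> A1 = {}" "X \<inter> A2 = {}" "X \<inter> A3 = {}"
    and dY: "X \<inter> Y = {}" "Y \<inter> A1 = {}" "Y \<inter> A2 = {}" "Y \<inter> A3 = {}" using b' by simp_all
  have xX: "x \<in> X \<or> x \<notin> D'" and yY: "y \<in> Y \<or> y \<notin> D'" using x y b' by auto
  have sub: "X \<subseteq> D'" "Y \<subseteq> D'" "A1 \<subseteq> D'" "A2 \<subseteq> D'" "A3 \<subseteq> D'" using b' by auto
  have "conn E (insert x X)"
  proof (cases "x = x'")
    case True
    then have "insert x X = X" using b' by blast
    then show ?thesis using b' by simp
  next
    case False
    then show ?thesis using x b' conn_insert[OF assms(1), of X x' x] by simp
  qed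
  moreover have "conn E (insert y Y)"
  proof (cases "y = y'")
    case True
    then have "insert y Y = Y" using b' by blast
    then show ?thesis using b' by simp
  next
    case False
    then show ?thesis using y b' conn_insert[OF assms(1), of Y y' y] by simp
  qed
  moreover have xn: "x \<notin> Y" "x \<notin> A1" "x \<notin> A2" "x \<notin> A3"
    using xX dX sub by blast+
  moreover have yn: "y \<notin> X" "y \<notin> A1" "y \<notin> A2" "y \<notin> A3"
    using yY dY sub by blast+
  moreover have "adj E (insert x X) A1" "adj E (insert x X) A2" "adj E (insert y Y) A2" "adj E (insert y Y) A3"
    using b' by (simp_all add: adj_insertI)
  moreover have "insert x X \<union> insert y Y \<union> A1 \<union> A2 \<union> A3 \<subseteq> D"
    using sub assms(3-5) by blast
  moreover have "insert x X \<inter> insert y Y = {}" using xn(1) yn(1) dX(1) assms(6) by blast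
  ultimately show ?thesis
    using b' unfolding blocked_def by simp
qed

lemma bowtie_lift:
  assumes "sym E" "bowtie E D' x' y'" "D' \<subseteq> D" "x \<in> D" "y \<in> D" "x \<noteq> y"
    "x = x' \<or> (x, x') \<in> E \<and> x \<notin> D'" "y = y' \<or> (y, y') \<in> E \<and> y \<notin> D'"
  shows "bowtie E D x y"
  using assms(2) blocked_lift[OF assms(1) _ assms(3-8)] unfolding bowtie_def by blast

lemma kite_lift:
  assumes "sym E" "kite E D' x' y'" "D' \<subseteq> D" "x \<in> D" "y \<in> D" "x \<noteq> y"
    "x = x' \<or> (x, x') \<in> E \<and> x \<notin> D'" "y = y' \<or> (y, y') \<in> E \<and> y \<notin> D'"
  shows "kite E D x y"
  using assms(2) blocked_lift[OF assms(1) _ assms(3-8)] unfolding kite_def by blast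

text \<open>First \<open>C\<close> is split into two connected parts that both meet \<open>S\<close>. If both also meet \<open>R\<close>, the bound on
  \<open>S \<union> R\<close> provides a part with distinct elements of \<open>S\<close> and of \<open>R\<close>, which are then separated; otherwise the
  part containing \<open>R\<close> is split between two elements of \<open>R\<close>.\<close>

lemma three_parts:
  assumes "sym E" "conn E C" "S \<subseteq> C" "R \<subseteq> C"
    and S: "card S \<ge> 2" and R: "card R \<ge> 2" and SR: "card (S \<union> R) \<ge> 3"
  obtains A1 A2 A3 where "A1 \<union> A2 \<union> A3 = C" "A1 \<inter> A2 = {}" "A1 \<inter> A3 = {}" "A2 \<inter> A3 = {}"
    "conn E A1" "conn E A2" "conn E A3"
    "S \<inter> A1 \<noteq> {}" "S \<inter> A2 \<noteq> {}" "R \<inter> A2 \<noteq> {}" "R \<inter> A3 \<noteq> {}"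
proof -
  note result = that
  obtain s1 s2 where s: "s1 \<in> S" "s2 \<in> S" "s1 \<noteq> s2"
    using two_elements[OF S] .
  have sC: "s1 \<in> C" "s2 \<in> C" using s(1,2) assms(3) by auto
  obtain P Q where PQ: "P \<union> Q = C" "P \<inter> Q = {}" "s1 \<in> P" "s2 \<in> Q" "conn E P" "conn E Q" "adj E P Q"
    using conn_split[OF assms(1,2) sC s(3)] .
  have main: thesis if PQ: "P \<union> Q = C" "P \<inter> Q = {}" "conn E P" "conn E Q"
    and SP: "S \<inter> P \<noteq> {}" "S \<inter> Q \<noteq> {}" "R \<inter> P \<noteq> {}"
    and RQ: "R \<inter> Q \<noteq> {} \<longrightarrow> (\<exists>s \<in> S \<inter> P. \<exists>r \<in> R \<inter> P. s \<noteq> r)" for P Q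
  proof (cases "R \<inter> Q = {}")
    case False
    then obtain s r where sr: "s \<in> S" "s \<in> P" "r \<in> R" "r \<in> P" "s \<noteq> r" using RQ by blast
    obtain P1 P2 where P: "P1 \<union> P2 = P" "P1 \<inter> P2 = {}" "s \<in> P1" "r \<in> P2" "conn E P1" "conn E P2" "adj E P1 P2"
      using conn_split[OF assms(1) PQ(3) sr(2,4,5)] .
    have "P1 \<union> Q \<union> P2 = C" "P1 \<inter> Q = {}" "Q \<inter> P2 = {}" using P(1,2) PQ(1,2) by auto
    moreover have "S \<inter> P1 \<noteq> {}" "R \<inter> P2 \<noteq> {}" using sr(1,3) P(3,4) by auto
    ultimately show thesis using P(2,5,6) PQ(4) SP(2) False by (intro result[of P1 Q P2])
  next
    case True
    then have RP: "R \<subseteq> P" using assms(4) PQ(1) by blast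
    obtain r1 r2 where r: "r1 \<in> R" "r2 \<in> R" "r1 \<noteq> r2"
      using two_elements[OF R] .
    have rP: "r1 \<in> P" "r2 \<in> P" using r RP by auto
    obtain P1 P2 where P: "P1 \<union> P2 = P" "P1 \<inter> P2 = {}" "r1 \<in> P1" "r2 \<in> P2" "conn E P1" "conn E P2" "adj E P1 P2"
      using conn_split[OF assms(1) PQ(3) rP r(3)] .
    have RP12: "R \<inter> P1 \<noteq> {}" "R \<inter> P2 \<noteq> {}" using P(3,4) r(1,2) by auto
    have disj: "Q \<inter> P1 = {}" "Q \<inter> P2 = {}" "P2 \<inter> P1 = {}" using P(1,2) PQ(2) by auto
    have un: "Q \<union> P1 \<union> P2 = C" "Q \<union> P2 \<union> P1 = C" using P(1) PQ(1) by auto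
    have "S \<inter> P1 \<noteq> {} \<or> S \<inter> P2 \<noteq> {}" using SP(1) P(1) by blast
    then show thesis
    proof
      assume "S \<inter> P1 \<noteq> {}"
      then show thesis
        using un(1) disj(1,2) P(2,5,6) PQ(4) SP(2) RP12 by (intro result[of Q P1 P2])
    next
      assume "S \<inter> P2 \<noteq> {}"
      then show thesis
        using un(2) disj P(5,6) PQ(4) SP(2) RP12 by (intro result[of Q P2 P1])
    qed
  qed
  have SPQ: "S \<inter> P \<noteq> {}" "S \<inter> Q \<noteq> {}" using s(1,2) PQ(3,4) by auto
  obtain r where "r \<in> R" using two_elements[OF R] by metis
  then have RPQ: "R \<inter> P \<noteq> {} \<or> R \<inter> Q \<noteq> {}" using assms(4) PQ(1) by blast
  have QP: "Q \<union> P = C" "Q \<inter> P = {}" using PQ(1,2) by auto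
  consider "R \<inter> P \<noteq> {}" "R \<inter> Q = {}" | "R \<inter> P = {}" "R \<inter> Q \<noteq> {}" | "R \<inter> P \<noteq> {}" "R \<inter> Q \<noteq> {}"
    using RPQ by argo
  then show thesis
  proof cases
    case 1
    show thesis by (rule main[OF PQ(1,2,5,6) SPQ 1(1)]) (simp add: 1(2))
  next
    case 2
    show thesis by (rule main[OF QP PQ(6,5) SPQ(2,1) 2(2)]) (simp add: 2(1))
  next
    case 3
    have "(\<exists>s \<in> S \<inter> P. \<exists>r \<in> R \<inter> P. s \<noteq> r) \<or> (\<exists>s \<in> S \<inter> Q. \<exists>r \<in> R \<inter> Q. s \<noteq> r)"
    proof (rule ccontr)
      assume neg: "\<not> ?thesis"
      obtain p q where pq: "p \<in> S" "p \<in> P" "q \<in> S" "q \<in> Q" using SPQ by blast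
      have negP: "s = r" if "s \<in> S" "s \<in> P" "r \<in> R" "r \<in> P" for s r
        using neg that by auto
      have negQ: "s = r" if "s \<in> S" "s \<in> Q" "r \<in> R" "r \<in> Q" for s r
        using neg that by auto
      have RP: "R \<inter> P \<subseteq> {p}" and RQ: "R \<inter> Q \<subseteq> {q}" using negP[OF pq(1,2)] negQ[OF pq(3,4)] by auto
      then have "p \<in> R" "q \<in> R" using 3 by auto
      then have "S \<inter> P \<subseteq> {p}" "S \<inter> Q \<subseteq> {q}" using negP[of _ p] negQ[of _ q] pq(2,4) by auto
      moreover have "S \<union> R \<subseteq> P \<union> Q" using PQ(1) assms(3,4) by simp
      ultimately have "S \<union> R \<subseteq> {p, q}" using RP RQ by blast
      then have "card (S \<union> R) \<le> card {p, q}" by (intro card_mono) auto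
      also have "\<dots> \<le> 2" using card_length[of "[p, q]"] by simp
      finally show False using SR by simp
    qed
    then show thesis
    proof
      assume "\<exists>s \<in> S \<inter> P. \<exists>r \<in> R \<inter> P. s \<noteq> r"
      then show thesis by (intro main[OF PQ(1,2,5,6) SPQ 3(1)] impI)
    next
      assume "\<exists>s \<in> S \<inter> Q. \<exists>r \<in> R \<inter> Q. s \<noteq> r"
      then show thesis by (intro main[OF QP PQ(6,5) SPQ(2,1) 3(2)] impI)
    qed
  qed
qed

context fgraph
begin

lemma nb_singletons:
  assumes "nb E C = {x, y}"
  shows "E `` {x} \<inter> C \<noteq> {}" "E `` {y} \<inter> C \<noteq> {}"
proof -
  have "x \<in> nb E C" "y \<in> nb E C" using assms by auto
  then show "E `` {x} \<inter> C \<noteq> {}" "E `` {y} \<inter> C \<noteq> {}" using arcD unfolding nb_iff by blast+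
qed

text \<open>The three parts of \<open>C\<close> are joined to each other at least by a path, and the part in the middle of this path
  decides between a bowtie and the two kites.\<close>

lemma stuck_imp_blocked:
  assumes C: "conn E C" "x \<notin> C" "y \<notin> C" "x \<noteq> y"
    and S: "card (E `` {x} \<inter> C) \<ge> 2" and R: "card (E `` {y} \<inter> C) \<ge> 2"
    and SR: "card (E `` {x} \<inter> C \<union> E `` {y} \<inter> C) \<ge> 3"
  shows "bowtie E (C \<union> {x, y}) x y \<or> kite E (C \<union> {x, y}) x y \<or> kite E (C \<union> {x, y}) y x"
proof -
  obtain A1 A2 A3 where A: "A1 \<union> A2 \<union> A3 = C" "A1 \<inter> A2 = {}" "A1 \<inter> A3 = {}" "A2 \<inter> A3 = {}"
    and cn: "conn E A1" "conn E A2" "conn E A3"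
    and SA: "E `` {x} \<inter> C \<inter> A1 \<noteq> {}" "E `` {x} \<inter> C \<inter> A2 \<noteq> {}"
      "E `` {y} \<inter> C \<inter> A2 \<noteq> {}" "E `` {y} \<inter> C \<inter> A3 \<noteq> {}"
    by (rule three_parts[OF sym C(1) _ _ S R SR]) auto
  have xA: "adj E {x} A1" "adj E {x} A2" "adj E {y} A2" "adj E {y} A3"
    using SA by (auto simp: adj_def)
  have ne: "A1 \<noteq> {}" "A2 \<noteq> {}" "A3 \<noteq> {}" using cn conn_nonempty by auto
  have notin: "x \<notin> A1" "x \<notin> A2" "x \<notin> A3" "y \<notin> A1" "y \<notin> A2" "y \<notin> A3" using A(1) C(2,3) by auto
  have sub: "A1 \<subseteq> C" "A2 \<subseteq> C" "A3 \<subseteq> C" using A(1) by auto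
  have un: "{x} \<union> {y} \<union> A1 \<union> A2 \<union> A3 \<subseteq> C \<union> {x, y}" "{y} \<union> {x} \<union> A3 \<union> A2 \<union> A1 \<subseteq> C \<union> {x, y}"
    using sub by auto
  have b1: "blocked E (C \<union> {x, y}) x y {x} {y} A1 A2 A3"
    unfolding blocked_def using un(1) cn A(2-4) xA notin C(4) by (simp add: conn_single)
  have b2: "blocked E (C \<union> {x, y}) y x {y} {x} A3 A2 A1"
    unfolding blocked_def using un(2) cn A(2-4) xA notin C(4) by (simp add: conn_single Int_commute)
  have 1: "adj E A1 A2 \<or> adj E A1 A3"
    using conn_cut[OF C(1), of A1] A ne unfolding adj_def by blast
  have 2: "adj E A2 A1 \<or> adj E A2 A3"
    using conn_cut[OF C(1), of A2] A ne unfolding adj_def by blast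
  have 3: "adj E A3 A1 \<or> adj E A3 A2"
    using conn_cut[OF C(1), of A3] A ne unfolding adj_def by blast
  have "adj E A1 A2 \<and> adj E A2 A3 \<or> adj E A1 A2 \<and> adj E A1 A3 \<or> adj E A3 A2 \<and> adj E A3 A1"
    using 1 2 3 adj_sym[OF sym] by metis
  then show ?thesis using b1 b2 unfolding bowtie_def kite_def by blast
qed

text \<open>Unless the situation is stuck in the sense of \<open>stuck_imp_blocked\<close>, a root with a single neighbour in \<open>C\<close> can be
  exchanged for that neighbour, or both roots for their two common neighbours. A configuration at the
  new roots would lift to the old ones.\<close>

lemma unblocked_imp_rooted_rep:
  assumes k2: "kconn 2 V E" and "C \<subseteq> V" "conn E C" "x \<in> V - C" "y \<in> V - C" "x \<noteq> y" "nb E C \<subseteq> {x, y}"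
    and "\<not> bowtie E (C \<union> {x, y}) x y" "\<not> kite E (C \<union> {x, y}) x y" "\<not> kite E (C \<union> {x, y}) y x"
  shows "rooted_rep E (C \<union> {x, y}) {x, y}"
  using assms(2-)
proof (induction "card C" arbitrary: C x y rule: less_induct)
  case less
  note CV = less.prems(1) and cn = less.prems(2) and x = less.prems(3) and y = less.prems(4)
    and xy = less.prems(5) and nbC = less.prems(6) and unb = less.prems(7-9)
  have finC: "finite C" using finV CV finite_subset by blast
  let ?S = "E `` {x} \<inter> C" and ?R = "E `` {y} \<inter> C"
  have "nb E C = {x, y}" using two_connected_nb[OF k2 CV conn_nonempty[OF cn] nbC x y xy] .
  then have ne: "?S \<noteq> {}" "?R \<noteq> {}" using nb_singletons by auto
  have fin: "finite ?S" "finite ?R" using finC by auto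
  have notstuck: "\<not> (card ?S \<ge> 2 \<and> card ?R \<ge> 2 \<and> card (?S \<union> ?R) \<ge> 3)"
    using stuck_imp_blocked[OF cn _ _ xy] x y unb by blast
  \<comment> \<open>the next bag is \<open>{p, q}\<close>, where \<open>p\<close> takes the place of \<open>x\<close> and \<open>q\<close> the place of \<open>y\<close>\<close>
  have "\<exists>p q. p \<noteq> q \<and> (x = p \<or> p \<in> ?S) \<and> (y = q \<or> q \<in> ?R) \<and> {p, q} \<inter> C \<noteq> {} \<and>
      (\<forall>b \<in> {x, y} - {p, q}. \<forall>c \<in> C. (b, c) \<in> E \<longrightarrow> c \<in> {p, q})"
  proof -
    consider "card ?S < 2" | "card ?R < 2" | "card ?S \<ge> 2" "card ?R \<ge> 2" "card (?S \<union> ?R) < 3"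
      using notstuck by linarith
    then show ?thesis
    proof cases
      case 1
      then have "card ?S = 1" using ne(1) fin(1) by (simp add: less_Suc_eq numeral_2_eq_2)
      then obtain c where c: "?S = {c}" by (auto simp: card_1_singleton_iff)
      then have cC: "c \<in> C" by blast
      have nbr: "e = c" if "e \<in> C" "(x, e) \<in> E" for e using that c by blast
      show ?thesis
      proof (intro exI conjI ballI impI)
        show "c \<noteq> y" using cC y by blast
        show "x = c \<or> c \<in> ?S" using c by blast
        show "{c, y} \<inter> C \<noteq> {}" using cC by blast
        show "e \<in> {c, y}" if "b \<in> {x, y} - {c, y}" "e \<in> C" "(b, e) \<in> E" for b e
          using that nbr by blast
      qed simp
    next
      case 2
      then have "card ?R = 1" using ne(2) fin(2) by (simp add: less_Suc_eq numeral_2_eq_2)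
      then obtain c where c: "?R = {c}" by (auto simp: card_1_singleton_iff)
      then have cC: "c \<in> C" by blast
      have nbr: "e = c" if "e \<in> C" "(y, e) \<in> E" for e using that c by blast
      show ?thesis
      proof (intro exI conjI ballI impI)
        show "x \<noteq> c" using cC x by blast
        show "y = c \<or> c \<in> ?R" using c by blast
        show "{x, c} \<inter> C \<noteq> {}" using cC by blast
        show "e \<in> {x, c}" if "b \<in> {x, y} - {x, c}" "e \<in> C" "(b, e) \<in> E" for b e
          using that nbr by blast
      qed simp
    next
      case 3
      obtain c d where cd: "c \<in> ?S" "d \<in> ?S" "c \<noteq> d" using two_elements[OF 3(1)] .
      have finSR: "finite (?S \<union> ?R)" using fin by simp
      have "card (?S \<union> ?R) \<le> 2" using 3(3) by simp
      then have S: "?S = ?S \<union> ?R" and R: "?R = ?S \<union> ?R"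
        using card_subset_eq[OF finSR, of ?S] card_subset_eq[OF finSR, of ?R] 3(1,2)
          card_mono[OF finSR, of ?S] card_mono[OF finSR, of ?R] by simp_all
      have c2: "card {c, d} = 2" using cd(3) by simp
      have "{c, d} = ?S" using c2 3 cd S fin by (intro card_subset_eq) auto
      moreover have "?R = ?S" using S R by simp
      moreover have "e \<in> ?S \<union> ?R" if "e \<in> C" "(x, e) \<in> E \<or> (y, e) \<in> E" for e using that by blast
      ultimately have nbr: "e \<in> {c, d}" if "e \<in> C" "(x, e) \<in> E \<or> (y, e) \<in> E" for e using that by simp
      have "d \<in> ?R" using \<open>?R = ?S\<close> cd(2) by simp
      show ?thesis
      proof (intro exI conjI ballI impI)
        show "x = c \<or> c \<in> ?S" "y = d \<or> d \<in> ?R" using cd(1) \<open>d \<in> ?R\<close> by simp_all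
        show "{c, d} \<inter> C \<noteq> {}" using cd(1) by blast
        show "e \<in> {c, d}" if "b \<in> {x, y} - {c, d}" "e \<in> C" "(b, e) \<in> E" for b e
          using that nbr by blast
      qed (fact cd(3))
    qed
  qed
  then obtain p q where pq: "p \<noteq> q" "x = p \<or> p \<in> ?S" "y = q \<or> q \<in> ?R" "{p, q} \<inter> C \<noteq> {}"
    and left: "\<And>b c. b \<in> {x, y} - {p, q} \<Longrightarrow> c \<in> C \<Longrightarrow> (b, c) \<in> E \<Longrightarrow> c \<in> {p, q}" by blast
  have pqV: "p \<in> V" "q \<in> V" using pq(2,3) x y CV by auto
  show ?case
  proof (rule rooted_rep_step[OF sym finC, where B' = "{p, q}"])
    show "card {x, y} \<le> 2" "card {p, q} \<le> 2" using card_length[of "[x, y]"] card_length[of "[p, q]"] by simp_all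
    show "{x, y} \<inter> C = {}" using x y by blast
    show "{p, q} \<subseteq> {x, y} \<union> C" using pq(2,3) by blast
    show "c \<in> {p, q}" if "b \<in> {x, y} - {p, q}" "c \<in> C" "(b, c) \<in> E" for b c using left that .
    fix D assume D: "D \<in> comps E (C - {p, q})"
    note D' = compsD[OF D]
    have DC: "D \<subset> C" using D'(1) pq(4) by blast
    have lift: "D \<union> {p, q} \<subseteq> C \<union> {x, y}" using DC pq(2,3) by blast
    have x': "x = p \<or> (x, p) \<in> E \<and> x \<notin> D \<union> {p, q}" and y': "y = q \<or> (y, q) \<in> E \<and> y \<notin> D \<union> {p, q}"
      using pq(2,3) x y xy DC by auto
    have in_D: "x \<in> C \<union> {x, y}" "y \<in> C \<union> {x, y}" by auto
    show "rooted_rep E (D \<union> {p, q}) {p, q}"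
    proof (rule less.hyps)
      show "card D < card C" using psubset_card_mono[OF finC DC] .
      show "D \<subseteq> V" using DC CV by blast
      show "conn E D" by fact
      show "p \<in> V - D" "q \<in> V - D" "p \<noteq> q" using pq(1) pqV D'(1) by auto
      show "nb E D \<subseteq> {p, q}"
      proof
        fix z assume z: "z \<in> nb E D"
        then obtain d where d: "d \<in> D" "(d, z) \<in> E" by (auto simp: nb_iff)
        have "z \<in> {x, y} \<union> {p, q}" using nb_comp[OF D] nbC z by blast
        moreover have "d \<in> C" "d \<notin> {p, q}" using d(1) D'(1) by auto
        ultimately show "z \<in> {p, q}" using left[of z d] arcD[OF d(2)] by blast
      qed
      show "\<not> bowtie E (D \<union> {p, q}) p q"
        using bowtie_lift[OF sym _ lift in_D xy x' y'] unb(1) by blast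
      show "\<not> kite E (D \<union> {p, q}) p q"
        using kite_lift[OF sym _ lift in_D xy x' y'] unb(2) by blast
      show "\<not> kite E (D \<union> {p, q}) q p"
        using kite_lift[OF sym _ lift in_D(2,1) xy[symmetric] y' x'] unb(3) by blast
    qed
  qed simp
qed

end

section \<open>The graphs \<open>F3\<close> and \<open>H3\<close> from blocking configurations\<close>

definition rooted_triangle :: "'a rel \<Rightarrow> 'a set \<Rightarrow> 'a \<Rightarrow> 'a \<Rightarrow> bool" where
  "rooted_triangle E D x y \<longleftrightarrow>
     (\<exists>X Y W. x \<in> X \<and> y \<in> Y \<and> X \<union> Y \<union> W \<subseteq> D \<and> conn E X \<and> conn E Y \<and> conn E W \<and>
        X \<inter> Y = {} \<and> X \<inter> W = {} \<and> Y \<inter> W = {} \<and> adj E X Y \<and> adj E X W \<and> adj E Y W)"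

text \<open>The candidate models of \<open>F3\<close> and \<open>H3\<close>.\<close>

definition node_sets :: "'a set \<Rightarrow> 'a set \<Rightarrow> 'a set \<Rightarrow> 'a set \<Rightarrow> 'a set \<Rightarrow> 'a set \<Rightarrow> node \<Rightarrow> 'a set" where
  "node_sets A1 A2 A3 A12 A13 A23 v =
     (case v of V1 \<Rightarrow> A1 | V2 \<Rightarrow> A2 | V3 \<Rightarrow> A3 | V12 \<Rightarrow> A12 | V13 \<Rightarrow> A13 | V23 \<Rightarrow> A23)"

lemma node_sets_simps [simp]:
  "node_sets A1 A2 A3 A12 A13 A23 V1 = A1" "node_sets A1 A2 A3 A12 A13 A23 V2 = A2"
  "node_sets A1 A2 A3 A12 A13 A23 V3 = A3" "node_sets A1 A2 A3 A12 A13 A23 V12 = A12"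
  "node_sets A1 A2 A3 A12 A13 A23 V13 = A13" "node_sets A1 A2 A3 A12 A13 A23 V23 = A23"
  by (simp_all add: node_sets_def)

lemma node_sets_model:
  assumes cn: "conn E A1" "conn E A2" "conn E A3" "conn E A12" "conn E A13" "conn E A23"
    and sub: "A1 \<subseteq> V" "A2 \<subseteq> V" "A3 \<subseteq> V" "A12 \<subseteq> V" "A13 \<subseteq> V" "A23 \<subseteq> V"
    and d: "A1 \<inter> A2 = {}" "A1 \<inter> A3 = {}" "A1 \<inter> A12 = {}" "A1 \<inter> A13 = {}" "A1 \<inter> A23 = {}"
      "A2 \<inter> A3 = {}" "A2 \<inter> A12 = {}" "A2 \<inter> A13 = {}" "A2 \<inter> A23 = {}"
      "A3 \<inter> A12 = {}" "A3 \<inter> A13 = {}" "A3 \<inter> A23 = {}"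
      "A12 \<inter> A13 = {}" "A12 \<inter> A23 = {}" "A13 \<inter> A23 = {}"
    and EM: "\<And>u v. (u, v) \<in> EM \<Longrightarrow>
      adj E (node_sets A1 A2 A3 A12 A13 A23 u) (node_sets A1 A2 A3 A12 A13 A23 v)"
  shows "model VM EM V E (node_sets A1 A2 A3 A12 A13 A23)"
proof (rule modelI)
  let ?f = "node_sets A1 A2 A3 A12 A13 A23"
  show "?f v \<subseteq> V" for v using sub by (cases v) simp_all
  show "conn E (?f v)" for v using cn by (cases v) simp_all
  show "?f u \<inter> ?f v = {}" if "u \<noteq> v" for u v
    using d that by (cases u; cases v) (simp_all add: Int_commute)
qed (fact EM)

lemma F3_model:
  assumes "sym E"
    and "conn E A1" "conn E A2" "conn E A3" "conn E A12" "conn E A13" "conn E A23"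
    and "A1 \<subseteq> V" "A2 \<subseteq> V" "A3 \<subseteq> V" "A12 \<subseteq> V" "A13 \<subseteq> V" "A23 \<subseteq> V"
    and "A1 \<inter> A2 = {}" "A1 \<inter> A3 = {}" "A1 \<inter> A12 = {}" "A1 \<inter> A13 = {}" "A1 \<inter> A23 = {}"
      "A2 \<inter> A3 = {}" "A2 \<inter> A12 = {}" "A2 \<inter> A13 = {}" "A2 \<inter> A23 = {}"
      "A3 \<inter> A12 = {}" "A3 \<inter> A13 = {}" "A3 \<inter> A23 = {}"
      "A12 \<inter> A13 = {}" "A12 \<inter> A23 = {}" "A13 \<inter> A23 = {}"
    and "adj E A1 A2" "adj E A1 A3" "adj E A2 A3" "adj E A1 A12" "adj E A2 A12"
      "adj E A1 A13" "adj E A3 A13" "adj E A2 A23" "adj E A3 A23"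
  shows "\<exists>f. model (pverts F3) (parcs F3) V E f"
proof -
  have "adj E (node_sets A1 A2 A3 A12 A13 A23 u) (node_sets A1 A2 A3 A12 A13 A23 v)"
    if "(u, v) \<in> parcs F3" for u v
    using that assms(29-) adj_sym[OF assms(1)] by (cases u; cases v) (simp_all add: F3_def Let_def)
  then show ?thesis using node_sets_model[OF assms(2-28)] by blast
qed

lemma H3_model:
  assumes "sym E"
    and "conn E A1" "conn E A2" "conn E A3" "conn E A12" "conn E A13" "conn E A23"
    and "A1 \<subseteq> V" "A2 \<subseteq> V" "A3 \<subseteq> V" "A12 \<subseteq> V" "A13 \<subseteq> V" "A23 \<subseteq> V"
    and "A1 \<inter> A2 = {}" "A1 \<inter> A3 = {}" "A1 \<inter> A12 = {}" "A1 \<inter> A13 = {}" "A1 \<inter> A23 = {}"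
      "A2 \<inter> A3 = {}" "A2 \<inter> A12 = {}" "A2 \<inter> A13 = {}" "A2 \<inter> A23 = {}"
      "A3 \<inter> A12 = {}" "A3 \<inter> A13 = {}" "A3 \<inter> A23 = {}"
      "A12 \<inter> A13 = {}" "A12 \<inter> A23 = {}" "A13 \<inter> A23 = {}"
    and "adj E A1 A3" "adj E A1 A13" "adj E A2 A13" "adj E A3 A13"
      "adj E A1 A12" "adj E A12 A2" "adj E A2 A23" "adj E A23 A3"
  shows "\<exists>f. model (pverts H3) (parcs H3) V E f"
proof -
  have "adj E (node_sets A1 A2 A3 A12 A13 A23 u) (node_sets A1 A2 A3 A12 A13 A23 v)"
    if "(u, v) \<in> parcs H3" for u v
    using that assms(29-) adj_sym[OF assms(1)]
    by (cases u; cases v) (simp_all add: H3_explicit Let_def)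
  then show ?thesis using node_sets_model[OF assms(2-28)] by blast
qed

context fgraph
begin

text \<open>The sets \<open>X\<close>, \<open>Y\<close>, \<open>A1\<close>, \<open>A2\<close> form a \<open>K\<^sub>4\<close> in which the edges \<open>X Y\<close> and \<open>Y A1\<close> are subdivided by \<open>K\<close>
  and \<open>A3\<close>.\<close>

lemma kite_and_path_imp_H3:
  assumes k: "kite E P x y" and "P \<subseteq> V" "K \<subseteq> V - P" "conn E K" "adj E {x} K" "adj E {y} K"
  shows "\<exists>f. model (pverts H3) (parcs H3) V E f"
proof -
  obtain X Y A1 A2 A3 where b: "blocked E P x y X Y A1 A2 A3" and a: "adj E A1 A2" "adj E A1 A3"
    using k unfolding kite_def by blast
  note b' = b[unfolded blocked_def]
  have sub: "X \<subseteq> P" "Y \<subseteq> P" "A1 \<subseteq> P" "A2 \<subseteq> P" "A3 \<subseteq> P" using b' by auto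
  have dK: "S \<inter> K = {}" "K \<inter> S = {}" "S \<subseteq> V" if "S \<subseteq> P" for S using assms(2,3) that by auto
  have "adj E X K" "adj E Y K" "K \<subseteq> V"
    using assms(3) b' adj_mono[OF assms(5)] adj_mono[OF assms(6)] by auto
  moreover have "X \<inter> K = {}" "Y \<inter> K = {}" "A1 \<inter> K = {}" "A2 \<inter> K = {}" "A3 \<inter> K = {}"
    "K \<inter> X = {}" "K \<inter> Y = {}" "K \<inter> A1 = {}" "K \<inter> A2 = {}" "K \<inter> A3 = {}"
    using dK sub by simp_all
  ultimately show ?thesis
    using b' a assms(4) dK(3) sub adj_sym[OF sym]
    by (intro H3_model[OF sym, where ?A1.0 = X and ?A2.0 = Y and ?A3.0 = A1 and ?A12.0 = K and ?A13.0 = A2 and ?A23.0 = A3])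
      (simp_all add: Int_commute)
qed

text \<open>With \<open>X\<close> and \<open>Y\<close> made adjacent through the triangle, \<open>X\<close>, \<open>Y\<close>, \<open>A2\<close> is the inner triangle of \<open>F3\<close>, and
  \<open>A1\<close>, \<open>A3\<close> and the third vertex of the given triangle are its ears.\<close>

lemma bowtie_and_triangle_imp_F3:
  assumes k: "bowtie E P x y" and t: "rooted_triangle E D x y"
    and "P \<subseteq> V" "D \<subseteq> V" "P \<inter> D \<subseteq> {x, y}"
  shows "\<exists>f. model (pverts F3) (parcs F3) V E f"
proof -
  obtain X Y A1 A2 A3 where b: "blocked E P x y X Y A1 A2 A3" and a: "adj E A1 A2" "adj E A2 A3"
    using k unfolding bowtie_def by blast
  obtain X2 Y2 W where t: "x \<in> X2" "y \<in> Y2" "X2 \<union> Y2 \<union> W \<subseteq> D" "conn E X2" "conn E Y2" "conn E W"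
    "X2 \<inter> Y2 = {}" "X2 \<inter> W = {}" "Y2 \<inter> W = {}" "adj E X2 Y2" "adj E X2 W" "adj E Y2 W"
    using t unfolding rooted_triangle_def by blast
  note b' = b[unfolded blocked_def]
  have sub: "X \<subseteq> P" "Y \<subseteq> P" "A1 \<subseteq> P" "A2 \<subseteq> P" "A3 \<subseteq> P" using b' by auto
  have xy: "x \<in> X" "y \<in> Y" using b' by auto
  have disj: "X \<inter> Y = {}" "X \<inter> A1 = {}" "X \<inter> A2 = {}" "X \<inter> A3 = {}" "Y \<inter> A1 = {}" "Y \<inter> A2 = {}" "Y \<inter> A3 = {}"
    using b' by auto
  have cross: "S \<inter> S' \<subseteq> {x, y}" if "S \<subseteq> P" "S' \<subseteq> D" for S S' using that assms(5) by blast
  have sub2: "X2 \<subseteq> D" "Y2 \<subseteq> D" "W \<subseteq> D" using t(3) by auto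
  have not: "x \<notin> Y" "x \<notin> A1" "x \<notin> A2" "x \<notin> A3" "y \<notin> X" "y \<notin> A1" "y \<notin> A2" "y \<notin> A3"
    "x \<notin> Y2" "x \<notin> W" "y \<notin> X2" "y \<notin> W" using xy disj t(1,2,7-9) by auto
  have cr: "X \<inter> Y2 = {}" "X \<inter> W = {}" "Y \<inter> X2 = {}" "Y \<inter> W = {}"
    "A1 \<inter> X2 = {}" "A1 \<inter> Y2 = {}" "A1 \<inter> W = {}" "A2 \<inter> X2 = {}" "A2 \<inter> Y2 = {}" "A2 \<inter> W = {}"
    "A3 \<inter> X2 = {}" "A3 \<inter> Y2 = {}" "A3 \<inter> W = {}"
    using cross[OF sub(1) sub2(2)] cross[OF sub(1) sub2(3)] cross[OF sub(2) sub2(1)]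
      cross[OF sub(2) sub2(3)] cross[OF sub(3) sub2(1)] cross[OF sub(3) sub2(2)]
      cross[OF sub(3) sub2(3)] cross[OF sub(4) sub2(1)] cross[OF sub(4) sub2(2)]
      cross[OF sub(4) sub2(3)] cross[OF sub(5) sub2(1)] cross[OF sub(5) sub2(2)]
      cross[OF sub(5) sub2(3)] not by auto
  have "X \<inter> X2 \<noteq> {}" "Y \<inter> Y2 \<noteq> {}" using xy t(1,2) by auto
  then have cX: "conn E (X \<union> X2)" "conn E (Y \<union> Y2)"
    using b' t(4,5) by (auto intro!: conn_Un[OF sym])
  have subV: "X \<subseteq> V" "Y \<subseteq> V" "A1 \<subseteq> V" "A2 \<subseteq> V" "A3 \<subseteq> V" "X2 \<subseteq> V" "Y2 \<subseteq> V" "W \<subseteq> V"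
    using sub sub2 assms(3,4) by auto
  have cn: "conn E A1" "conn E A2" "conn E A3" using b' by auto
  have dA: "A1 \<inter> A2 = {}" "A1 \<inter> A3 = {}" "A2 \<inter> A3 = {}" using b' by auto
  have aX: "adj E X A1" "adj E X A2" "adj E Y A2" "adj E Y A3" using b' by auto
  show ?thesis
    using cX cn t(6) subV cr disj dA aX a t(7-12) adj_sym[OF sym]
    by (intro F3_model[OF sym, where ?A1.0 = "X \<union> X2" and ?A2.0 = "Y \<union> Y2" and ?A3.0 = A2 and ?A12.0 = W and ?A13.0 = A1 and ?A23.0 = A3])
      (simp_all add: Int_commute Int_Un_distrib adj_Un)
qed

end

section \<open>Separating pairs\<close>

context fgraph
begin

lemma rooted_triangleI:
  assumes "x \<in> X" "y \<in> Y" "X \<subseteq> D" "Y \<subseteq> D" "W \<subseteq> D" "conn E X" "conn E Y" "conn E W"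
    "X \<inter> Y = {}" "X \<inter> W = {}" "Y \<inter> W = {}" "adj E X Y" "adj E X W" "adj E Y W"
  shows "rooted_triangle E D x y"
  unfolding rooted_triangle_def using assms by blast

lemma adj_nb_singleton: "v \<in> nb E C \<Longrightarrow> adj E {v} C"
  using arcD unfolding adj_def nb_iff by blast

text \<open>If \<open>C\<close> were disconnected, one component could be contracted into \<open>x\<close> and another would complete a
  triangle. If \<open>y\<close> had two neighbours in \<open>C\<close>, then \<open>C\<close> could be split between them, with one half contracted into
  \<open>x\<close>. So \<open>y\<close> has one neighbour \<open>c\<close>, and the argument repeats with \<open>C - {c}\<close> and the roots \<open>x\<close> and \<open>c\<close>:
  the set \<open>C\<close> is a path from \<open>x\<close> to \<open>y\<close>.\<close>

lemma no_triangle_imp_thin: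
  assumes k2: "kconn 2 V E"
    and "C \<subseteq> V" "C \<noteq> {}" "x \<in> V - C" "y \<in> V - C" "x \<noteq> y" "nb E C \<subseteq> {x, y}"
    and "\<not> rooted_triangle E (C \<union> {x, y}) x y"
  shows "conn E C \<and> (x, y) \<notin> E \<and> (\<forall>v \<in> C. card (E `` {v}) \<le> 2) \<and>
    (\<exists>c \<in> C. \<forall>e \<in> C. (y, e) \<in> E \<longrightarrow> e = c)"
  using assms(2-)
proof (induction "card C" arbitrary: C x y rule: less_induct)
  case less
  note CV = less.prems(1) and ne = less.prems(2) and x = less.prems(3) and y = less.prems(4)
    and xy = less.prems(5) and nbC = less.prems(6) and notri = less.prems(7)
  have finC: "finite C" using finV CV finite_subset by blast
  have nb_eq: "nb E C = {x, y}" using two_connected_nb[OF k2 CV ne nbC x y xy] .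
  have adjK: "adj E {x} K" "adj E {y} K" if K: "K \<in> comps E C" for K
  proof -
    note K' = compsD[OF K]
    have "nb E K \<subseteq> nb E C" using K'(1,3) unfolding nb_def by blast
    then have "nb E K = {x, y}"
      using K' CV x y nbC by (intro two_connected_nb[OF k2 _ K'(4) _ _ _ xy]) auto
    then show "adj E {x} K" "adj E {y} K" using adj_nb_singleton by auto
  qed
  obtain v where v: "v \<in> C" using ne by blast
  obtain K where K: "K \<in> comps E C" "v \<in> K" using comp_exists[OF sym v] .
  note K = K(1)
  note K' = compsD[OF K]
  have xK: "x \<notin> K" "y \<notin> K" using K'(1) x y by auto
  have noxy: "(x, y) \<notin> E"
  proof
    assume "(x, y) \<in> E"
    then have "adj E {x} {y}" by (simp add: adj_def)
    then have "rooted_triangle E (C \<union> {x, y}) x y"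
      using K'(1,2) adjK[OF K] xK xy
      by (intro rooted_triangleI[where X = "{x}" and Y = "{y}" and W = K]) (auto simp: conn_single)
    then show False using notri by blast
  qed
  have "K = C"
  proof (rule ccontr)
    assume "K \<noteq> C"
    then obtain w where w: "w \<in> C" "w \<notin> K" using K'(1) by blast
    obtain L where L: "L \<in> comps E C" "w \<in> L" using comp_exists[OF sym w(1)] .
    then have dis: "K \<inter> L = {}" using comps_disjoint[OF sym K L(1)] w(2) L(2) by blast
    note L' = compsD[OF L(1)]
    have cX: "conn E ({x} \<union> K)" using conn_Un[OF sym conn_single K'(2), of x] adjK(1)[OF K] by blast
    have "adj E ({x} \<union> K) {y}" "adj E ({x} \<union> K) L"
      unfolding adj_Un using adjK[OF K] adjK[OF L(1)] adj_sym[OF sym] by metis+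
    moreover have "x \<notin> L" "y \<notin> L" using L'(1) x y by auto
    ultimately have "rooted_triangle E (C \<union> {x, y}) x y"
      using K'(1) L'(1,2) adjK[OF L(1)] cX dis xK xy
      by (intro rooted_triangleI[where X = "{x} \<union> K" and Y = "{y}" and W = L]) (auto simp: conn_single)
    then show False using notri by blast
  qed
  then have cn: "conn E C" using K'(2) by simp
  have "y \<in> nb E C" using nb_eq by simp
  then obtain c where c: "c \<in> C" "(y, c) \<in> E" using arcD unfolding nb_iff by blast
  have unique: "e = c" if e: "e \<in> C" "(y, e) \<in> E" for e
  proof (rule ccontr)
    assume "e \<noteq> c"
    have tri: False if AB: "A \<union> B = C" "A \<inter> B = {}" "conn E A" "conn E B" "adj E A B"
      and yA: "adj E {y} A" "adj E {y} B" and xA: "adj E {x} A" for A B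
    proof -
      have cX: "conn E ({x} \<union> A)" using conn_Un[OF sym conn_single AB(3), of x] xA by blast
      have "adj E ({x} \<union> A) {y}" "adj E ({x} \<union> A) B"
        unfolding adj_Un using yA AB(5) adj_sym[OF sym] by metis+
      moreover have "x \<notin> A" "y \<notin> A" "x \<notin> B" "y \<notin> B" "A \<subseteq> C" "B \<subseteq> C" using AB(1) x y by auto
      ultimately have "rooted_triangle E (C \<union> {x, y}) x y"
        using AB(2,4) yA cX xy
        by (intro rooted_triangleI[where X = "{x} \<union> A" and Y = "{y}" and W = B]) (auto simp: conn_single)
      then show False using notri by blast
    qed
    obtain A B where AB: "A \<union> B = C" "A \<inter> B = {}" "c \<in> A" "e \<in> B" "conn E A" "conn E B" "adj E A B"
      using conn_split[OF sym cn c(1) e(1) \<open>e \<noteq> c\<close>[symmetric]] .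
    have yAB: "adj E {y} A" "adj E {y} B" using c(2) e(2) AB(3,4) by (auto simp: adj_def)
    have "x \<in> nb E C" using nb_eq by simp
    then have "adj E {x} (A \<union> B)" using adj_nb_singleton AB(1) by simp
    then have "adj E {x} A \<or> adj E {x} B" by (simp only: adj_Un)
    then show False
    proof
      assume "adj E {x} A"
      then show False using tri[OF AB(1,2,5,6,7) yAB] by blast
    next
      assume xB: "adj E {x} B"
      have "B \<union> A = C" "B \<inter> A = {}" "adj E B A" using AB(1,2,7) adj_sym[OF sym] by auto
      then show False using tri[OF _ _ AB(6,5) _ yAB(2,1) xB] by blast
    qed
  qed
  have cV: "c \<in> V" using c(1) CV by blast
  have inC: "z \<in> C \<union> {x, y}" if "(c, z) \<in> E" for z using that nbC c(1) by (auto simp: nb_def)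
  have "\<forall>v \<in> C. card (E `` {v}) \<le> 2"
  proof (cases "C - {c} = {}")
    case True
    then have "C = {c}" using c(1) by blast
    moreover have "E `` {c} \<subseteq> {x, y}" using inC arcD \<open>C = {c}\<close> by blast
    then have "card (E `` {c}) \<le> card {x, y}" by (intro card_mono) auto
    moreover have "card {x, y} \<le> 2" using card_length[of "[x, y]"] by simp
    ultimately show ?thesis by simp
  next
    case False
    let ?C = "C - {c}"
    have nbC': "nb E ?C \<subseteq> {x, c}"
    proof
      fix z assume "z \<in> nb E ?C"
      then obtain d where d: "d \<in> C" "d \<noteq> c" "(d, z) \<in> E" "z \<notin> ?C" by (auto simp: nb_iff)
      then have "z \<in> {x, y, c}" using nbC by (auto simp: nb_def)
      moreover have "z \<noteq> y" using unique[of d] d arcD by blast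
      ultimately show "z \<in> {x, c}" by blast
    qed
    have xc: "x \<noteq> c" using x c(1) by blast
    have notri': "\<not> rooted_triangle E (?C \<union> {x, c}) x c"
    proof
      assume "rooted_triangle E (?C \<union> {x, c}) x c"
      then obtain X Y W where t: "x \<in> X" "c \<in> Y" "X \<union> Y \<union> W \<subseteq> ?C \<union> {x, c}" "conn E X" "conn E Y" "conn E W"
        "X \<inter> Y = {}" "X \<inter> W = {}" "Y \<inter> W = {}" "adj E X Y" "adj E X W" "adj E Y W"
        unfolding rooted_triangle_def by blast
      have "?C \<union> {x, c} = insert x C" using c(1) by blast
      then have sub: "X \<subseteq> insert x C" "Y \<subseteq> insert x C" "W \<subseteq> insert x C" using t(3) by simp_all
      then have yn: "y \<notin> X" "y \<notin> Y" "y \<notin> W" using y xy by auto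
      have "conn E (insert y Y)" using conn_insert[OF sym t(5,2) c(2)] .
      moreover have "adj E X (insert y Y)" "adj E (insert y Y) W"
        using adj_mono[OF t(10) order_refl order_refl subset_insertI] adj_insertI[OF t(12)] .
      ultimately have "rooted_triangle E (C \<union> {x, y}) x y"
        using t sub yn
        by (intro rooted_triangleI[where X = X and Y = "insert y Y" and W = W]) auto
      then show False using notri by blast
    qed
    have "card ?C < card C" by (rule card_Diff1_less[OF finC c(1)])
    then have IH: "(x, c) \<notin> E \<and> (\<forall>v \<in> ?C. card (E `` {v}) \<le> 2) \<and>
        (\<exists>d \<in> ?C. \<forall>e \<in> ?C. (c, e) \<in> E \<longrightarrow> e = d)"
      using less.hyps[of ?C x c] CV False x cV xc nbC' notri' by blast
    then obtain d where d: "\<And>e. e \<in> ?C \<Longrightarrow> (c, e) \<in> E \<Longrightarrow> e = d" by blast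
    have "E `` {c} \<subseteq> {y, d}"
    proof
      fix z assume "z \<in> E `` {c}"
      then have cz: "(c, z) \<in> E" by simp
      then have "z \<noteq> x" "z \<noteq> c" using IH arcD by blast+
      then show "z \<in> {y, d}" using inC[OF cz] d[OF _ cz] by blast
    qed
    then have "card (E `` {c}) \<le> card {y, d}" by (intro card_mono) auto
    moreover have "card {y, d} \<le> 2" using card_length[of "[y, d]"] by simp
    ultimately have "card (E `` {c}) \<le> 2" by simp
    then show ?thesis using IH by blast
  qed
  then show ?case using cn noxy unique c(1) by blast
qed

text \<open>The component into which the tree cannot be continued contains a bowtie or a kite. If there is anything else
  besides it, a kite would give \<open>H3\<close>, and a bowtie with a triangle on the other side would give \<open>F3\<close>.\<close>

lemma separating_pair_thin:
  assumes k2: "kconn 2 V E"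
    and no_start: "\<forall>x \<in> V. \<forall>y \<in> V - {x}.
      \<exists>C \<in> comps E (V - {x, y}). \<not> rooted_rep E (C \<union> {x, y}) {x, y}"
    and noF3: "\<nexists>f. model (pverts F3) (parcs F3) V E f"
    and noH3: "\<nexists>f. model (pverts H3) (parcs H3) V E f"
    and x: "x \<in> V" and y: "y \<in> V" and xy: "x \<noteq> y"
  obtains C where "C \<subseteq> V - {x, y}" "conn E C" "nb E C \<subseteq> {x, y}"
    "V - {x, y} - C = {} \<or>
       (x, y) \<notin> E \<and> conn E (V - {x, y} - C) \<and> (\<forall>v \<in> V - {x, y} - C. card (E `` {v}) \<le> 2)"
proof -
  obtain C where C: "C \<in> comps E (V - {x, y})" and bad: "\<not> rooted_rep E (C \<union> {x, y}) {x, y}"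
    using no_start x y xy by blast
  note C' = compsD[OF C]
  have nbC: "nb E C \<subseteq> {x, y}" using C'(3) nb_in_V[of C] by blast
  have blocked: "bowtie E (C \<union> {x, y}) x y \<or> kite E (C \<union> {x, y}) x y \<or> kite E (C \<union> {x, y}) y x"
    using unblocked_imp_rooted_rep[OF k2 _ C'(2) _ _ xy nbC] bad x y C'(1) by blast
  let ?K = "V - {x, y} - C"
  have P: "C \<union> {x, y} \<subseteq> V" using C'(1) x y by blast
  have "(x, y) \<notin> E \<and> conn E ?K \<and> (\<forall>v \<in> ?K. card (E `` {v}) \<le> 2)" if ne: "?K \<noteq> {}"
  proof -
    have nbK: "nb E ?K \<subseteq> {x, y}"
    proof
      fix z assume "z \<in> nb E ?K"
      then obtain d where d: "d \<in> ?K" "(d, z) \<in> E" "z \<notin> ?K" by (auto simp: nb_iff)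
      then have "z \<in> V" "(z, d) \<in> E" using arcD by blast+
      moreover have "z \<notin> C"
      proof
        assume "z \<in> C"
        then have "d \<in> nb E C" using d(1) \<open>(z, d) \<in> E\<close> unfolding nb_iff by blast
        then show False using d(1) nbC by blast
      qed
      ultimately show "z \<in> {x, y}" using d(3) by blast
    qed
    obtain v where v: "v \<in> ?K" using ne by blast
    obtain L where L: "L \<in> comps E ?K" "v \<in> L" using comp_exists[OF sym v] .
    note L' = compsD[OF L(1)]
    have "nb E L \<subseteq> {x, y}" using L'(1,3) nbK unfolding nb_def by blast
    then have nbL: "nb E L = {x, y}"
      using L' x y by (intro two_connected_nb[OF k2 _ L'(4) _ _ _ xy]) auto
    have adjL: "adj E {x} L" "adj E {y} L" using nbL adj_nb_singleton by auto
    have LP: "L \<subseteq> V - (C \<union> {x, y})" using L'(1) by blast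
    have "\<not> kite E (C \<union> {x, y}) x y"
      using kite_and_path_imp_H3[OF _ P LP L'(2) adjL] noH3 by blast
    moreover have "\<not> kite E (C \<union> {x, y}) y x"
      using kite_and_path_imp_H3[OF _ P LP L'(2) adjL(2,1)] noH3 by blast
    ultimately have bow: "bowtie E (C \<union> {x, y}) x y" using blocked by blast
    have "?K \<union> {x, y} \<subseteq> V" "(C \<union> {x, y}) \<inter> (?K \<union> {x, y}) \<subseteq> {x, y}" using x y by blast+
    then have "\<not> rooted_triangle E (?K \<union> {x, y}) x y"
      using bowtie_and_triangle_imp_F3[OF bow _ P] noF3 by blast
    then show ?thesis
      using no_triangle_imp_thin[OF k2 _ ne _ _ xy nbK] x y by blast
  qed
  then have alt: "?K = {} \<or> (x, y) \<notin> E \<and> conn E ?K \<and> (\<forall>v \<in> ?K. card (E `` {v}) \<le> 2)" by argo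
  show ?thesis by (rule that[OF C'(1,2) nbC alt])
qed

end

section \<open>Three-connected graphs with at least five vertices\<close>

context fgraph
begin

definition "as_graph = \<lparr>pverts = V, parcs = E\<rparr>"

lemma pair_graph_as_graph: "pair_graph as_graph"
  using finV wf sym irr by (simp add: pair_graph_iff as_graph_def)

lemma contract_simps:
  "pverts (contract_edge as_graph x y) = V - {y}"
  "(a, b) \<in> parcs (contract_edge as_graph x y) \<longleftrightarrow> a \<noteq> b \<and>
     (\<exists>c d. (c, d) \<in> E \<and> a = (if c = y then x else c) \<and> b = (if d = y then x else d))"
  by (simp_all add: contract_edge_def as_graph_def Bex_def split_paired_Ex)

lemma three_connected_nb:
  assumes k3: "kconn 3 V E" and D: "D \<subseteq> V" "D \<noteq> {}" "nb E D \<subseteq> {x, y, z}" "D \<union> {x, y, z} \<noteq> V"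
    and xyz: "{x, y, z} \<subseteq> V"
  shows "nb E D = {x, y, z} \<and> x \<noteq> y \<and> y \<noteq> z \<and> x \<noteq> z"
proof -
  have "\<not> card (nb E D) < 3"
  proof
    assume "card (nb E D) < 3"
    then have "D \<union> nb E D = V" by (rule kconnD[OF k3 D(1,2)])
    then show False using D(1,3,4) xyz by blast
  qed
  moreover have "card (nb E D) \<le> card {x, y, z}" using D(3) by (intro card_mono) auto
  moreover have le: "card {x, y, z} \<le> 3" using card_length[of "[x, y, z]"] by simp
  ultimately have "card (nb E D) = card {x, y, z}" "card {x, y, z} = 3" by simp_all
  moreover from this have "nb E D = {x, y, z}" using D(3) by (intro card_subset_eq) auto
  ultimately show ?thesis by (auto simp: card_insert_if split: if_splits)
qed

text \<open>A set of at most two vertices that separates the contracted graph must contain the merged vertex, since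
  otherwise it would already separate the given graph.\<close>

lemma bad_contraction_imp_separation:
  assumes k3: "kconn 3 V E" and xy: "(x, y) \<in> E"
    and bad: "\<not> kconn 3 (pverts (contract_edge as_graph x y)) (parcs (contract_edge as_graph x y))"
  obtains z D where "z \<in> V" "D \<subseteq> V" "D \<noteq> {}" "nb E D \<subseteq> {x, y, z}" "D \<inter> {x, y, z} = {}"
    "D \<union> {x, y, z} \<noteq> V"
proof -
  let ?E = "parcs (contract_edge as_graph x y)"
  note xy' = arcD[OF xy]
  obtain S where S: "S \<subseteq> V - {y}" "S \<noteq> {}" "card (nb ?E S) < 3" "S \<union> nb ?E S \<noteq> V - {y}"
    using bad unfolding kconn_def contract_simps(1) by blast
  let ?N = "nb ?E S"
  have NV: "?N \<subseteq> V - {y}"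
  proof
    fix z assume "z \<in> ?N"
    then obtain c where "(c, z) \<in> ?E" by (auto simp: nb_iff)
    then obtain d e where "(d, e) \<in> E" "z = (if e = y then x else e)" unfolding contract_simps by blast
    then show "z \<in> V - {y}" using arcD xy' by auto
  qed
  have im: "((if c = y then x else c), z) \<in> ?E" if "(c, z) \<in> E" "z \<noteq> y" "(if c = y then x else c) \<noteq> z" for c z
    unfolding contract_simps using that by (intro conjI exI[of _ c] exI[of _ z]) auto
  have "x \<notin> S"
  proof
    assume xS: "x \<in> S"
    have "nb E (S \<union> {y}) \<subseteq> ?N"
    proof
      fix z assume "z \<in> nb E (S \<union> {y})"
      then obtain c where c: "c \<in> S \<union> {y}" "(c, z) \<in> E" "z \<notin> S" "z \<noteq> y" by (auto simp: nb_iff)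
      have "(if c = y then x else c) \<in> S" using c(1) xS by auto
      moreover from this have "(if c = y then x else c) \<noteq> z" using c(3) by blast
      ultimately show "z \<in> ?N" using im[OF c(2,4)] c(3) unfolding nb_iff by blast
    qed
    moreover have "finite ?N" using NV finV finite_subset by blast
    ultimately have "card (nb E (S \<union> {y})) < 3" using S(3) card_mono le_less_trans by blast
    then have "(S \<union> {y}) \<union> nb E (S \<union> {y}) = V" using S(1) xy' by (intro kconnD[OF k3]) auto
    then show False using \<open>nb E (S \<union> {y}) \<subseteq> ?N\<close> S(1,4) NV by blast
  qed
  have nbS: "nb E S \<subseteq> ?N \<union> {y}"
  proof
    fix z assume "z \<in> nb E S"
    then obtain c where c: "c \<in> S" "(c, z) \<in> E" "z \<notin> S" by (auto simp: nb_iff)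
    then have "c \<noteq> y" "c \<noteq> z" using S(1) by auto
    then show "z \<in> ?N \<union> {y}" using im[OF c(2)] c by (cases "z = y") (auto simp: nb_iff)
  qed
  have "x \<in> ?N"
  proof (rule ccontr)
    assume xN: "x \<notin> ?N"
    have "y \<notin> nb E S"
    proof
      assume "y \<in> nb E S"
      then obtain c where c: "c \<in> S" "(c, y) \<in> E" by (auto simp: nb_iff)
      then have "c \<noteq> x" "c \<noteq> y" using \<open>x \<notin> S\<close> S(1) by auto
      then have "(c, x) \<in> ?E" unfolding contract_simps using c by (intro conjI exI[of _ c] exI[of _ y]) auto
      then show False using xN \<open>x \<notin> S\<close> c(1) unfolding nb_iff by blast
    qed
    then have "nb E S \<subseteq> ?N" using nbS by blast
    moreover have "finite ?N" using NV finV finite_subset by blast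
    ultimately have "card (nb E S) < 3" using S(3) card_mono le_less_trans by blast
    then have "S \<union> nb E S = V" using S(1,2) by (intro kconnD[OF k3]) auto
    then show False using \<open>y \<notin> nb E S\<close> S(1) xy' by blast
  qed
  have "\<exists>z. ?N = {x, z}"
  proof -
    have finN: "finite ?N" using NV finV finite_subset by blast
    have "card (?N - {x}) \<le> 1" using S(3) \<open>x \<in> ?N\<close> finN by simp
    then have "?N - {x} = {} \<or> (\<exists>z. ?N - {x} = {z})"
      using finN by (metis card_0_eq card_1_singletonE finite_Diff le_less less_one)
    then show ?thesis using \<open>x \<in> ?N\<close> by blast
  qed
  then obtain z where z: "?N = {x, z}" by blast
  have "?N \<inter> S = {}" by (auto simp: nb_def)
  show thesis
  proof (rule that[of z S])
    show "z \<in> V" using z NV by blast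
    show "S \<subseteq> V" "S \<noteq> {}" using S by auto
    show "nb E S \<subseteq> {x, y, z}" using nbS z by blast
    show "S \<inter> {x, y, z} = {}" using \<open>?N \<inter> S = {}\<close> z S(1) by blast
    show "S \<union> {x, y, z} \<noteq> V"
    proof
      assume eq: "S \<union> {x, y, z} = V"
      have "z \<noteq> y" "x \<noteq> y" using z NV by auto
      then have "S \<union> {x, z} = V - {y}" using eq S(1) by blast
      then show False using S(4) z by blast
    qed
  qed
qed

text \<open>An argument of Tutte. If every contraction fails, choose a smallest part \<open>D\<close> that the ends of an edge \<open>x y\<close>
  and a further vertex \<open>z\<close> cut off. It contains a neighbour \<open>v\<close> of \<open>z\<close>. The ends of the edge \<open>z v\<close> and some \<open>w\<close>
  also separate the graph, and one side \<open>K\<close> of that separation avoids the adjacent vertices \<open>x\<close> and \<open>y\<close>. Then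
  \<open>K \<inter> D\<close> is cut off by \<open>z\<close>, \<open>v\<close>, \<open>w\<close> and is smaller than \<open>D\<close>.\<close>

lemma three_connected_contraction:
  assumes k3: "kconn 3 V E" and ne: "E \<noteq> {}"
  shows "\<exists>x y. (x, y) \<in> E \<and> kconn 3 (pverts (contract_edge as_graph x y)) (parcs (contract_edge as_graph x y))"
proof (rule ccontr)
  assume neg: "\<not> ?thesis"
  define sep where "sep x y z D \<longleftrightarrow> (x, y) \<in> E \<and> z \<in> V \<and> D \<subseteq> V \<and> D \<noteq> {} \<and> nb E D \<subseteq> {x, y, z} \<and>
    D \<inter> {x, y, z} = {} \<and> D \<union> {x, y, z} \<noteq> V" for x y z D
  have ex: "\<exists>z D. sep x y z D" if xy: "(x, y) \<in> E" for x y
  proof -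
    have bad: "\<not> kconn 3 (pverts (contract_edge as_graph x y)) (parcs (contract_edge as_graph x y))" using neg xy by blast
    obtain z D where "z \<in> V" "D \<subseteq> V" "D \<noteq> {}" "nb E D \<subseteq> {x, y, z}" "D \<inter> {x, y, z} = {}" "D \<union> {x, y, z} \<noteq> V"
      using bad_contraction_imp_separation[OF k3 xy bad] .
    then have "sep x y z D" unfolding sep_def using xy by blast
    then show ?thesis by blast
  qed
  let ?P = "\<lambda>n. \<exists>x y z D. sep x y z D \<and> card D = n"
  have "\<exists>n. ?P n" using ne ex by fastforce
  then have "?P (LEAST n. ?P n)" by (rule LeastI_ex)
  then obtain x y z D where D: "sep x y z D" and "card D = (LEAST n. ?P n)" by blast
  then have minimal: "card D \<le> card D'" if "sep x' y' z' D'" for x' y' z' D'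
    using that Least_le[of ?P "card D'"] by metis
  note D' = D[unfolded sep_def]
  have finD: "finite D" using D' finV finite_subset by blast
  have xyV: "{x, y, z} \<subseteq> V" using D' arcD by blast
  have nbD: "nb E D = {x, y, z}" and "x \<noteq> z" "y \<noteq> z"
    using three_connected_nb[OF k3, of D x y z] D' xyV by blast+
  then have "z \<in> nb E D" by simp
  then obtain v where v: "v \<in> D" "(v, z) \<in> E" by (auto simp: nb_iff)
  then have zv: "(z, v) \<in> E" using arcD by blast
  obtain w D1 where D1: "sep z v w D1" using ex[OF zv] by blast
  note D1' = D1[unfolded sep_def]
  have wV: "{z, v, w} \<subseteq> V" using D1' arcD by blast
  define D2 where "D2 = V - D1 - {z, v, w}"
  have D2: "D2 \<noteq> {}" "D2 \<inter> {z, v, w} = {}" "D2 \<subseteq> V" "D1 \<inter> D2 = {}" using D1' wV unfolding D2_def by blast+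
  have no12: "(a, b) \<notin> E" if "a \<in> D1" "b \<in> D2" for a b
  proof
    assume "(a, b) \<in> E"
    then have "b \<in> nb E D1" using that D2(4) unfolding nb_iff by blast
    then show False using D1' that(2) D2(2) by blast
  qed
  have nbD2: "nb E D2 \<subseteq> {z, v, w}"
  proof
    fix u assume "u \<in> nb E D2"
    then obtain a where a: "a \<in> D2" "(a, u) \<in> E" "u \<notin> D2" by (auto simp: nb_iff)
    then have "u \<in> V" "u \<notin> D1" using no12 arcD by blast+
    then show "u \<in> {z, v, w}" using a(3) unfolding D2_def by blast
  qed
  have "\<exists>K K'. K \<noteq> {} \<and> K \<subseteq> V \<and> K' \<subseteq> V \<and> nb E K \<subseteq> {z, v, w} \<and> K \<inter> {z, v, w} = {} \<and> K' \<inter> {z, v, w} = {} \<and>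
      K' \<noteq> {} \<and> K \<inter> K' = {} \<and> x \<notin> K \<and> y \<notin> K"
  proof (cases "x \<notin> D1 \<and> y \<notin> D1")
    case True
    then show ?thesis using D1' D2 by (intro exI[of _ D1] exI[of _ D2]) simp
  next
    case False
    then have "x \<notin> D2 \<and> y \<notin> D2" using no12 D2(4) D' arcD by blast
    moreover have "D2 \<inter> D1 = {}" using D2(4) by blast
    ultimately show ?thesis using D1' D2 nbD2 by (intro exI[of _ D2] exI[of _ D1]) simp
  qed
  then obtain K K' where K: "K \<noteq> {}" "K \<subseteq> V" "nb E K \<subseteq> {z, v, w}" "K \<inter> {z, v, w} = {}"
    and K': "K' \<subseteq> V" "K' \<inter> {z, v, w} = {}" "K' \<noteq> {}" "K \<inter> K' = {}" and xK: "x \<notin> K" "y \<notin> K" by blast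
  have "K \<union> {z, v, w} \<noteq> V" using K' by blast
  then have "nb E K = {z, v, w}" using three_connected_nb[OF k3 K(2,1,3)] wV by blast
  then have "v \<in> nb E K" by simp
  then obtain k where k: "k \<in> K" "(k, v) \<in> E" by (auto simp: nb_iff)
  have "k \<in> D \<union> {x, y, z}" using nbD v(1) arcD[OF k(2)] unfolding nb_def by blast
  then have kD: "k \<in> D" using xK k(1) K(4) by blast
  have "sep z v w (K \<inter> D)" unfolding sep_def
  proof (intro conjI)
    show "(z, v) \<in> E" "w \<in> V" using zv wV by auto
    show "K \<inter> D \<subseteq> V" "K \<inter> D \<noteq> {}" using K(2) k(1) kD by auto
    show "K \<inter> D \<inter> {z, v, w} = {}" using K(4) by blast
    show "K \<inter> D \<union> {z, v, w} \<noteq> V" using K' by blast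
    show "nb E (K \<inter> D) \<subseteq> {z, v, w}"
    proof
      fix e assume "e \<in> nb E (K \<inter> D)"
      then obtain a where a: "a \<in> K" "a \<in> D" "(a, e) \<in> E" "e \<notin> K \<inter> D" by (auto simp: nb_iff)
      have "e \<in> K \<union> {z, v, w}" using K(3) a(1,3) unfolding nb_def by blast
      moreover have "e \<in> D \<union> {x, y, z}" using nbD a(2,3) unfolding nb_def by blast
      ultimately show "e \<in> {z, v, w}" using a(4) xK K(4) by blast
    qed
  qed
  then have "card D \<le> card (K \<inter> D)" by (rule minimal)
  moreover have "K \<inter> D \<subset> D" using v(1) K(4) by blast
  then have "card (K \<inter> D) < card D" by (rule psubset_card_mono[OF finD])
  ultimately show False by simp
qed

end

text \<open>The candidate models of \<open>W5\<close>, with the hub last.\<close>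

definition wheel_sets :: "'a set \<Rightarrow> 'a set \<Rightarrow> 'a set \<Rightarrow> 'a set \<Rightarrow> 'a set \<Rightarrow> nat \<Rightarrow> 'a set" where
  "wheel_sets A0 A1 A2 A3 A4 i =
     (if i = 0 then A0 else if i = 1 then A1 else if i = 2 then A2 else if i = 3 then A3 else A4)"

lemma wheel_model:
  assumes sym: "sym E" and V: "{a, b, c, d, h} \<subseteq> V" and dist: "distinct [a, b, c, d, h]"
    and E: "(a, b) \<in> E" "(b, c) \<in> E" "(c, d) \<in> E" "(d, a) \<in> E"
      "(h, a) \<in> E" "(h, b) \<in> E" "(h, c) \<in> E" "(h, d) \<in> E"
  shows "\<exists>f. model (pverts W5) (parcs W5) V E f"
proof -
  let ?f = "wheel_sets {a} {b} {c} {d} {h}"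
  have E': "(b, a) \<in> E" "(c, b) \<in> E" "(d, c) \<in> E" "(a, d) \<in> E"
      "(a, h) \<in> E" "(b, h) \<in> E" "(c, h) \<in> E" "(d, h) \<in> E"
    using E symD[OF sym] by blast+
  have "model (pverts W5) (parcs W5) V E ?f"
  proof (rule modelI)
    show "?f i \<subseteq> V" for i using V by (auto simp: wheel_sets_def)
    show "conn E (?f i)" for i by (auto simp: wheel_sets_def conn_single)
    show "?f i \<inter> ?f j = {}" if "i \<in> pverts W5" "j \<in> pverts W5" "i \<noteq> j" for i j
      using that dist by (auto simp: wheel_sets_def W5_def Let_def split: if_splits)
    fix i j assume "(i, j) \<in> parcs W5"
    then have "(i, j) \<in> {(0, 1), (1, 2), (2, 3), (3, 0), (4, 0), (4, 1), (4, 2), (4, 3),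
        (1, 0), (2, 1), (3, 2), (0, 3), (0, 4), (1, 4), (2, 4), (3, 4)}"
      by (auto simp: W5_def Let_def)
    then show "adj E (?f i) (?f j)"
      using E E' by (elim insertE emptyE) (simp_all add: wheel_sets_def adj_def)
  qed
  then show ?thesis by blast
qed

context fgraph
begin

text \<open>Each vertex misses at most one other, so the missing edges form a matching. The rim is chosen with the missing edges
  among its diagonals.\<close>

lemma three_connected_five_vertices:
  assumes k3: "kconn 3 V E" and card5: "card V = 5"
  shows "\<exists>f. model (pverts W5) (parcs W5) V E f"
proof -
  have nonadj: "(v, a) \<in> E \<or> (v, b) \<in> E" if "v \<in> V" "a \<in> V" "b \<in> V" "v \<noteq> a" "v \<noteq> b" "a \<noteq> b" for v a b
  proof (rule ccontr)
    assume neg: "\<not> ?thesis"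
    have "nb E {v} \<subseteq> V - {v, a, b}" using neg nb_in_V unfolding nb_def by blast
    then have "card (nb E {v}) \<le> card (V - {v, a, b})" using finV by (intro card_mono) auto
    also have "\<dots> = 2" using that finV card5 by (subst card_Diff_subset) auto
    finally have "{v} \<union> nb E {v} = V" using that by (intro kconnD[OF k3]) auto
    then show False using neg that unfolding nb_def by blast
  qed
  have "\<exists>a c. a \<in> V \<and> c \<in> V \<and> a \<noteq> c \<and> (\<forall>p \<in> V - {a, c}. (p, a) \<in> E \<and> (p, c) \<in> E)"
  proof (cases "\<exists>a \<in> V. \<exists>c \<in> V. a \<noteq> c \<and> (a, c) \<notin> E")
    case True
    then obtain a c where ac: "a \<in> V" "c \<in> V" "a \<noteq> c" "(a, c) \<notin> E" by blast
    then have ca: "(c, a) \<notin> E" using arcD by blast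
    have "(p, a) \<in> E \<and> (p, c) \<in> E" if "p \<in> V - {a, c}" for p
      using nonadj[of a c p] nonadj[of c a p] ac ca that arcD by blast
    then show ?thesis using ac by blast
  next
    case False
    obtain a c where "a \<in> V" "c \<in> V" "a \<noteq> c" using two_elements[of V] card5 by auto
    then show ?thesis using False by blast
  qed
  then obtain a c where ac: "a \<in> V" "c \<in> V" "a \<noteq> c"
    and adj_ac: "\<And>p. p \<in> V - {a, c} \<Longrightarrow> (p, a) \<in> E \<and> (p, c) \<in> E" by blast
  have "card (V - {a, c}) = 3" using ac finV card5 by (subst card_Diff_subset) auto
  then obtain p q r where pqr: "V - {a, c} = {p, q, r}" "p \<noteq> q" "q \<noteq> r" "p \<noteq> r"
    by (auto simp: card_3_iff)
  then have in_V: "p \<in> V - {a, c}" "q \<in> V - {a, c}" "r \<in> V - {a, c}" by auto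
  have hub: "\<exists>h b d. {h, b, d} \<subseteq> V - {a, c} \<and> h \<noteq> b \<and> h \<noteq> d \<and> b \<noteq> d \<and> (h, b) \<in> E \<and> (h, d) \<in> E"
  proof -
    consider "(p, q) \<notin> E" | "(p, q) \<in> E" "(p, r) \<in> E" | "(p, q) \<in> E" "(p, r) \<notin> E" by blast
    then show ?thesis
    proof cases
      case 1
      then have "(r, p) \<in> E" "(r, q) \<in> E"
        using nonadj[of p q r] nonadj[of q p r] in_V pqr(2-4) arcD by blast+
      then show ?thesis using in_V pqr(2-4) by (intro exI[of _ r] exI[of _ p] exI[of _ q]) auto
    next
      case 2
      then show ?thesis using in_V pqr(2-4) by (intro exI[of _ p] exI[of _ q] exI[of _ r]) auto
    next
      case 3
      then have "(q, p) \<in> E" "(q, r) \<in> E" using nonadj[of r p q] in_V pqr(2-4) arcD by blast+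
      then show ?thesis using in_V pqr(2-4) by (intro exI[of _ q] exI[of _ p] exI[of _ r]) auto
    qed
  qed
  then obtain h b d where h: "h \<in> V - {a, c}" "b \<in> V - {a, c}" "d \<in> V - {a, c}"
    "h \<noteq> b" "h \<noteq> d" "b \<noteq> d" "(h, b) \<in> E" "(h, d) \<in> E" by auto
  show ?thesis
  proof (rule wheel_model[OF sym, of a b c d h])
    show "{a, b, c, d, h} \<subseteq> V" using ac h by auto
    show "distinct [a, b, c, d, h]" using ac h by auto
    show "(a, b) \<in> E" "(c, d) \<in> E" using adj_ac[OF h(2)] adj_ac[OF h(3)] arcD by blast+
    show "(b, c) \<in> E" "(d, a) \<in> E" "(h, a) \<in> E" "(h, c) \<in> E"
      using adj_ac[OF h(2)] adj_ac[OF h(3)] adj_ac[OF h(1)] by auto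
  qed (use h in auto)
qed

end

lemma three_connected_imp_W5:
  assumes "fgraph V E" "kconn 3 V E" "card V \<ge> 5"
  shows "\<exists>f. model (pverts W5) (parcs W5) V E f"
  using assms
proof (induction "card V" arbitrary: V E rule: less_induct)
  case less
  interpret fgraph V E by fact
  show ?case
  proof (cases "card V = 5")
    case True
    then show ?thesis using three_connected_five_vertices less.prems(2) by blast
  next
    case False
    have "V \<noteq> {}" using less.prems(3) by auto
    then obtain v where v: "v \<in> V" by blast
    have "E \<noteq> {}"
    proof
      assume "E = {}"
      then have "nb E {v} = {}" by (auto simp: nb_def)
      then have "{v} \<union> nb E {v} = V" using v by (intro kconnD[OF less.prems(2)]) auto
      then have "V = {v}" using \<open>nb E {v} = {}\<close> by simp
      then show False using less.prems(3) by simp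
    qed
    then obtain x y where xy: "(x, y) \<in> E"
      and k3: "kconn 3 (pverts (contract_edge as_graph x y)) (parcs (contract_edge as_graph x y))"
      using three_connected_contraction[OF less.prems(2)] by blast
    let ?H = "contract_edge as_graph x y"
    have xyG: "(x, y) \<in> parcs as_graph" using xy by (simp add: as_graph_def)
    have "pair_graph ?H" using pair_graph_contract_edge[OF pair_graph_as_graph xyG] .
    then have fg: "fgraph (pverts ?H) (parcs ?H)" by (simp add: fgraph_def pair_graph_iff)
    have "card (pverts ?H) = card V - 1" using arcD[OF xy] by (simp add: contract_simps(1))
    then have "card (pverts ?H) < card V" "card (pverts ?H) \<ge> 5" using False less.prems(3) by simp_all
    then obtain f where "model (pverts W5) (parcs W5) (pverts ?H) (parcs ?H) f"
      using less.hyps fg k3 by blast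
    then have "\<exists>g. model (pverts W5) (parcs W5) (pverts as_graph) (parcs as_graph) g"
      by (rule model_contract_edge[OF pair_graph_as_graph xyG])
    then show ?thesis by (simp add: as_graph_def)
  qed
qed

section \<open>Suppressing the vertices of degree two\<close>

context fgraph
begin

text \<open>The arcs that leave a set are counted, not just its neighbours, so that the count also bounds the number of
  arcs to a single neighbour.\<close>

definition out :: "'a set \<Rightarrow> 'a rel" where
  "out K = {(k, u) \<in> E. k \<in> K \<and> u \<notin> K}"

lemma finite_E: "finite E"
  using wf finV finite_subset by blast

lemma finite_out: "finite (out K)"
  using finite_E by (rule finite_subset[rotated]) (auto simp: out_def)

lemma finite_nbrs: "finite (E `` {v})"
  by (rule finite_subset[OF _ finV]) (use arcD in blast)

text \<open>The set is built up vertex by vertex along its edges. Each new vertex uses up one outgoing arc and has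
  at most one further neighbour.\<close>

lemma card_out_le_2:
  assumes cn: "conn E K" and KV: "K \<subseteq> V" and deg: "\<And>v. v \<in> K \<Longrightarrow> card (E `` {v}) \<le> 2"
  shows "card (out K) \<le> 2"
proof -
  have finK: "finite K" using KV finV finite_subset by blast
  have "\<exists>J \<subseteq> K. card J = Suc n \<and> card (out J) \<le> 2" if "Suc n \<le> card K" for n
    using that
  proof (induction n)
    case 0
    obtain k where k: "k \<in> K" using conn_nonempty[OF cn] by blast
    have "out {k} \<subseteq> Pair k ` (E `` {k})" by (auto simp: out_def)
    then have "card (out {k}) \<le> card (Pair k ` (E `` {k}))" using finite_nbrs by (intro card_mono) auto
    also have "\<dots> \<le> 2" using card_image_le[OF finite_nbrs, of "Pair k" k] deg[OF k] by linarith
    finally show ?case using k by (intro exI[of _ "{k}"]) simp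
  next
    case (Suc n)
    then obtain J where J: "J \<subseteq> K" "card J = Suc n" "card (out J) \<le> 2" by auto
    have "J \<noteq> {}" using J(2) by auto
    then have "J \<inter> K \<noteq> {}" using J(1) by blast
    moreover have "\<not> K \<subseteq> J" using J(2) Suc.prems card_mono[of J K] finite_subset[OF J(1) finK] by auto
    ultimately obtain b a where ba: "b \<in> J" "a \<in> K" "a \<notin> J" "(b, a) \<in> E"
      using conn_cut[OF cn, of J] by blast
    have ab: "(a, b) \<in> E" using arcD[OF ba(4)] by blast
    let ?X = "(out J - {(b, a)}) \<union> Pair a ` (E `` {a} - {b})"
    have "out (insert a J) \<subseteq> ?X" using ba(1) by (auto simp: out_def)
    then have "card (out (insert a J)) \<le> card ?X"
      using finite_out finite_nbrs by (intro card_mono) auto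
    also have "\<dots> \<le> card (out J - {(b, a)}) + card (Pair a ` (E `` {a} - {b}))" by (rule card_Un_le)
    also have "\<dots> \<le> 1 + 1"
    proof (rule add_mono)
      have "(b, a) \<in> out J" using ba by (simp add: out_def)
      then show "card (out J - {(b, a)}) \<le> 1" using J(3) finite_out[of J] by simp
      have "card (E `` {a} - {b}) \<le> 1" using deg[OF ba(2)] ab finite_nbrs[of a] by simp
      then show "card (Pair a ` (E `` {a} - {b})) \<le> 1"
        using card_image_le[of "E `` {a} - {b}" "Pair a"] finite_nbrs[of a] by simp
    qed
    finally have "card (out (insert a J)) \<le> 2" by simp
    moreover have "card (insert a J) = Suc (Suc n)" using J(2) ba(3) finite_subset[OF J(1) finK] by simp
    ultimately show ?case using J(1) ba(2) by (intro exI[of _ "insert a J"]) simp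
  qed
  moreover have "Suc (card K - 1) = card K" using conn_nonempty[OF cn] finK by (simp add: card_gt_0_iff)
  ultimately obtain J where J: "J \<subseteq> K" "card J = card K" "card (out J) \<le> 2" by (metis order_refl)
  then have "J = K" using finK by (simp add: card_subset_eq)
  then show ?thesis using J(3) by simp
qed

lemma thin_unique_nbr:
  assumes K: "conn E K" "K \<subseteq> V" "\<And>v. v \<in> K \<Longrightarrow> card (E `` {v}) \<le> 2"
    and xy: "x \<in> nb E K" "y \<in> nb E K" "x \<noteq> y"
    and k: "k1 \<in> K" "k2 \<in> K" "(k1, x) \<in> E" "(k2, x) \<in> E"
  shows "k1 = k2"
proof (rule ccontr)
  assume "k1 \<noteq> k2"
  obtain k3 where k3: "k3 \<in> K" "(k3, y) \<in> E" using xy(2) by (auto simp: nb_iff)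
  have "{(k1, x), (k2, x), (k3, y)} \<subseteq> out K" using xy k k3 by (auto simp: out_def nb_iff)
  then have "card {(k1, x), (k2, x), (k3, y)} \<le> card (out K)" using finite_out by (rule card_mono[rotated])
  moreover have "card {(k1, x), (k2, x), (k3, y)} = 3" using \<open>k1 \<noteq> k2\<close> xy(3) by simp
  ultimately show False using card_out_le_2[OF K] by simp
qed

text \<open>A path \<open>C\<close> from \<open>x\<close> to \<open>y\<close> is represented by keeping \<open>x\<close> and letting the other vertex of the bag run through
  the path.\<close>

lemma thin_rooted_rep:
  assumes k2: "kconn 2 V E" and "C \<subseteq> V" "conn E C" "x \<in> V - C" "y \<in> V - C" "x \<noteq> y" "nb E C \<subseteq> {x, y}"
    and "\<And>v. v \<in> C \<Longrightarrow> card (E `` {v}) \<le> 2"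
  shows "rooted_rep E (C \<union> {x, y}) {x, y}"
  using assms(2-)
proof (induction "card C" arbitrary: C x y rule: less_induct)
  case less
  note CV = less.prems(1) and cn = less.prems(2) and x = less.prems(3) and y = less.prems(4)
    and xy = less.prems(5) and nbC = less.prems(6) and deg = less.prems(7)
  have finC: "finite C" using finV CV finite_subset by blast
  have nb_eq: "nb E C = {x, y}" using two_connected_nb[OF k2 CV conn_nonempty[OF cn] nbC x y xy] .
  then have nbs: "y \<in> nb E C" "x \<in> nb E C" by auto
  then obtain c where c: "c \<in> C" "(c, y) \<in> E" by (auto simp: nb_iff)
  have unique: "e = c" if "e \<in> C" "(y, e) \<in> E" for e
    using thin_unique_nbr[OF cn CV deg nbs xy[symmetric] that(1) c(1) _ c(2)] arcD[OF that(2)] by blast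
  have xc: "x \<noteq> c" using x c(1) by blast
  show ?case
  proof (rule rooted_rep_step[OF sym finC, where B' = "{x, c}"])
    show "card {x, y} \<le> 2" "card {x, c} \<le> 2" using card_length[of "[x, y]"] card_length[of "[x, c]"] by simp_all
    show "{x, y} \<inter> C = {}" using x y by blast
    show "{x, c} \<subseteq> {x, y} \<union> C" using c(1) by blast
    show "e \<in> {x, c}" if "b \<in> {x, y} - {x, c}" "e \<in> C" "(b, e) \<in> E" for b e
      using that unique[of e] by blast
    fix D assume D: "D \<in> comps E (C - {x, c})"
    note D' = compsD[OF D]
    have DC: "D \<subset> C" using D'(1) c(1) by blast
    show "rooted_rep E (D \<union> {x, c}) {x, c}"
    proof (rule less.hyps)
      show "card D < card C" using psubset_card_mono[OF finC DC] .
      show "D \<subseteq> V" using DC CV by blast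
      show "conn E D" by fact
      show "x \<in> V - D" "c \<in> V - D" "x \<noteq> c" using x c(1) CV D'(1) xc by auto
      show "card (E `` {v}) \<le> 2" if "v \<in> D" for v using deg that DC by blast
      show "nb E D \<subseteq> {x, c}"
      proof
        fix z assume z: "z \<in> nb E D"
        then obtain d where d: "d \<in> D" "(d, z) \<in> E" by (auto simp: nb_iff)
        have "z \<in> {x, y} \<union> {x, c}" using nb_comp[OF D] nbC z by blast
        moreover have "z \<noteq> y" using unique[of d] d D'(1) arcD[OF d(2)] by blast
        ultimately show "z \<in> {x, c}" by blast
      qed
    qed
  qed simp
qed

end

text \<open>A 2-connected counterexample to the converse direction. No pair of vertices can serve as the first bag, since for each pair some
  component cannot be reached from it.\<close>

locale critical = fgraph +
  assumes k2: "kconn 2 V E"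
    and no_start: "\<forall>x \<in> V. \<forall>y \<in> V - {x}.
      \<exists>C \<in> comps E (V - {x, y}). \<not> rooted_rep E (C \<union> {x, y}) {x, y}"
    and noF3: "\<nexists>f. model (pverts F3) (parcs F3) V E f"
    and noH3: "\<nexists>f. model (pverts H3) (parcs H3) V E f"
    and noW5: "\<nexists>f. model (pverts W5) (parcs W5) V E f"
    and card3: "card V \<ge> 3"
begin

definition "U = {v \<in> V. card (E `` {v}) \<ge> 3}"
text \<open>The maximal paths of vertices of degree two.\<close>

definition "threads = comps E (V - U)"
definition "linked p q \<longleftrightarrow> (p, q) \<in> E \<or> (\<exists>K \<in> threads. nb E K = {p, q})"
text \<open>The graph obtained by replacing each thread by an edge between its ends.\<close>

definition "suppressed = {(p, q). p \<in> U \<and> q \<in> U \<and> p \<noteq> q \<and> linked p q}"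

lemma U_sub: "U \<subseteq> V" and finU: "finite U"
  using finV by (auto simp: U_def)

lemma not_U: "v \<in> V \<Longrightarrow> v \<notin> U \<Longrightarrow> card (E `` {v}) \<le> 2"
  by (auto simp: U_def)

lemma bad_comp_meets_U:
  assumes "x \<in> V" "y \<in> V" "x \<noteq> y" "C \<in> comps E (V - {x, y})" "\<not> rooted_rep E (C \<union> {x, y}) {x, y}"
  shows "C \<inter> U \<noteq> {}"
proof
  assume CU: "C \<inter> U = {}"
  note C = compsD[OF assms(4)]
  have "nb E C \<subseteq> {x, y}" using C(3) nb_in_V[of C] by blast
  moreover have "card (E `` {v}) \<le> 2" if "v \<in> C" for v using that C(1) CU not_U by blast
  moreover have "C \<subseteq> V" "x \<in> V - C" "y \<in> V - C" using C(1) assms(1,2) by auto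
  ultimately have "rooted_rep E (C \<union> {x, y}) {x, y}"
    using thin_rooted_rep[OF k2 _ C(2) _ _ assms(3)] by blast
  then show False using assms(5) by blast
qed

text \<open>Otherwise \<open>U\<close> would fit into the first bag, and only threads would remain.\<close>

lemma card_U_ge_3: "card U \<ge> 3"
proof (rule ccontr)
  assume "\<not> card U \<ge> 3"
  then obtain T where T: "U \<subseteq> T" "T \<subseteq> V" "card T = 2"
    using exists_subset_between[of U 2 V] U_sub finV card3 by auto
  then obtain x y where xy: "T = {x, y}" "x \<noteq> y" by (auto simp: card_2_iff)
  have xyV: "x \<in> V" "y \<in> V" using T xy by auto
  obtain C where C: "C \<in> comps E (V - {x, y})" "\<not> rooted_rep E (C \<union> {x, y}) {x, y}"
    using no_start xyV xy(2) by blast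
  have "C \<inter> U \<noteq> {}" using bad_comp_meets_U[OF xyV xy(2) C] .
  then show False using compsD(1)[OF C(1)] T(1) xy(1) by blast
qed

lemma threadD:
  assumes "K \<in> threads"
  shows "K \<subseteq> V" "K \<inter> U = {}" "conn E K" "nb E K \<subseteq> U" "\<And>v. v \<in> K \<Longrightarrow> card (E `` {v}) \<le> 2"
proof -
  note K = compsD[OF assms[unfolded threads_def]]
  show "K \<subseteq> V" "K \<inter> U = {}" "conn E K" using K by auto
  show "nb E K \<subseteq> U" using K(3) nb_in_V[of K] by blast
  show "card (E `` {v}) \<le> 2" if "v \<in> K" for v using that K(1) not_U by blast
qed

text \<open>At most two arcs leave a thread, and by 2-connectivity they lead to different vertices.\<close>

lemma card_nb_thread:
  assumes "K \<in> threads"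
  shows "card (nb E K) = 2"
proof (rule antisym)
  note K = threadD[OF assms]
  have "nb E K \<subseteq> snd ` out K" by (force simp: nb_iff out_def)
  then have "card (nb E K) \<le> card (snd ` out K)" using finite_out by (intro card_mono) auto
  also have "\<dots> \<le> card (out K)" using finite_out by (rule card_image_le)
  also have "\<dots> \<le> 2" using card_out_le_2[OF K(3,1,5)] .
  finally show "card (nb E K) \<le> 2" .
  show "2 \<le> card (nb E K)"
  proof (rule ccontr)
    assume "\<not> 2 \<le> card (nb E K)"
    then have "K \<union> nb E K = V" using K(1) conn_nonempty[OF K(3)] by (intro kconnD[OF k2]) auto
    then have "U \<subseteq> nb E K" using K(2) U_sub by blast
    then have "card U \<le> card (nb E K)" using K(4) finU finite_subset by (intro card_mono) auto
    then show False using card_U_ge_3 \<open>\<not> 2 \<le> card (nb E K)\<close> by simp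
  qed
qed

lemma thread_ends:
  assumes "K \<in> threads"
  obtains p q where "nb E K = {p, q}" "p \<noteq> q" "p \<in> U" "q \<in> U"
  using card_nb_thread[OF assms] threadD(4)[OF assms] by (auto simp: card_2_iff)

lemma thread_at:
  assumes "v \<in> V" "v \<notin> U"
  obtains K where "K \<in> threads" "v \<in> K"
  using comp_exists[OF sym, of v "V - U"] assms unfolding threads_def by blast

text \<open>The pair \<open>{c, e}\<close> separates any thread between \<open>c\<close> and \<open>e\<close> from \<open>u\<close>. As \<open>u\<close> has degree at least three, the
  thread is the whole thin side of \<open>separating_pair_thin\<close>.\<close>

lemma thread_is_thin_side:
  assumes c: "c \<in> U" and e: "e \<in> U" and ce: "c \<noteq> e" and u: "u \<in> U" "u \<noteq> c" "u \<noteq> e"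
  obtains R where "\<forall>K \<in> threads. nb E K = {c, e} \<longrightarrow> K = R \<and> (c, e) \<notin> E"
proof -
  have ceV: "c \<in> V" "e \<in> V" using c e U_sub by auto
  obtain C where C: "C \<subseteq> V - {c, e}" "conn E C" "nb E C \<subseteq> {c, e}"
    and alt: "V - {c, e} - C = {} \<or> (c, e) \<notin> E \<and> conn E (V - {c, e} - C) \<and>
      (\<forall>v \<in> V - {c, e} - C. card (E `` {v}) \<le> 2)"
    using separating_pair_thin[OF k2 no_start noF3 noH3 ceV ce] .
  let ?R = "V - {c, e} - C"
  have uV: "u \<in> V - {c, e}" using u U_sub by auto
  have uC: "u \<in> C"
  proof (rule ccontr)
    assume "u \<notin> C"
    then have uR: "u \<in> ?R" using uV by blast
    then have "card (E `` {u}) \<le> 2" using alt by blast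
    then show False using u(1) by (simp add: U_def)
  qed
  have "K = ?R \<and> (c, e) \<notin> E" if K: "K \<in> threads" "nb E K = {c, e}" for K
  proof -
    note K' = threadD[OF K(1)]
    have cK: "c \<notin> K" "e \<notin> K" using K'(2) c e by auto
    have "C \<inter> K = {}"
    proof (rule ccontr)
      assume "C \<inter> K \<noteq> {}"
      moreover have "\<not> C \<subseteq> K" using uC u(1) K'(2) by blast
      ultimately obtain b a where ba: "b \<in> K" "a \<in> C" "a \<notin> K" "(b, a) \<in> E"
        using conn_cut[OF C(2), of K] by blast
      then have "a \<in> nb E K" unfolding nb_iff by blast
      then show False using K(2) C(1) ba(2) by blast
    qed
    then have KR: "K \<subseteq> ?R" using K'(1) cK by blast
    moreover have "K \<noteq> {}" using conn_nonempty[OF K'(3)] .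
    ultimately have R: "(c, e) \<notin> E" "conn E ?R" using alt by auto
    have "?R \<subseteq> K"
    proof (rule ccontr)
      assume "\<not> ?R \<subseteq> K"
      then obtain b a where ba: "b \<in> K" "a \<in> ?R" "a \<notin> K" "(b, a) \<in> E"
        using conn_cut[OF R(2), of K] KR \<open>K \<noteq> {}\<close> by blast
      then have "a \<in> nb E K" unfolding nb_iff by blast
      then show False using K(2) ba(2) by blast
    qed
    then show ?thesis using KR R(1) by blast
  qed
  then show ?thesis by (intro that ballI impI)
qed

text \<open>The vertex of \<open>U\<close> that is reached from \<open>c\<close> when one leaves through the neighbour \<open>n\<close> and follows the thread, if
  any.\<close>

definition link_end :: "'a \<Rightarrow> 'a \<Rightarrow> 'a \<Rightarrow> bool" where
  "link_end c n e \<longleftrightarrow> e \<in> U \<and> e \<noteq> c \<and> (n = e \<or> (\<exists>K \<in> threads. n \<in> K \<and> nb E K = {c, e}))"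

lemma link_end_exists:
  assumes "c \<in> U" "(c, n) \<in> E"
  shows "\<exists>e. link_end c n e"
proof (cases "n \<in> U")
  case True
  then show ?thesis using arcD[OF assms(2)] unfolding link_end_def by blast
next
  case False
  obtain K where K: "K \<in> threads" "n \<in> K" using thread_at[OF _ False] arcD[OF assms(2)] by blast
  have "c \<in> nb E K" using assms arcD[OF assms(2)] K threadD(2)[OF K(1)] unfolding nb_iff by blast
  moreover obtain p q where pq: "nb E K = {p, q}" "p \<noteq> q" "p \<in> U" "q \<in> U" using thread_ends[OF K(1)] .
  ultimately have "\<exists>e. nb E K = {c, e} \<and> e \<noteq> c \<and> e \<in> U" by (metis doubleton_eq_iff insertE singletonD)
  then show ?thesis using K unfolding link_end_def by blast
qed

text \<open>Two different connections between \<open>c\<close> and \<open>e\<close> would be two threads, or a thread and an edge, against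
  \<open>thread_is_thin_side\<close>. So suppressing vertices of degree two does not lower the other degrees.\<close>

lemma link_end_unique:
  assumes c: "c \<in> U" and n: "(c, n1) \<in> E" "(c, n2) \<in> E" and e: "link_end c n1 e" "link_end c n2 e"
  shows "n1 = n2"
proof -
  have e': "e \<in> U" "c \<noteq> e" using e(1) by (auto simp: link_end_def)
  have "card {c, e} \<le> 2" using card_length[of "[c, e]"] by simp
  then have "\<not> U \<subseteq> {c, e}" using card_U_ge_3 card_mono[of "{c, e}" U] by fastforce
  then obtain u where u: "u \<in> U" "u \<noteq> c" "u \<noteq> e" by blast
  obtain R where R: "\<forall>K \<in> threads. nb E K = {c, e} \<longrightarrow> K = R \<and> (c, e) \<notin> E"
    using thread_is_thin_side[OF c e'(1,2) u] .
  consider "n1 = e" "n2 = e" | K where "n1 = e \<or> n2 = e" "K \<in> threads" "nb E K = {c, e}"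
    | K1 K2 where "n1 \<in> K1" "K1 \<in> threads" "nb E K1 = {c, e}" "n2 \<in> K2" "K2 \<in> threads" "nb E K2 = {c, e}"
    using e unfolding link_end_def by blast
  then show ?thesis
  proof cases
    case 1
    then show ?thesis by simp
  next
    case 2
    then show ?thesis using R n by blast
  next
    case 3
    then have "K1 = K2" using R by blast
    note K = threadD[OF 3(2)]
    have nbs: "c \<in> nb E K1" "e \<in> nb E K1" using 3(3) by auto
    show ?thesis
      using thin_unique_nbr[OF K(3,1,5) nbs e'(2) 3(1)] 3(4) \<open>K1 = K2\<close> n arcD by blast
  qed
qed

lemma sym_suppressed: "sym suppressed"
  unfolding suppressed_def linked_def sym_def using arcD by (auto simp: insert_commute)

lemma fgraph_suppressed: "fgraph U suppressed"
  using finU sym_suppressed by unfold_locales (auto simp: suppressed_def irrefl_def)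

lemma card_suppressed_nbrs:
  assumes c: "c \<in> U"
  shows "card (suppressed `` {c}) \<ge> 3"
proof -
  obtain g where g: "\<And>n. (c, n) \<in> E \<Longrightarrow> link_end c n (g n)" using link_end_exists[OF c] by metis
  have "inj_on g (E `` {c})"
  proof (rule inj_onI)
    fix n1 n2 assume n: "n1 \<in> E `` {c}" "n2 \<in> E `` {c}" and eq: "g n1 = g n2"
    then have "(c, n1) \<in> E" "(c, n2) \<in> E" by auto
    then show "n1 = n2" using link_end_unique[OF c] g eq by metis
  qed
  then have "card (g ` (E `` {c})) = card (E `` {c})" by (rule card_image)
  moreover have "g ` (E `` {c}) \<subseteq> suppressed `` {c}"
  proof
    fix e assume "e \<in> g ` (E `` {c})"
    then obtain n where n: "(c, n) \<in> E" "e = g n" by auto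
    then have "link_end c n e" using g by simp
    then show "e \<in> suppressed `` {c}" using n(1) c unfolding link_end_def suppressed_def linked_def by auto
  qed
  then have "card (g ` (E `` {c})) \<le> card (suppressed `` {c})"
    using finU by (intro card_mono finite_subset[of "suppressed `` {c}" U]) (auto simp: suppressed_def)
  ultimately show ?thesis using c by (simp add: U_def)
qed

lemma suppressed_nbrs_sub: "suppressed `` {c} \<subseteq> U - {c}"
  by (auto simp: suppressed_def)

lemma card_U_ge_4: "card U \<ge> 4"
proof -
  obtain c where c: "c \<in> U" using card_U_ge_3 by fastforce
  have "card (suppressed `` {c}) \<le> card (U - {c})" using finU suppressed_nbrs_sub by (intro card_mono) auto
  then show ?thesis using card_suppressed_nbrs[OF c] c finU by simp
qed

text \<open>Each thread in \<open>J\<close> is contracted into an arbitrarily chosen one of its ends. The set \<open>J\<close> is a parameter because a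
  model of \<open>H3\<close> has to keep two threads as branch sets of their own.\<close>

definition absorb :: "'a set set \<Rightarrow> 'a \<Rightarrow> 'a set" where
  "absorb J p = insert p (\<Union> {K \<in> J. (SOME z. z \<in> nb E K) = p})"

lemma some_end: "K \<in> threads \<Longrightarrow> (SOME z. z \<in> nb E K) \<in> nb E K"
  by (rule thread_ends) (auto intro: someI[of "\<lambda>z. z \<in> nb E K"])

lemma absorb_sub: "J \<subseteq> threads \<Longrightarrow> p \<in> U \<Longrightarrow> absorb J p \<subseteq> V"
  using U_sub threadD(1) unfolding absorb_def by blast

lemma absorb_conn:
  assumes "J \<subseteq> threads" "p \<in> U"
  shows "conn E (absorb J p)"
proof (rule conn_avoidingI[OF sym])
  show "p \<in> absorb J p" by (simp add: absorb_def)
  fix B assume B: "B \<subseteq> absorb J p" "B \<noteq> {}" "p \<notin> B"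
  then obtain b where b: "b \<in> B" by blast
  then have "b \<in> absorb J p" "b \<noteq> p" using B by auto
  then obtain K where K: "K \<in> J" "(SOME z. z \<in> nb E K) = p" "b \<in> K" unfolding absorb_def by blast
  have KJ: "K \<in> threads" using K(1) assms(1) by blast
  have Ka: "K \<subseteq> absorb J p" using K unfolding absorb_def by blast
  show "\<exists>b \<in> B. \<exists>a \<in> absorb J p - B. (b, a) \<in> E"
  proof (cases "K \<subseteq> B")
    case True
    have "p \<in> nb E K" using some_end[OF KJ] K(2) by simp
    then obtain k where "k \<in> K" "(k, p) \<in> E" by (auto simp: nb_iff)
    then show ?thesis using True B(3) by (intro bexI[of _ k] bexI[of _ p]) (auto simp: absorb_def)
  next
    case False
    then obtain k a where "k \<in> B" "a \<in> K" "a \<notin> B" "(k, a) \<in> E"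
      using conn_cut[OF threadD(3)[OF KJ], of B] b K(3) by blast
    then show ?thesis using Ka by blast
  qed
qed

lemma absorb_disjoint:
  assumes J: "J \<subseteq> threads" and pq: "p \<in> U" "q \<in> U" "p \<noteq> q"
  shows "absorb J p \<inter> absorb J q = {}"
proof (rule ccontr)
  assume "absorb J p \<inter> absorb J q \<noteq> {}"
  then obtain z where z: "z \<in> absorb J p" "z \<in> absorb J q" by blast
  have notU: "K \<inter> U = {}" if "K \<in> J" for K using threadD(2) J that by blast
  show False
  proof (cases "z = p \<or> z = q")
    case True
    then show False using z pq notU unfolding absorb_def by blast
  next
    case False
    then obtain K L where KL: "K \<in> J" "(SOME z. z \<in> nb E K) = p" "z \<in> K"
      "L \<in> J" "(SOME z. z \<in> nb E L) = q" "z \<in> L" using z unfolding absorb_def by blast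
    have "K = L"
      using comps_disjoint[OF sym, of K "V - U" L] KL J unfolding threads_def by blast
    then show False using KL pq(3) by simp
  qed
qed

lemma absorb_disjoint_thread:
  assumes J: "J \<subseteq> threads" and L: "L \<in> threads" "L \<notin> J" and p: "p \<in> U"
  shows "absorb J p \<inter> L = {}"
proof -
  have "p \<notin> L" using threadD(2)[OF L(1)] p by blast
  moreover have "K \<inter> L = {}" if "K \<in> J" for K
    using comps_disjoint[OF sym, of K "V - U" L] L J that unfolding threads_def by blast
  ultimately show ?thesis unfolding absorb_def by blast
qed

lemma adj_thread_end:
  assumes "p \<in> nb E K" "p \<in> A"
  shows "adj E A K"
  using adj_nb_singleton[OF assms(1)] assms(2) unfolding adj_def by blast

lemma absorb_adj:
  assumes J: "J \<subseteq> threads" and pq: "(p, q) \<in> E \<or> (\<exists>K \<in> J. nb E K = {p, q})"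
  shows "adj E (absorb J p) (absorb J q)"
proof -
  have pp: "z \<in> absorb J z" for z by (simp add: absorb_def)
  from pq show ?thesis
  proof
    assume "(p, q) \<in> E"
    then show ?thesis using pp unfolding adj_def by blast
  next
    assume "\<exists>K \<in> J. nb E K = {p, q}"
    then obtain K where K: "K \<in> J" "nb E K = {p, q}" by blast
    have "(SOME z. z \<in> nb E K) \<in> {p, q}" using some_end[of K] K J by auto
    then have "K \<subseteq> absorb J p \<or> K \<subseteq> absorb J q" using K(1) unfolding absorb_def by blast
    moreover have "adj E (absorb J q) K" "adj E (absorb J p) K"
      using adj_thread_end[of q K] adj_thread_end[of p K] K(2) pp by simp_all
    ultimately show ?thesis using adj_mono[OF _ order_refl order_refl] adj_sym[OF sym] by metis
  qed
qed

lemma suppressed_model: "model U suppressed V E (absorb threads)"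
proof (rule modelI)
  show "absorb threads p \<subseteq> V" "conn E (absorb threads p)" if "p \<in> U" for p
    using that absorb_sub absorb_conn by auto
  show "absorb threads p \<inter> absorb threads q = {}" if "p \<in> U" "q \<in> U" "p \<noteq> q" for p q
    using absorb_disjoint that by blast
  show "adj E (absorb threads p) (absorb threads q)" if "(p, q) \<in> suppressed" for p q
    using that by (intro absorb_adj) (auto simp: suppressed_def linked_def)
qed

end

context critical
begin

text \<open>By \<open>separating_pair_thin\<close> all vertices of \<open>U\<close> other than \<open>p\<close> and \<open>q\<close> lie on one connected side \<open>C\<close> of the pair.
  The vertices of \<open>S\<close> with the threads at them would be a part of \<open>C\<close> without edges to the rest.\<close>

lemma suppressed_connected_off_pair:
  assumes pq: "p \<in> U" "q \<in> U" "p \<noteq> q" and S: "S \<subseteq> U" "nb suppressed S \<subseteq> {p, q}"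
    and s: "s \<in> S" "s \<notin> {p, q}" and u: "u \<in> U" "u \<notin> {p, q}"
  shows "u \<in> S"
proof (rule ccontr)
  assume "u \<notin> S"
  have pqV: "p \<in> V" "q \<in> V" using pq U_sub by auto
  obtain C where C: "C \<subseteq> V - {p, q}" "conn E C" "nb E C \<subseteq> {p, q}"
    and alt: "V - {p, q} - C = {} \<or> (p, q) \<notin> E \<and> conn E (V - {p, q} - C) \<and>
      (\<forall>v \<in> V - {p, q} - C. card (E `` {v}) \<le> 2)"
    using separating_pair_thin[OF k2 no_start noF3 noH3 pqV pq(3)] .
  have inC: "z \<in> C" if z: "z \<in> U" "z \<notin> {p, q}" for z
  proof (rule ccontr)
    assume "z \<notin> C"
    then have "z \<in> V - {p, q} - C" using z U_sub by blast
    then have "card (E `` {z}) \<le> 2" using alt by blast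
    then show False using z(1) by (simp add: U_def)
  qed
  let ?S = "S - {p, q}"
  define Z where "Z = ?S \<union> \<Union> {K \<in> threads. nb E K \<inter> ?S \<noteq> {}}"
  have closed: "b \<in> S" if "a \<in> ?S" "b \<in> U" "b \<notin> {p, q}" "linked a b" for a b
  proof (rule ccontr)
    assume "b \<notin> S"
    then have "(a, b) \<in> suppressed" using that S(1) by (auto simp: suppressed_def)
    then have "b \<in> nb suppressed S" using that(1) \<open>b \<notin> S\<close> unfolding nb_iff by blast
    then show False using S(2) that(3) by blast
  qed
  have "s \<in> Z \<inter> C" using s inC S(1) unfolding Z_def by blast
  moreover have "u \<in> C - Z"
  proof -
    have "u \<notin> K" if "K \<in> threads" for K using threadD(2)[OF that] u(1) by blast
    then show ?thesis using u inC \<open>u \<notin> S\<close> unfolding Z_def by blast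
  qed
  ultimately obtain b a where ba: "b \<in> Z" "b \<in> C" "a \<in> C" "a \<notin> Z" "(b, a) \<in> E"
    using conn_cut[OF C(2), of Z] by blast
  have a: "a \<in> V" "a \<notin> {p, q}" using ba(3) C(1) by auto
  consider "b \<in> ?S" | K where "K \<in> threads" "nb E K \<inter> ?S \<noteq> {}" "b \<in> K"
    using ba(1) unfolding Z_def by blast
  then show False
  proof cases
    case 1
    show False
    proof (cases "a \<in> U")
      case True
      then have "a \<in> S" using closed[OF 1 True a(2)] ba(5) by (simp add: linked_def)
      then show False using ba(4) a(2) unfolding Z_def by blast
    next
      case False
      obtain K where K: "K \<in> threads" "a \<in> K" using thread_at[OF a(1) False] .
      have "b \<notin> K" using threadD(2)[OF K(1)] 1 S(1) by blast
      then have "b \<in> nb E K" using K(2) ba(5) arcD unfolding nb_iff by blast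
      then have "a \<in> Z" using K 1 unfolding Z_def by blast
      then show False using ba(4) by blast
    qed
  next
    case 2
    have "a \<notin> K" using 2 ba(4) unfolding Z_def by blast
    then have anb: "a \<in> nb E K" using 2(3) ba(5) unfolding nb_iff by blast
    then have aU: "a \<in> U" using threadD(4)[OF 2(1)] by blast
    obtain t where t: "t \<in> nb E K" "t \<in> ?S" using 2(2) by blast
    have "t \<noteq> a" using t(2) ba(4) unfolding Z_def by blast
    have "card {t, a} = 2" using \<open>t \<noteq> a\<close> by simp
    then have "{t, a} = nb E K"
      using t(1) anb card_nb_thread[OF 2(1)] threadD(4)[OF 2(1)] finU finite_subset
      by (intro card_subset_eq) auto
    then have "linked t a" using 2(1) unfolding linked_def by blast
    then have "a \<in> S" using closed[OF t(2) aU a(2)] by blast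
    then show False using ba(4) a(2) unfolding Z_def by blast
  qed
qed

text \<open>A neighbourhood of at most two vertices is filled up to a pair \<open>{p, q}\<close> that avoids a given \<open>s \<in> S\<close> and a vertex
  \<open>u\<close> beyond; there is room for this as \<open>U\<close> has at least four elements.\<close>

lemma three_connected_suppressed: "kconn 3 U suppressed"
  unfolding kconn_def
proof (intro allI impI)
  fix S assume S: "S \<subseteq> U" "S \<noteq> {}" "card (nb suppressed S) < 3"
  have nbU: "nb suppressed S \<subseteq> U" by (auto simp: nb_def suppressed_def)
  show "S \<union> nb suppressed S = U"
  proof (rule ccontr)
    assume "S \<union> nb suppressed S \<noteq> U"
    then obtain u where u: "u \<in> U" "u \<notin> S" "u \<notin> nb suppressed S" using S(1) nbU by blast
    obtain s where s: "s \<in> S" using S(2) by blast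
    have "card (U - {s, u}) = card U - card {s, u}"
      using s u(1) S(1) by (intro card_Diff_subset) auto
    moreover have "card {s, u} \<le> 2" using card_length[of "[s, u]"] by simp
    ultimately have "2 \<le> card (U - {s, u})" using card_U_ge_4 by simp
    moreover have "nb suppressed S \<subseteq> U - {s, u}" using nbU u s by (auto simp: nb_def)
    moreover have "card (nb suppressed S) \<le> 2" using S(3) by simp
    ultimately obtain T where T: "nb suppressed S \<subseteq> T" "T \<subseteq> U - {s, u}" "card T = 2"
      using exists_subset_between[of "nb suppressed S" 2 "U - {s, u}"] finU by auto
    then obtain p q where pq: "T = {p, q}" "p \<noteq> q" by (auto simp: card_2_iff)
    have "p \<in> U" "q \<in> U" "s \<notin> {p, q}" "u \<notin> {p, q}" "nb suppressed S \<subseteq> {p, q}" using T pq(1) by auto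
    then have "u \<in> S" using suppressed_connected_off_pair[OF _ _ pq(2) S(1) _ s _ u(1)] by blast
    then show False using u(2) by blast
  qed
qed

lemma card_U_eq_4: "card U = 4"
proof (rule ccontr)
  assume "card U \<noteq> 4"
  then have "card U \<ge> 5" using card_U_ge_4 by simp
  then obtain f where "model (pverts W5) (parcs W5) U suppressed f"
    using three_connected_imp_W5[OF fgraph_suppressed three_connected_suppressed] by blast
  then show False using model_trans[OF _ suppressed_model] noW5 by blast
qed

lemma all_linked:
  assumes "p \<in> U" "q \<in> U" "p \<noteq> q"
  shows "linked p q"
proof -
  have "card (U - {p}) = 3" using card_U_eq_4 assms(1) finU by simp
  then have "suppressed `` {p} = U - {p}"
    using card_suppressed_nbrs[OF assms(1)] suppressed_nbrs_sub[of p] finU card_mono[OF _ suppressed_nbrs_sub[of p]]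
    by (intro card_subset_eq) auto
  then show ?thesis using assms by (auto simp: suppressed_def)
qed

text \<open>With the two threads as subdividing vertices and all others contracted, a \<open>K\<^sub>4\<close> on \<open>U\<close> with two adjacent edges
  subdivided remains, which is \<open>H3\<close>.\<close>

lemma threads_not_adjacent:
  assumes K: "K1 \<in> threads" "K2 \<in> threads" "nb E K1 = {p, q}" "nb E K2 = {q, r}"
    and ne: "p \<noteq> q" "q \<noteq> r" "p \<noteq> r"
  shows False
proof -
  have pqr: "p \<in> U" "q \<in> U" "r \<in> U" using threadD(4)[OF K(1)] threadD(4)[OF K(2)] K(3,4) by auto
  have "card {p, q, r} = 3" using ne by simp
  then have "\<not> U \<subseteq> {p, q, r}" using card_U_eq_4 card_mono[of "{p, q, r}" U] by fastforce
  then obtain s where s: "s \<in> U" "s \<noteq> p" "s \<noteq> q" "s \<noteq> r" by blast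
  let ?J = "threads - {K1, K2}"
  have J: "?J \<subseteq> threads" by blast
  let ?f = "absorb ?J"
  have ad: "adj E (?f a) (?f b)"
    if ab: "a \<in> U" "b \<in> U" "a \<noteq> b" "{a, b} \<noteq> {p, q}" "{a, b} \<noteq> {q, r}" for a b
  proof (rule absorb_adj[OF J])
    from all_linked[OF ab(1-3)] show "(a, b) \<in> E \<or> (\<exists>K \<in> ?J. nb E K = {a, b})"
      unfolding linked_def
    proof
      assume "\<exists>K \<in> threads. nb E K = {a, b}"
      then obtain K where K': "K \<in> threads" "nb E K = {a, b}" by blast
      then have "K \<noteq> K1" "K \<noteq> K2" using K(3,4) ab(4,5) by auto
      then show ?thesis using K' by blast
    qed blast
  qed
  have ends: "z \<in> ?f z" for z by (simp add: absorb_def)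
  have "{p, q} \<noteq> {q, r}" using ne by (auto simp: doubleton_eq_iff)
  then have "K1 \<noteq> K2" using K(3,4) by auto
  then have K12: "K1 \<inter> K2 = {}" using comps_disjoint[OF sym] K(1,2) unfolding threads_def by blast
  have th: "adj E (?f p) K1" "adj E (?f q) K1" "adj E (?f q) K2" "adj E (?f r) K2"
    using K(3,4) ends by (auto intro: adj_thread_end)
  have cn: "conn E (?f z)" "?f z \<subseteq> V" "?f z \<inter> K1 = {}" "?f z \<inter> K2 = {}" if "z \<in> U" for z
    using absorb_conn[OF J that] absorb_sub[OF J that]
      absorb_disjoint_thread[OF J K(1) _ that] absorb_disjoint_thread[OF J K(2) _ that] by auto
  have dis: "?f a \<inter> ?f b = {}" if "a \<in> U" "b \<in> U" "a \<noteq> b" for a b using absorb_disjoint[OF J that] .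
  have "\<exists>f. model (pverts H3) (parcs H3) V E f"
  proof (rule H3_model[OF sym, where ?A1.0 = "?f p" and ?A2.0 = "?f q" and ?A3.0 = "?f r"
        and ?A12.0 = K1 and ?A13.0 = "?f s" and ?A23.0 = K2])
    show "conn E (?f p)" "conn E (?f q)" "conn E (?f r)" "conn E (?f s)"
      "?f p \<subseteq> V" "?f q \<subseteq> V" "?f r \<subseteq> V" "?f s \<subseteq> V"
      "?f p \<inter> K1 = {}" "?f p \<inter> K2 = {}" "?f q \<inter> K1 = {}" "?f q \<inter> K2 = {}"
      "?f r \<inter> K1 = {}" "?f r \<inter> K2 = {}" "?f s \<inter> K2 = {}"
      using cn pqr s(1) by simp_all
    show "K1 \<inter> ?f s = {}" using cn(3)[OF s(1)] by (simp add: Int_commute)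
    show "conn E K1" "conn E K2" "K1 \<subseteq> V" "K2 \<subseteq> V" using threadD K(1,2) by simp_all
    show "?f p \<inter> ?f q = {}" "?f p \<inter> ?f r = {}" "?f p \<inter> ?f s = {}" "?f q \<inter> ?f r = {}"
      "?f q \<inter> ?f s = {}" "?f r \<inter> ?f s = {}" using dis pqr s ne by simp_all
    show "K1 \<inter> K2 = {}" by fact
    show "adj E (?f p) (?f r)" "adj E (?f p) (?f s)" "adj E (?f q) (?f s)" "adj E (?f r) (?f s)"
      using ad pqr s ne by (simp_all add: doubleton_eq_iff)
    show "adj E (?f p) K1" "adj E K1 (?f q)" "adj E (?f q) K2" "adj E K2 (?f r)"
      using th adj_sym[OF sym] by simp_all
  qed
  then show False using noH3 by blast
qed

lemma threads_on_opposite_edges: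
  obtains a b where "a \<in> U" "b \<in> U" "a \<noteq> b" "\<forall>K \<in> threads. nb E K = {a, b} \<or> nb E K = U - {a, b}"
proof (cases "threads = {}")
  case True
  obtain a b where "a \<in> U" "b \<in> U" "a \<noteq> b" using two_elements[of U] card_U_ge_4 by auto
  then show ?thesis using that True by blast
next
  case False
  then obtain K0 where K0: "K0 \<in> threads" by blast
  obtain a b where ab: "nb E K0 = {a, b}" "a \<noteq> b" "a \<in> U" "b \<in> U" using thread_ends[OF K0] .
  have "nb E K = {a, b} \<or> nb E K = U - {a, b}" if K: "K \<in> threads" for K
  proof -
    obtain p q where pq: "nb E K = {p, q}" "p \<noteq> q" "p \<in> U" "q \<in> U" using thread_ends[OF K] .
    show ?thesis
    proof (cases "{p, q} \<inter> {a, b} = {}")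
      case True
      have "card (U - {a, b}) = 2" using ab card_U_eq_4 by (subst card_Diff_subset) auto
      then have "{p, q} = U - {a, b}" using True pq(2-4) finU by (intro card_subset_eq) auto
      then show ?thesis using pq(1) by simp
    next
      case False
      show ?thesis
      proof (rule ccontr)
        assume neg: "\<not> ?thesis"
        then have ne: "{p, q} \<noteq> {a, b}" using pq(1) by simp
        have ab': "nb E K0 = {b, a}" using ab(1) by (simp add: insert_commute)
        have pq': "nb E K = {q, p}" using pq(1) by (simp add: insert_commute)
        consider "p = a" "q \<noteq> b" | "p = b" "q \<noteq> a" | "q = a" "p \<noteq> b" | "q = b" "p \<noteq> a"
          using False ne by auto
        then show False
        proof cases
          case 1
          show False by (rule threads_not_adjacent[OF K0 K ab' pq(1)[unfolded 1(1)]]) (use 1 ab(2) pq(2) in auto)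
        next
          case 2
          show False by (rule threads_not_adjacent[OF K0 K ab(1) pq(1)[unfolded 2(1)]]) (use 2 ab(2) pq(2) in auto)
        next
          case 3
          show False by (rule threads_not_adjacent[OF K0 K ab' pq'[unfolded 3(1)]]) (use 3 ab(2) pq(2) in auto)
        next
          case 4
          show False by (rule threads_not_adjacent[OF K0 K ab(1) pq'[unfolded 4(1)]]) (use 4 ab(2) pq(2) in auto)
        qed
      qed
    qed
  qed
  then show ?thesis using that ab by blast
qed

text \<open>What remains is a subdivision of \<open>K\<^sub>4\<close> with threads at most on the opposite edges \<open>{a, b}\<close> and \<open>{c, d}\<close>. It does have
  a representation, with the adjacent bags \<open>{a, b}\<close> and \<open>{c, d}\<close> and the threads attached to the bag of their
  ends.\<close>

lemma no_critical_graph: False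
proof -
  obtain a b where ab: "a \<in> U" "b \<in> U" "a \<noteq> b"
    and thr: "\<forall>K \<in> threads. nb E K = {a, b} \<or> nb E K = U - {a, b}" using threads_on_opposite_edges .
  have abV: "a \<in> V" "b \<in> V" using ab U_sub by auto
  have "card (U - {a, b}) = 2" using ab card_U_eq_4 by (subst card_Diff_subset) auto
  then obtain c d where cd: "U - {a, b} = {c, d}" "c \<noteq> d" by (auto simp: card_2_iff)
  have cdU: "c \<in> U" "d \<in> U" "c \<notin> {a, b}" "d \<notin> {a, b}" using cd(1) by auto
  obtain C where C: "C \<in> comps E (V - {a, b})" and bad: "\<not> rooted_rep E (C \<union> {a, b}) {a, b}"
    using no_start abV ab(3) by blast
  note C' = compsD[OF C]
  have nbC: "nb E C \<subseteq> {a, b}" using C'(3) nb_in_V[of C] by blast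
  have CU: "C \<inter> U \<noteq> {}" using bad_comp_meets_U[OF abV ab(3) C bad] .
  have finC: "finite C" using C'(1) finV finite_subset[of C V] by blast
  have absorbs: "K \<subseteq> C" if "K \<in> threads" "K \<inter> C \<noteq> {}" for K
  proof -
    have "K \<subseteq> V - {a, b}" using threadD(1,2)[OF that(1)] ab by blast
    then show ?thesis using comp_absorbs[OF sym C threadD(3)[OF that(1)]] that(2) by blast
  qed
  have reach: "f \<in> C" if "e \<in> C" "e \<in> U" "f \<in> U" "f \<notin> {a, b}" "e \<noteq> f" for e f
  proof (rule ccontr)
    assume fC: "f \<notin> C"
    from all_linked[OF that(2,3,5)] show False unfolding linked_def
    proof
      assume "(e, f) \<in> E"
      then have "f \<in> nb E C" using that(1) fC unfolding nb_iff by blast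
      then show False using nbC that(4) by blast
    next
      assume "\<exists>K \<in> threads. nb E K = {e, f}"
      then obtain K where K: "K \<in> threads" "nb E K = {e, f}" by blast
      then have "e \<in> nb E K" "f \<in> nb E K" by auto
      then obtain k l where kl: "k \<in> K" "(k, e) \<in> E" "l \<in> K" "(l, f) \<in> E" unfolding nb_iff by blast
      have kV: "k \<notin> {a, b}" using threadD(2)[OF K(1)] kl(1) ab by blast
      have "(e, k) \<in> E" using arcD[OF kl(2)] by blast
      then have "k \<in> C" using that(1) nbC kV unfolding nb_iff subset_iff by blast
      then have "l \<in> C" using absorbs[OF K(1)] kl(1,3) by blast
      then have "f \<in> nb E C" using kl(4) fC unfolding nb_iff by blast
      then show False using nbC that(4) by blast
    qed
  qed
  obtain e where e: "e \<in> C" "e \<in> U" using CU by blast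
  have cdC: "c \<in> C" "d \<in> C" using e reach[OF e, of c] reach[OF e, of d] cdU by blast+
  have left: "n \<in> {c, d}" if "z \<in> {a, b}" "n \<in> C" "(z, n) \<in> E" for z n
  proof (cases "n \<in> U")
    case True
    then show ?thesis using that(2) C'(1) cd(1) by blast
  next
    case False
    have "n \<in> V" using that(2) C'(1) by blast
    then obtain K where K: "K \<in> threads" "n \<in> K" using thread_at False by blast
    have zU: "z \<in> U" using that(1) ab by blast
    then have "z \<notin> K" using threadD(2)[OF K(1)] by blast
    then have "z \<in> nb E K" using K(2) arcD[OF that(3)] unfolding nb_iff by blast
    then have nbK: "nb E K = {a, b}" using thr K(1) that(1) by blast
    have "K \<inter> C \<noteq> {}" using K(2) that(2) by blast
    moreover have "\<not> C \<subseteq> K" using cdC(1) cdU(1) threadD(2)[OF K(1)] by blast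
    ultimately obtain k m where "k \<in> K" "m \<in> C" "m \<notin> K" "(k, m) \<in> E"
      using conn_cut[OF C'(2), of K] by blast
    then have "m \<in> nb E K" "m \<in> C" unfolding nb_iff by blast+
    then show ?thesis using nbK C'(1) by blast
  qed
  have "rooted_rep E (C \<union> {a, b}) {a, b}"
  proof (rule rooted_rep_step[OF sym finC, where B' = "{c, d}"])
    show "card {a, b} \<le> 2" "card {c, d} \<le> 2" using card_length[of "[a, b]"] card_length[of "[c, d]"] by simp_all
    show "{a, b} \<inter> C = {}" using C'(1) by blast
    show "{c, d} \<subseteq> {a, b} \<union> C" using cdC by blast
    show "n \<in> {c, d}" if "z \<in> {a, b} - {c, d}" "n \<in> C" "(z, n) \<in> E" for z n using left[of z n] that by blast
    fix D assume D: "D \<in> comps E (C - {c, d})"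
    note D' = compsD[OF D]
    show "rooted_rep E (D \<union> {c, d}) {c, d}"
    proof (rule thin_rooted_rep[OF k2])
      show "D \<subseteq> V" "conn E D" "c \<noteq> d" using D' C'(1) cd(2) by auto
      show "c \<in> V - D" "d \<in> V - D" using D'(1) cdU U_sub by auto
      show "nb E D \<subseteq> {c, d}"
      proof
        fix z assume z: "z \<in> nb E D"
        then obtain m where m: "m \<in> D" "(m, z) \<in> E" by (auto simp: nb_iff)
        have "m \<in> C" "m \<notin> {c, d}" using m(1) D'(1) by auto
        have "z \<in> {a, b} \<union> {c, d}" using nb_comp[OF D] nbC z by blast
        moreover have "z \<notin> {a, b}" using left[of z m] \<open>m \<in> C\<close> \<open>m \<notin> {c, d}\<close> arcD[OF m(2)] by blast
        ultimately show "z \<in> {c, d}" by blast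
      qed
      show "card (E `` {v}) \<le> 2" if "v \<in> D" for v
      proof -
        have "v \<in> V" "v \<notin> {a, b}" "v \<notin> {c, d}" using that D'(1) C'(1) by auto
        then show ?thesis using not_U cd(1) by blast
      qed
    qed
  qed simp
  then show False using bad by blast
qed

end

section \<open>The characterization\<close>

lemma two_connected_rooted_rep:
  assumes "fgraph V E" and k2: "kconn 2 V E"
    and noF3: "\<nexists>f. model (pverts F3) (parcs F3) V E f"
    and noH3: "\<nexists>f. model (pverts H3) (parcs H3) V E f"
    and noW5: "\<nexists>f. model (pverts W5) (parcs W5) V E f"
  shows "\<exists>B. rooted_rep E V B"
proof (rule ccontr)
  assume neg: "\<nexists>B. rooted_rep E V B"
  interpret fgraph V E by fact
  have "\<not> card V \<le> 2" using rooted_rep_leaf[OF finV] neg by blast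
  then have card3: "card V \<ge> 3" by simp
  have "\<exists>C \<in> comps E (V - {x, y}). \<not> rooted_rep E (C \<union> {x, y}) {x, y}" if "x \<in> V" "y \<in> V - {x}" for x y
  proof (rule ccontr)
    assume "\<not> ?thesis"
    moreover have "{x, y} \<subseteq> V" "card {x, y} \<le> 2" using that card_length[of "[x, y]"] by auto
    ultimately have "rooted_rep E V {x, y}" using rooted_rep_comps[OF sym finV] by blast
    then show False using neg by blast
  qed
  then interpret critical V E using k2 noF3 noH3 noW5 card3 by unfold_locales blast+
  show False by (rule no_critical_graph)
qed

lemma fgraph_induced:
  assumes "fgraph V E" "S \<subseteq> V"
  shows "fgraph S (E \<inter> S \<times> S)"
proof -
  interpret fgraph V E by fact
  show ?thesis
    using finV assms(2) finite_subset sym irr by unfold_locales (auto simp: sym_def irrefl_def)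
qed

text \<open>If the graph is not 2-connected, it falls into two smaller parts with at most one common vertex, and their
  representations are joined at bags that contain this vertex.\<close>

lemma no_forbidden_model_imp_rooted_rep:
  assumes "fgraph V E"
    and "\<nexists>f. model (pverts F3) (parcs F3) V E f"
    and "\<nexists>f. model (pverts H3) (parcs H3) V E f"
    and "\<nexists>f. model (pverts W5) (parcs W5) V E f"
  shows "\<exists>B. rooted_rep E V B"
  using assms
proof (induction "card V" arbitrary: V E rule: less_induct)
  case less
  interpret fgraph V E by fact
  show ?case
  proof (cases "kconn 2 V E")
    case True
    then show ?thesis using two_connected_rooted_rep less.prems by blast
  next
    case False
    then obtain C where C: "C \<subseteq> V" "C \<noteq> {}" "card (nb E C) < 2" "C \<union> nb E C \<noteq> V"
      unfolding kconn_def by blast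
    let ?S1 = "C \<union> nb E C" and ?S2 = "V - C"
    have sub: "?S1 \<subset> V" "?S2 \<subset> V" using C nb_in_V[of C] by auto
    have rep: "\<exists>B. rooted_rep E S B" if S: "S \<subset> V" for S
    proof -
      have SV: "S \<subseteq> V" using S by blast
      have "card S < card V" using psubset_card_mono[OF finV S] .
      moreover have "\<nexists>f. model (pverts F3) (parcs F3) S (E \<inter> S \<times> S) f"
        "\<nexists>f. model (pverts H3) (parcs H3) S (E \<inter> S \<times> S) f"
        "\<nexists>f. model (pverts W5) (parcs W5) S (E \<inter> S \<times> S) f"
        using less.prems(2-4) model_mono[OF _ SV Int_lower1] by blast+
      ultimately obtain B where "rooted_rep (E \<inter> S \<times> S) S B"
        using less.hyps fgraph_induced[OF less.prems(1) SV] by blast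
      then show ?thesis using rooted_rep_cong by blast
    qed
    have int: "?S1 \<inter> ?S2 = nb E C" using nb_in_V[of C] by (auto simp: nb_def)
    have "\<exists>B1 B2. rooted_rep E ?S1 B1 \<and> rooted_rep E ?S2 B2 \<and> nb E C \<subseteq> B1 \<inter> B2"
    proof (cases "nb E C = {}")
      case True
      then show ?thesis using rep[OF sub(1)] rep[OF sub(2)] by auto
    next
      case False
      have "finite (nb E C)" using nb_in_V finV finite_subset by blast
      then have "card (nb E C) = 1" using C(3) False by (simp add: less_Suc_eq numeral_2_eq_2)
      then obtain x where x: "nb E C = {x}" by (auto simp: card_1_singleton_iff)
      then have "x \<in> ?S1" "x \<in> ?S2" using int by auto
      then obtain B1 B2 where "x \<in> B1" "rooted_rep E ?S1 B1" "x \<in> B2" "rooted_rep E ?S2 B2"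
        using rep[OF sub(1)] rep[OF sub(2)] rooted_rep_bag_at by metis
      then show ?thesis using x by (intro exI[of _ B1] exI[of _ B2]) simp
    qed
    then obtain B1 B2 where B: "rooted_rep E ?S1 B1" "rooted_rep E ?S2 B2" "nb E C \<subseteq> B1 \<inter> B2" by blast
    have "rooted_rep E (?S1 \<union> ?S2) B1"
    proof (rule rooted_rep_join[OF sym B(1,2)])
      show "?S1 \<inter> ?S2 \<subseteq> B1 \<inter> B2" using int B(3) by simp
      fix u v assume uv: "u \<in> ?S1 - ?S2" "v \<in> ?S2 - ?S1" "(u, v) \<in> E"
      then have "u \<in> C" using nb_in_V[of C] by blast
      then have "v \<in> nb E C" using uv unfolding nb_iff by blast
      then show "u \<in> B1 \<and> v \<in> B2" using uv(2) by blast
    qed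
    moreover have "?S1 \<union> ?S2 = V" using C(1) nb_in_V[of C] by blast
    ultimately show ?thesis by auto
  qed
qed

lemma no_minor_if_la_strong_le_2:
  assumes G: "pair_graph G" and la: "la_strong G \<le> 2" and M: "pair_graph M"
    and tri: "(a, b) \<in> parcs M" "(b, c) \<in> parcs M" "(a, c) \<in> parcs M"
    and cut: "\<And>L R P Q. \<not> tree_cut (pverts M) (parcs M) a b L R P Q"
      "\<And>L R P Q. \<not> tree_cut (pverts M) (parcs M) b c L R P Q"
      "\<And>L R P Q. \<not> tree_cut (pverts M) (parcs M) a c L R P Q"
  shows "\<not> minor M G"
proof
  assume "minor M G"
  then obtain f where f: "model (pverts M) (parcs M) (pverts G) (parcs G) f"
    using minor_imp_model[OF _ G] by blast
  let ?P = "\<lambda>k :: nat. 1 \<le> k \<and> (\<exists>T :: nat pair_pre_digraph. undirected_tree T \<and> minor G (T \<boxtimes> complete_on {..<k}))"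
  have "\<exists>k. ?P k" using la_strong_exists[OF G] .
  then have "?P (la_strong G)" unfolding la_strong_def by (rule LeastI_ex)
  then obtain T :: "nat pair_pre_digraph" where T: "undirected_tree T"
    "minor G (T \<boxtimes> complete_on {..<la_strong G})" by blast
  have "pair_graph (T \<boxtimes> complete_on {..<la_strong G})"
    using T(1) by (intro pair_graph_strong_product pair_graph_complete_on) (auto simp: undirected_tree_def)
  then obtain g where "model (pverts G) (parcs G) (pverts (T \<boxtimes> complete_on {..<la_strong G}))
      (parcs (T \<boxtimes> complete_on {..<la_strong G})) g"
    using minor_imp_model[OF T(2)] by blast
  from model_trans[OF f this] show False
    using no_model_in_tree_product[OF T(1) la M tri cut] by blast
qed

theorem theorem6p1:
  fixes G :: "'a pair_pre_digraph"
  assumes "pair_graph G"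
  shows "la_strong G \<le> 2 \<longleftrightarrow> \<not> minor F3 G \<and> \<not> minor H3 G \<and> \<not> minor W5 G"
proof
  assume la: "la_strong G \<le> 2"
  have "\<not> minor F3 G"
    by (rule no_minor_if_la_strong_le_2[OF assms la pair_graph_F3 _ _ _ F3_no_tree_cut])
      (simp_all add: F3_def Let_def)
  moreover have "\<not> minor H3 G"
    by (rule no_minor_if_la_strong_le_2[OF assms la pair_graph_H3 _ _ _ H3_no_tree_cut])
      (simp_all add: H3_explicit Let_def)
  moreover have "\<not> minor W5 G"
    by (rule no_minor_if_la_strong_le_2[OF assms la pair_graph_W5 _ _ _ W5_no_tree_cut])
      (simp_all add: W5_def Let_def)
  ultimately show "\<not> minor F3 G \<and> \<not> minor H3 G \<and> \<not> minor W5 G" by blast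
next
  assume "\<not> minor F3 G \<and> \<not> minor H3 G \<and> \<not> minor W5 G"
  then have "\<nexists>f. model (pverts F3) (parcs F3) (pverts G) (parcs G) f"
    "\<nexists>f. model (pverts H3) (parcs H3) (pverts G) (parcs G) f"
    "\<nexists>f. model (pverts W5) (parcs W5) (pverts G) (parcs G) f"
    using model_imp_minor[OF _ assms] pair_graph_F3 pair_graph_H3 pair_graph_W5 by blast+
  moreover have "fgraph (pverts G) (parcs G)" using assms by (simp add: fgraph_def pair_graph_iff)
  ultimately obtain B where "rooted_rep (parcs G) (pverts G) B"
    using no_forbidden_model_imp_rooted_rep by blast
  then have "\<exists>T :: nat pair_pre_digraph. undirected_tree T \<and> minor G (T \<boxtimes> complete_on {..<2 :: nat})"
    by (rule rooted_rep_imp_minor[OF assms])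
  then show "la_strong G \<le> 2" unfolding la_strong_def by (intro Least_le) simp
qed

end
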